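(* Let $(S,\mathcal{S},\hat{\mathcal{S}})$ be a localized Borel space and let $\xi$ be an atomless completely random signed measure on $S$, with almost sure representation $\xi(B)=\alpha(B)+\int_{\mathbb{R}\setminus\{0\}}x\,\Psi(B\times dx)$, $B\in\hat{\mathcal{S}}$. Then the random measures $\xi_+$ and $\xi_-$ of the Jordan decomposition of $\xi$ are independent atomless completely random measures. Moreover, almost surely $$\xi_+(B)=\alpha_+(B)+\int_0^\infty x\,\Psi(B\times dx),\quad B\in\hat{\mathcal{S}},$$ $$\xi_-(B)=\alpha_-(B)-\int_{-\infty}^0 x\,\Psi(B\times dx),\quad B\in\hat{\mathcal{S}}.$$
   Context: A localized Borel space $(S,\mathcal{S},\hat{\mathcal{S}})$ consists of a Borel space $(S,\mathcal{S})$ and a localizing ring $\hat{\mathcal{S}}$, i.e. a ring $\hat{\mathcal{S}}\subset\mathcal{S}$ such that $B\cap C\in\hat{\mathcal{S}}$ for all $B\in\hat{\mathcal{S}}$, $C\in\mathcal{S}$, and $\hat{\mathcal{S}}=\bigcup_n(\mathcal{S}\cap S_n)$ for some sets $S_n\uparrow S$ in $\hat{\mathcal{S}}$. $\mathcal{M}_S$ is the space of measures on $(S,\mathcal{S})$ finite on $\hat{\mathcal{S}}$, with the $\sigma$-algebra generated by $\mu\mapsto\mu(B)$, $B\in\mathcal{S}$; a random measure is an $\mathcal{M}_S$-valued random element. $\mathsf{M}_S$ is the space of countably additive set functions $\mu:\hat{\mathcal{S}}\to\mathbb{R}$ (sums over disjoint sets converging absolutely), with the $\sigma$-algebra generated by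 $\mu\mapsto\mu(B)$, $B\in\hat{\mathcal{S}}$; a random signed measure is an $\mathsf{M}_S$-valued random element. A random signed measure (resp. random measure) is completely random if its values on any finitely many disjoint sets of $\hat{\mathcal{S}}$ are jointly independent. It is called atomless if it has no fixed atoms, i.e. no $s\in S$ with $\mathbb{P}(\xi(\{s\})\neq0)>0$. Every atomless completely random signed measure has an almost surely unique representation $\xi(B)=\alpha(B)+\int_{\mathbb{R}\setminus\{0\}}x\,\Psi(B\times dx)$, $B\in\hat{\mathcal{S}}$, where $\alpha\in\mathsf{M}_S$ is the difference of two deterministic atomless measures in $\mathcal{M}_S$ and $\Psi$ is a Poisson process on $S\times(\mathbb{R}\setminus\{0\})$ with intensity $F$ satisfying $\int(1\wedge|x|)F(B\times dx)<\infty$ for $B\in\hat{\mathcal{S}}$ and $F(\{s\}\times(\mathbb{R}\setminus\{0\}))=0$ for $s\in S$. The Jordan decomposition of $\mu\in\mathsf{M}_S$ consists of the measures $\mu_\pm\in\mathcal{M}_S$ with $\mu_+(B)=\sup_{E\in\mathcal{S},E\subset B}\mu(E)$ and $\mu_-(B)=\sup_{E\in\mathcal{S},E\subset B}-\mu(E)$ for $B\in\hat{\mathcal{S}}$; $\xi_\pm$ is defined $\omega$-wise, and $\alpha_\pm$ is the Jordan decomposition of $\alpha$. *)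

theory Defs
  imports "HOL-Probability.Probability"
begin

definition borel_space :: "'a measure \<Rightarrow> bool" where
  "borel_space S \<longleftrightarrow>
     (\<exists>A \<in> sets (borel :: real measure). \<exists>f g.
        f \<in> S \<rightarrow>\<^sub>M restrict_space borel A \<and> g \<in> restrict_space borel A \<rightarrow>\<^sub>M S \<and>
        (\<forall>s\<in>space S. g (f s) = s) \<and> (\<forall>x\<in>A. f (g x) = x))"

text \<open>Only the measurable structure of \<open>S\<close> matters here and below; its measure is ignored.\<close>

locale localized_borel_space = ring_of_sets "space S" R
  for S :: "'a measure" and R :: "'a set set" +
  assumes borel_space: "borel_space S"
    and ring_measurable: "R \<subseteq> sets S"
    and ring_ideal: "\<And>B C. B \<in> R \<Longrightarrow> C \<in> sets S \<Longrightarrow> B \<inter> C \<in> R"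
    and localizing: "\<exists>U :: nat \<Rightarrow> 'a set. range U \<subseteq> R \<and> incseq U \<and> (\<Union>n. U n) = space S \<and>
           R = (\<Union>n. {C \<inter> U n | C. C \<in> sets S})"

definition locally_finite_measures :: "'a measure \<Rightarrow> 'a set set \<Rightarrow> 'a measure measure" where
  "locally_finite_measures S R =
     (SUP B\<in>sets S. vimage_algebra {\<mu>. sets \<mu> = sets S \<and> (\<forall>B\<in>R. emeasure \<mu> B < \<infinity>)}
                       (\<lambda>\<mu>. emeasure \<mu> B) borel)"

lemma space_locally_finite_measures:
  "space (locally_finite_measures S R) = {\<mu>. sets \<mu> = sets S \<and> (\<forall>B\<in>R. emeasure \<mu> B < \<infinity>)}"
  by (auto simp: locally_finite_measures_def space_Sup_eq_UN)

text \<open>Set functions on \<open>R\<close> are total functions on \<open>'a set\<close> that are \<^const>\<open>undefined\<close>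
  outside \<open>R\<close>. The value \<open>0\<close> at the empty set is forced by summability of the constant
  sequence.\<close>

definition local_signed_measure :: "'a set set \<Rightarrow> ('a set \<Rightarrow> real) \<Rightarrow> bool" where
  "local_signed_measure R \<mu> \<longleftrightarrow> \<mu> \<in> extensional R \<and>
     (\<forall>A :: nat \<Rightarrow> 'a set. range A \<subseteq> R \<longrightarrow> disjoint_family A \<longrightarrow> (\<Union>n. A n) \<in> R \<longrightarrow>
        summable (\<lambda>n. \<bar>\<mu> (A n)\<bar>) \<and> (\<lambda>n. \<mu> (A n)) sums \<mu> (\<Union>n. A n))"

definition local_signed_measures :: "'a set set \<Rightarrow> ('a set \<Rightarrow> real) measure" where
  "local_signed_measures R =
     (SUP B\<in>R. vimage_algebra {\<mu>. local_signed_measure R \<mu>} (\<lambda>\<mu>. \<mu> B) borel)"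

lemma space_local_signed_measures:
  "R \<noteq> {} \<Longrightarrow> space (local_signed_measures R) = {\<mu>. local_signed_measure R \<mu>}"
  by (auto simp: local_signed_measures_def space_Sup_eq_UN)

abbreviation random_measure ::
  "'w measure \<Rightarrow> 'a measure \<Rightarrow> 'a set set \<Rightarrow> ('w \<Rightarrow> 'a measure) \<Rightarrow> bool" where
  "random_measure \<Omega> S R \<xi> \<equiv> \<xi> \<in> \<Omega> \<rightarrow>\<^sub>M locally_finite_measures S R"

abbreviation random_signed_measure ::
  "'w measure \<Rightarrow> 'a set set \<Rightarrow> ('w \<Rightarrow> 'a set \<Rightarrow> real) \<Rightarrow> bool" where
  "random_signed_measure \<Omega> R \<xi> \<equiv> \<xi> \<in> \<Omega> \<rightarrow>\<^sub>M local_signed_measures R"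

text \<open>The next two notions apply to a random signed measure \<open>\<xi>\<close> directly, and to a random
  measure \<open>\<xi>\<close> through \<open>\<lambda>\<omega>. emeasure (\<xi> \<omega>)\<close>.\<close>

definition completely_random ::
  "'w measure \<Rightarrow> 'a set set \<Rightarrow> ('w \<Rightarrow> 'a set \<Rightarrow> 'b::topological_space) \<Rightarrow> bool" where
  "completely_random \<Omega> R \<xi> \<longleftrightarrow>
     (\<forall>(n::nat) A. A ` {..<n} \<subseteq> R \<longrightarrow> disjoint_family_on A {..<n} \<longrightarrow>
        prob_space.indep_vars \<Omega> (\<lambda>_. borel) (\<lambda>i \<omega>. \<xi> \<omega> (A i)) {..<n})"

definition atomless ::
  "'w measure \<Rightarrow> 'a measure \<Rightarrow> ('w \<Rightarrow> 'a set \<Rightarrow> 'b::zero) \<Rightarrow> bool" where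
  "atomless \<Omega> S \<xi> \<longleftrightarrow> \<not> (\<exists>s\<in>space S. measure \<Omega> {\<omega> \<in> space \<Omega>. \<xi> \<omega> {s} \<noteq> 0} > 0)"

definition jordan_pos :: "'a measure \<Rightarrow> 'a set set \<Rightarrow> ('a set \<Rightarrow> real) \<Rightarrow> 'a measure" where
  "jordan_pos S R \<mu> = (THE \<nu>. \<nu> \<in> space (locally_finite_measures S R) \<and>
     (\<forall>B\<in>R. enn2ereal (emeasure \<nu> B) = (SUP E\<in>{E \<in> sets S. E \<subseteq> B}. ereal (\<mu> E))))"

definition jordan_neg :: "'a measure \<Rightarrow> 'a set set \<Rightarrow> ('a set \<Rightarrow> real) \<Rightarrow> 'a measure" where
  "jordan_neg S R \<mu> = (THE \<nu>. \<nu> \<in> space (locally_finite_measures S R) \<and>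
     (\<forall>B\<in>R. enn2ereal (emeasure \<nu> B) = (SUP E\<in>{E \<in> sets S. E \<subseteq> B}. ereal (- \<mu> E))))"

text \<open>A Poisson process with intensity \<open>F\<close>, defined for arbitrary \<open>F\<close>: no localizing ring is
  needed, and sets of infinite intensity carry infinitely many points. The Poisson probabilities
  are written out because \<^const>\<open>poisson_pmf\<close> requires a positive rate.\<close>

definition poisson_process ::
  "'w measure \<Rightarrow> 'b measure \<Rightarrow> ('w \<Rightarrow> 'b measure) \<Rightarrow> bool" where
  "poisson_process \<Omega> F \<Psi> \<longleftrightarrow>
     (\<forall>\<omega>\<in>space \<Omega>. sets (\<Psi> \<omega>) = sets F \<and>
        (\<forall>C\<in>sets F. emeasure (\<Psi> \<omega>) C \<in> insert \<infinity> (range of_nat))) \<and>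
     (\<forall>C\<in>sets F. (\<lambda>\<omega>. emeasure (\<Psi> \<omega>) C) \<in> borel_measurable \<Omega>) \<and>
     (\<forall>C\<in>sets F. emeasure F C < \<infinity> \<longrightarrow>
        (\<forall>k::nat. measure \<Omega> {\<omega> \<in> space \<Omega>. emeasure (\<Psi> \<omega>) C = of_nat k} =
           measure F C ^ k / fact k * exp (- measure F C))) \<and>
     (\<forall>C\<in>sets F. emeasure F C = \<infinity> \<longrightarrow> (AE \<omega> in \<Omega>. emeasure (\<Psi> \<omega>) C = \<infinity>)) \<and>
     completely_random \<Omega> (sets F) (\<lambda>\<omega>. emeasure (\<Psi> \<omega>))"

abbreviation punctured_line :: "real measure" where
  "punctured_line \<equiv> restrict_space borel (- {0})"

text \<open>The measure \<open>N(B \<times> dx)\<close> on the punctured line.\<close>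

definition slice :: "('a \<times> real) measure \<Rightarrow> 'a set \<Rightarrow> real measure" where
  "slice N B = distr (restrict_space N (B \<times> - {0})) punctured_line snd"

lemma emeasure_slice:
  assumes N: "sets N = sets (S \<Otimes>\<^sub>M punctured_line)"
    and B: "B \<in> sets S" and A: "A \<in> sets punctured_line"
  shows "emeasure (slice N B) A = emeasure N (B \<times> A)"
proof -
  have N_space: "space N = space S \<times> - {0}"
    using sets_eq_imp_space_eq[OF N] by (simp add: space_pair_measure space_restrict_space)
  have line: "- {0} \<in> sets punctured_line"
    using sets.top[of punctured_line] by (simp add: space_restrict_space)
  have snd: "snd \<in> restrict_space N (B \<times> - {0}) \<rightarrow>\<^sub>M punctured_line"
    using measurable_snd[of S punctured_line] measurable_cong_sets[OF N refl]
    by (auto intro: measurable_restrict_space1)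
  have sub: "A \<subseteq> - {0}" and BS: "B \<subseteq> space S"
    using sets.sets_into_space[OF A] sets.sets_into_space[OF B]
    by (auto simp: space_restrict_space)
  have "snd -` A \<inter> space (restrict_space N (B \<times> - {0})) = B \<times> A"
    using sub BS N_space by (auto simp: space_restrict_space)
  moreover have "(B \<times> - {0}) \<inter> space N \<in> sets N"
    using B line by (auto simp: N intro!: sets.Int pair_measureI)
  ultimately show ?thesis
    using sub A snd by (auto simp: slice_def emeasure_distr intro!: emeasure_restrict_space)
qed

definition poisson_representation ::
  "'w measure \<Rightarrow> 'a measure \<Rightarrow> 'a set set \<Rightarrow> ('w \<Rightarrow> 'a set \<Rightarrow> real) \<Rightarrow>
   ('a set \<Rightarrow> real) \<Rightarrow> ('a \<times> real) measure \<Rightarrow> ('w \<Rightarrow> ('a \<times> real) measure) \<Rightarrow> bool" where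
  "poisson_representation \<Omega> S R \<xi> \<alpha> F \<Psi> \<longleftrightarrow>
     \<alpha> \<in> space (local_signed_measures R) \<and>
     (\<exists>\<mu> \<in> space (locally_finite_measures S R). \<exists>\<nu> \<in> space (locally_finite_measures S R).
        (\<forall>s\<in>space S. emeasure \<mu> {s} = 0 \<and> emeasure \<nu> {s} = 0) \<and>
        (\<forall>B\<in>R. \<alpha> B = measure \<mu> B - measure \<nu> B)) \<and>
     sets F = sets (S \<Otimes>\<^sub>M punctured_line) \<and>
     (\<forall>B\<in>R. (\<integral>\<^sup>+x. ennreal (min 1 \<bar>x\<bar>) \<partial>slice F B) < \<infinity>) \<and>
     (\<forall>s\<in>space S. emeasure F ({s} \<times> - {0}) = 0) \<and>
     poisson_process \<Omega> F \<Psi> \<and>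
     (AE \<omega> in \<Omega>. \<forall>B\<in>R. \<xi> \<omega> B = \<alpha> B + (\<integral>x. x \<partial>slice (\<Psi> \<omega>) B))"

end

(* The random part of xi is a sum of point masses x at the points (s, x) of Psi. Almost surely no s
   carries both positive and negative marks, and only countably many s carry any, so the positive
   and the negative jumps live on disjoint countable sets, which the diffuse set function alpha does
   not charge. Evaluating the supremum that defines the positive variation on sets chosen separately
   on and off these countable sets gives the two formulas. They express xi_+ and xi_- up to null
   sets through the restrictions of Psi to positive and to negative marks, and complete randomness
   of Psi makes the sigma-algebras generated by its restrictions to disjoint sets independent. *)

theory Submission
  imports Defs
begin

section \<open>The Jordan decomposition of a local signed measure\<close>

text \<open>Every \<open>\<xi> \<omega>\<close> must have a Jordan decomposition, and this
  decomposition must depend measurably on \<open>\<omega>\<close>, on the whole sample space: the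
  probability space is not assumed complete, so the almost sure formulas can supply neither.
  Existence rests on the finiteness of the positive variation on the ring. Measurability is delicate
  because the variation is an uncountable supremum; regularity of finite measures on the real line,
  into which \<open>S\<close> embeds, yields one countable family of sets that replaces it for all
  set functions simultaneously. The other obstacle is infinite mass. Marks may accumulate at 0 and
  the whole of \<open>S\<close> may carry infinitely many points, so statements about atoms are
  proved after truncation to \<open>U n\<close> and to marks of modulus above
  \<open>1 / (n + 1)\<close>, where the intensity is finite and the counts are almost surely natural
  numbers. Moreover \<open>poisson_process\<close> only says that \<open>\<Psi>\<close> is
  integer-valued; that it lives on atoms has to be derived.\<close>

definition ring_additive :: "'a set set \<Rightarrow> ('a set \<Rightarrow> real) \<Rightarrow> bool" where
  "ring_additive R \<mu> \<longleftrightarrow>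
     (\<forall>A :: nat \<Rightarrow> 'a set. range A \<subseteq> R \<longrightarrow> disjoint_family A \<longrightarrow> (\<Union>n. A n) \<in> R \<longrightarrow>
        summable (\<lambda>n. \<bar>\<mu> (A n)\<bar>) \<and> (\<lambda>n. \<mu> (A n)) sums \<mu> (\<Union>n. A n))"

lemma local_signed_measure_additive: "local_signed_measure R \<mu> \<Longrightarrow> ring_additive R \<mu>"
  by (simp add: local_signed_measure_def ring_additive_def)

text \<open>Closure under negation is why extensionality is dropped from
  \<open>local_signed_measure\<close>: outside \<open>R\<close>, \<open>- \<mu> B\<close> need not
  be \<open>undefined\<close>. It allows the negative part to be treated as the positive part of
  \<open>- \<mu>\<close>.\<close>

lemma ring_additive_uminus:
  assumes "ring_additive R \<mu>" shows "ring_additive R (\<lambda>B. - \<mu> B)"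
  using assms unfolding ring_additive_def by (auto intro: sums_minus)

lemma jordan_neg_eq_jordan_pos: "jordan_neg S R \<mu> = jordan_pos S R (\<lambda>B. - \<mu> B)"
  by (simp add: jordan_neg_def jordan_pos_def)

text \<open>Only members of \<open>R\<close> compete, so the supremum makes sense also for sets
  \<open>C\<close> outside the ring. The cutoff of negative values at 0 by \<open>ennreal\<close> is
  harmless for additive \<open>\<mu>\<close>, since the empty set already contributes 0.\<close>

definition pos_variation :: "'a set set \<Rightarrow> ('a set \<Rightarrow> real) \<Rightarrow> 'a set \<Rightarrow> ennreal" where
  "pos_variation R \<mu> C = (SUP E\<in>{E \<in> R. E \<subseteq> C}. ennreal (\<mu> E))"

lemma ennreal_le_pos_variation: "E \<in> R \<Longrightarrow> E \<subseteq> C \<Longrightarrow> ennreal (\<mu> E) \<le> pos_variation R \<mu> C"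
  unfolding pos_variation_def by (auto intro: SUP_upper)

lemma pos_variation_mono: "C \<subseteq> D \<Longrightarrow> pos_variation R \<mu> C \<le> pos_variation R \<mu> D"
  unfolding pos_variation_def by (rule SUP_subset_mono) auto

context localized_borel_space
begin

lemma ring_sets: "B \<in> R \<Longrightarrow> B \<in> sets S"
  using ring_measurable by auto

lemma ring_subset: "B \<in> R \<Longrightarrow> E \<in> sets S \<Longrightarrow> E \<subseteq> B \<Longrightarrow> E \<in> R"
  using ring_ideal[of B E] by (simp add: Int_absorb1)

lemma ring_additive_empty:
  assumes "ring_additive R \<mu>" shows "\<mu> {} = 0"
proof -
  have "summable (\<lambda>n::nat. \<bar>\<mu> {}\<bar>)"
    using assms[unfolded ring_additive_def, rule_format, of "\<lambda>_. {}"]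
    by (auto simp: disjoint_family_on_def)
  then show ?thesis by (simp add: summable_const_iff)
qed

lemma ring_additive_Un:
  assumes \<mu>: "ring_additive R \<mu>" and "A \<in> R" "B \<in> R" "A \<inter> B = {}"
  shows "\<mu> (A \<union> B) = \<mu> A + \<mu> B"
proof -
  have "disjoint_family (binaryset A B)"
    using assms by (auto simp: disjoint_family_on_def binaryset_def)
  moreover have "range (binaryset A B) \<subseteq> R" "(\<Union>n. binaryset A B n) = A \<union> B"
    using assms by (auto simp: range_binaryset_eq UN_binaryset_eq)
  ultimately have "(\<lambda>n. \<mu> (binaryset A B n)) sums \<mu> (A \<union> B)"
    using assms(2,3) \<mu>[unfolded ring_additive_def, rule_format, of "binaryset A B"] by auto
  moreover have "(\<lambda>n. \<mu> (binaryset A B n)) sums (\<mu> A + \<mu> B)"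
    by (rule binaryset_sums) (rule ring_additive_empty[OF \<mu>])
  ultimately show ?thesis by (rule sums_unique2)
qed

lemma ring_additive_Diff:
  assumes \<mu>: "ring_additive R \<mu>" and "A \<in> R" "B \<in> R" "B \<subseteq> A"
  shows "\<mu> (A - B) = \<mu> A - \<mu> B"
proof -
  have "A - B \<in> R" "(A - B) \<inter> B = {}" "(A - B) \<union> B = A" using assms by auto
  with ring_additive_Un[OF \<mu> this(1) assms(3) this(2)] show ?thesis by simp
qed

text \<open>Competitors \<open>E\<close> in \<open>A\<close> and \<open>E'\<close> in
  \<open>B\<close> are disjoint and can be joined. Because \<open>ennreal\<close> cuts off negative
  values, this works only if both values are nonnegative; otherwise one term is 0 and monotonicity
  bounds the other.\<close>

lemma pos_variation_Un:
  assumes \<mu>: "ring_additive R \<mu>" and "A \<inter> B = {}"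
  shows "pos_variation R \<mu> A + pos_variation R \<mu> B \<le> pos_variation R \<mu> (A \<union> B)"
proof -
  have le: "ennreal (\<mu> E) + ennreal (\<mu> E') \<le> pos_variation R \<mu> (A \<union> B)"
    if E: "E \<in> R" "E \<subseteq> A" "E' \<in> R" "E' \<subseteq> B" for E E'
  proof (cases "\<mu> E \<ge> 0 \<and> \<mu> E' \<ge> 0")
    case True
    moreover have "E \<inter> E' = {}" using E assms(2) by auto
    ultimately have "ennreal (\<mu> E) + ennreal (\<mu> E') = ennreal (\<mu> (E \<union> E'))"
      using ring_additive_Un[OF \<mu> E(1,3)] by simp
    then show ?thesis
      using E by (auto intro!: ennreal_le_pos_variation)
  next
    case False
    then have "ennreal (\<mu> E) = 0 \<or> ennreal (\<mu> E') = 0"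
      by (auto simp: ennreal_neg)
    then show ?thesis
      using ennreal_le_pos_variation[OF E(1) le_supI1[OF E(2)], of \<mu> B]
        ennreal_le_pos_variation[OF E(3) le_supI2[OF E(4)], of \<mu> A]
      by auto
  qed
  have ne: "{E \<in> R. E \<subseteq> C} \<noteq> {}" for C by auto
  show ?thesis
    unfolding pos_variation_def[of _ _ A] pos_variation_def[of _ _ B]
    by (subst ennreal_SUP_add_left[OF ne, symmetric], rule SUP_least,
        subst ennreal_SUP_add_right[OF ne], rule SUP_least) (simp add: le)
qed

lemma pos_variation_empty:
  assumes \<mu>: "ring_additive R \<mu>" shows "pos_variation R \<mu> {} = 0"
proof -
  have "{E \<in> R. E \<subseteq> {}} = {{}}" by auto
  then show ?thesis by (simp add: pos_variation_def ring_additive_empty[OF \<mu>])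
qed

lemma pos_variation_sum:
  assumes \<mu>: "ring_additive R \<mu>" and "disjoint_family C"
  shows "(\<Sum>i<n::nat. pos_variation R \<mu> (C i)) \<le> pos_variation R \<mu> (\<Union>i<n. C i)"
proof (induction n)
  case (Suc n)
  have "(\<Union>i<n. C i) \<inter> C n = {}"
    using assms(2) by (auto simp: disjoint_family_on_def) (metis IntI emptyE less_irrefl)
  then show ?case
    using order_trans[OF add_right_mono[OF Suc] pos_variation_Un[OF \<mu>, of "\<Union>i<n. C i" "C n"]]
    by (simp add: lessThan_Suc Un_commute add.commute)
qed (simp add: pos_variation_empty[OF \<mu>])

text \<open>One inequality is superadditivity passed to the limit. For the other, a competitor
  \<open>E\<close> is cut along the \<open>C i\<close>; the pieces and their union \<open>E\<close>
  lie in \<open>R\<close> even if the \<open>C i\<close> do not, so additivity applies.\<close>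

lemma pos_variation_UN:
  assumes \<mu>: "ring_additive R \<mu>" and C: "range C \<subseteq> sets S" "disjoint_family C"
  shows "(\<Sum>i. pos_variation R \<mu> (C i)) = pos_variation R \<mu> (\<Union>i::nat. C i)"
proof (rule antisym)
  show "(\<Sum>i. pos_variation R \<mu> (C i)) \<le> pos_variation R \<mu> (\<Union>i. C i)"
    unfolding suminf_eq_SUP
  proof (rule SUP_least)
    fix n
    have "pos_variation R \<mu> (\<Union>i<n. C i) \<le> pos_variation R \<mu> (\<Union>i. C i)"
      by (rule pos_variation_mono) auto
    with pos_variation_sum[OF \<mu> C(2)]
    show "(\<Sum>i<n. pos_variation R \<mu> (C i)) \<le> pos_variation R \<mu> (\<Union>i. C i)"
      by (rule order_trans)
  qed
next
  show "pos_variation R \<mu> (\<Union>i. C i) \<le> (\<Sum>i. pos_variation R \<mu> (C i))"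
    unfolding pos_variation_def[of _ _ "\<Union>i. C i"]
  proof (rule SUP_least, clarsimp)
    fix E assume E: "E \<in> R" "E \<subseteq> (\<Union>i. C i)"
    have rng: "E \<inter> C i \<in> R" for i
      using E C by (auto intro: ring_ideal)
    have UN: "(\<Union>i. E \<inter> C i) = E" using E by auto
    have "disjoint_family (\<lambda>i. E \<inter> C i)"
      using C(2) by (auto simp: disjoint_family_on_def)
    then have s: "summable (\<lambda>i. \<bar>\<mu> (E \<inter> C i)\<bar>)" "(\<lambda>i. \<mu> (E \<inter> C i)) sums \<mu> E"
      using \<mu>[unfolded ring_additive_def, rule_format, of "\<lambda>i. E \<inter> C i"] rng UN E(1) by auto
    \<comment> \<open>Absolute convergence makes the positive parts summable, and each of them is
      bounded by a variation.\<close>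
    have s2: "summable (\<lambda>i. max 0 (\<mu> (E \<inter> C i)))"
      by (rule summable_comparison_test'[OF s(1)]) auto
    have "\<mu> E = (\<Sum>i. \<mu> (E \<inter> C i))"
      using s(2) by (rule sums_unique)
    also have "\<dots> \<le> (\<Sum>i. max 0 (\<mu> (E \<inter> C i)))"
      using sums_summable[OF s(2)] s2 by (intro suminf_le) auto
    finally have "ennreal (\<mu> E) \<le> ennreal (\<Sum>i. max 0 (\<mu> (E \<inter> C i)))"
      by (rule ennreal_leI)
    also have "\<dots> = (\<Sum>i. ennreal (max 0 (\<mu> (E \<inter> C i))))"
      by (rule suminf_ennreal2[symmetric]) (auto intro: s2)
    also have "\<dots> \<le> (\<Sum>i. pos_variation R \<mu> (C i))"
      using rng by (intro suminf_le) (auto intro!: ennreal_le_pos_variation simp: max_def ennreal_neg)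
    finally show "ennreal (\<mu> E) \<le> (\<Sum>i. pos_variation R \<mu> (C i))" .
  qed
qed

text \<open>If the variation of \<open>B\<close> is infinite, a piece of mass at least one can be split off such that
  the rest still has infinite variation. Iterating contradicts absolute summability.\<close>

lemma pos_variation_split:
  assumes \<mu>: "ring_additive R \<mu>" and B: "B \<in> R" "pos_variation R \<mu> B = \<top>"
  shows "\<exists>B'\<in>R. B' \<subseteq> B \<and> pos_variation R \<mu> B' = \<top> \<and> 1 \<le> \<bar>\<mu> (B - B')\<bar>"
proof -
  \<comment> \<open>With this threshold both \<open>E\<close> and \<open>B - E\<close> have mass of
    modulus above 1, so it does not matter which of them inherits the infinite variation.\<close>
  have "ennreal (1 + \<bar>\<mu> B\<bar>) < pos_variation R \<mu> B" using B by simp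
  then obtain E where E: "E \<in> R" "E \<subseteq> B" "ennreal (1 + \<bar>\<mu> B\<bar>) < ennreal (\<mu> E)"
    unfolding pos_variation_def less_SUP_iff by auto
  from E(3) have big: "1 + \<bar>\<mu> B\<bar> < \<mu> E" by (subst (asm) ennreal_less_iff) auto
  have D: "B - E \<in> R" "\<mu> (B - E) = \<mu> B - \<mu> E"
    using ring_additive_Diff[OF \<mu> B(1) E(1,2)] B E by auto
  have "range (binaryset E (B - E)) \<subseteq> sets S" "disjoint_family (binaryset E (B - E))"
    using E D ring_sets by (auto simp: range_binaryset_eq) (auto simp: disjoint_family_on_def binaryset_def)
  from pos_variation_UN[OF \<mu> this]
  have "pos_variation R \<mu> E + pos_variation R \<mu> (B - E) = \<top>"
    using E B by (simp add: suminf_binaryset_eq[where f = "pos_variation R \<mu>", OF pos_variation_empty[OF \<mu>]] UN_binaryset_eq Un_absorb1)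
  then consider "pos_variation R \<mu> E = \<top>" | "pos_variation R \<mu> (B - E) = \<top>" by auto
  then show ?thesis
  proof cases
    case 1
    then show ?thesis using E D big by (intro bexI[of _ E]) auto
  next
    case 2
    have "B - (B - E) = E" using E by auto
    then show ?thesis using 2 D big by (intro bexI[of _ "B - E"]) auto
  qed
qed

lemma pos_variation_finite:
  assumes \<mu>: "ring_additive R \<mu>" and B: "B \<in> R"
  shows "pos_variation R \<mu> B < \<top>"
proof (rule ccontr)
  assume "\<not> ?thesis"
  then have top: "pos_variation R \<mu> B = \<top>" by (simp add: top.not_eq_extremum[symmetric])
  have "\<exists>C. \<forall>n. (C n \<in> R \<and> C n \<subseteq> B \<and> pos_variation R \<mu> (C n) = \<top>) \<and>
      (C (Suc n) \<subseteq> C n \<and> 1 \<le> \<bar>\<mu> (C n - C (Suc n))\<bar>)"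
  proof (rule dependent_nat_choice)
    show "\<exists>C. C \<in> R \<and> C \<subseteq> B \<and> pos_variation R \<mu> C = \<top>" using B top by blast
    fix C and n :: nat assume C: "C \<in> R \<and> C \<subseteq> B \<and> pos_variation R \<mu> C = \<top>"
    then obtain C' where "C' \<in> R" "C' \<subseteq> C" "pos_variation R \<mu> C' = \<top>" "1 \<le> \<bar>\<mu> (C - C')\<bar>"
      using pos_variation_split[OF \<mu>] by blast
    then show "\<exists>C'. (C' \<in> R \<and> C' \<subseteq> B \<and> pos_variation R \<mu> C' = \<top>) \<and>
        C' \<subseteq> C \<and> 1 \<le> \<bar>\<mu> (C - C')\<bar>"
      using C by blast
  qed
  then obtain C where C: "\<And>n. C n \<in> R" "\<And>n. C n \<subseteq> B" "\<And>n. C (Suc n) \<subseteq> C n"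
    "\<And>n. 1 \<le> \<bar>\<mu> (C n - C (Suc n))\<bar>"
    by blast
  let ?A = "\<lambda>n. C n - C (Suc n)"
  have dec: "decseq C" using C(3) by (rule decseq_SucI)
  have "?A m \<inter> ?A n = {}" if "m < n" for m n
    using decseqD[OF dec, of "Suc m" n] that by auto
  then have "disjoint_family ?A"
    unfolding disjoint_family_on_def by (metis Int_commute nat_neq_iff)
  moreover have "range ?A \<subseteq> R" using C(1) by auto
  \<comment> \<open>The union is a measurable subset of \<open>B\<close>, hence in \<open>R\<close>;
    this is what entitles additivity to make the masses of the pieces summable.\<close>
  moreover have "(\<Union>n. ?A n) \<in> R"
    using C ring_sets by (intro ring_subset[OF B]) (auto intro!: sets.countable_UN)
  ultimately have "summable (\<lambda>n. \<bar>\<mu> (?A n)\<bar>)"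
    using \<mu>[unfolded ring_additive_def, rule_format, of ?A] by auto
  then have "(\<lambda>n. \<bar>\<mu> (?A n)\<bar>) \<longlonglongrightarrow> 0" by (rule summable_LIMSEQ_zero)
  from LIMSEQ_le_const[OF this, of 1] C(4) show False by auto
qed

section \<open>Exhaustion by the ring and the measure given by the positive variation\<close>

lemma exhausting_sequence:
  obtains U :: "nat \<Rightarrow> 'a set" where "\<And>n. U n \<in> R" "incseq U" "(\<Union>n. U n) = space S"
    "\<And>B. B \<in> R \<Longrightarrow> \<exists>n. B \<subseteq> U n"
proof -
  obtain U :: "nat \<Rightarrow> 'a set" where U: "range U \<subseteq> R" "incseq U" "(\<Union>n. U n) = space S"
    "R = (\<Union>n. {C \<inter> U n | C. C \<in> sets S})"
    using localizing by blast
  have "\<exists>n. B \<subseteq> U n" if "B \<in> R" for B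
    using that unfolding U(4) by blast
  with U show ?thesis by (intro that[of U]) (simp_all add: image_subset_iff)
qed

lemma emeasure_eq_SUP_exhausting:
  assumes "sets N = sets S" "range U \<subseteq> R" "incseq U" "(\<Union>n. U n) = space S" "C \<in> sets S"
  shows "emeasure N C = (SUP n. emeasure N (C \<inter> U n))"
proof -
  have "C = (\<Union>n. C \<inter> U n)"
    using assms sets.sets_into_space by fastforce
  moreover have "(SUP n. emeasure N (C \<inter> U n)) = emeasure N (\<Union>n. C \<inter> U n)"
    using assms ring_sets incseq_SucD[OF assms(3)]
    by (intro SUP_emeasure_incseq) (auto intro!: incseq_SucI simp: subset_eq)
  ultimately show ?thesis by simp
qed

text \<open>A measurable set is the increasing limit of its intersections with the exhausting sets,
  which lie in \<open>R\<close>. This gives the uniqueness that the \<open>THE\<close> in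
  \<open>jordan_pos\<close> requires.\<close>

lemma measure_eqI_ring:
  assumes N: "sets N = sets S" "sets N' = sets S" and eq: "\<And>B. B \<in> R \<Longrightarrow> emeasure N B = emeasure N' B"
  shows "N = N'"
proof (rule measure_eqI)
  obtain U :: "nat \<Rightarrow> 'a set" where U: "\<And>n. U n \<in> R" "incseq U" "(\<Union>n. U n) = space S"
    by (rule exhausting_sequence) auto
  fix C assume "C \<in> sets N"
  then have C: "C \<in> sets S" using N by simp
  have rng: "range U \<subseteq> R" using U(1) by auto
  have "C \<inter> U n \<in> R" for n using ring_ideal[OF U(1) C, of n] by (simp add: Int_commute)
  then show "emeasure N C = emeasure N' C"
    using emeasure_eq_SUP_exhausting[OF N(1) rng U(2,3) C] emeasure_eq_SUP_exhausting[OF N(2) rng U(2,3) C]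
      eq by auto
qed (use N in simp)

text \<open>Measurable subsets of a member of \<open>R\<close> are in \<open>R\<close>, so both
  suprema run over the same sets; the empty set makes the extended real supremum nonnegative, and
  the cutoff at 0 loses nothing.\<close>

lemma enn2ereal_pos_variation:
  assumes \<mu>: "ring_additive R \<mu>" and B: "B \<in> R"
  shows "enn2ereal (pos_variation R \<mu> B) = (SUP E\<in>{E \<in> sets S. E \<subseteq> B}. ereal (\<mu> E))"
proof (rule antisym)
  have eq: "{E \<in> sets S. E \<subseteq> B} = {E \<in> R. E \<subseteq> B}"
    using ring_subset[OF B] ring_sets by blast
  have 0: "0 \<le> (SUP E\<in>{E \<in> R. E \<subseteq> B}. ereal (\<mu> E))"
    by (rule SUP_upper2[of "{}"]) (auto simp: ring_additive_empty[OF \<mu>])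
  have "pos_variation R \<mu> B \<le> e2ennreal (SUP E\<in>{E \<in> R. E \<subseteq> B}. ereal (\<mu> E))"
    unfolding pos_variation_def
  proof (rule SUP_least)
    fix E assume "E \<in> {E \<in> R. E \<subseteq> B}"
    then have "e2ennreal (ereal (\<mu> E)) \<le> e2ennreal (SUP E\<in>{E \<in> R. E \<subseteq> B}. ereal (\<mu> E))"
      by (intro e2ennreal_mono SUP_upper)
    then show "ennreal (\<mu> E) \<le> e2ennreal (SUP E\<in>{E \<in> R. E \<subseteq> B}. ereal (\<mu> E))"
      by (simp add: ennreal.abs_eq)
  qed
  from less_eq_ennreal.rep_eq[THEN iffD1, OF this]
  show "enn2ereal (pos_variation R \<mu> B) \<le> (SUP E\<in>{E \<in> sets S. E \<subseteq> B}. ereal (\<mu> E))"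
    unfolding eq enn2ereal_e2ennreal[OF 0] .
  show "(SUP E\<in>{E \<in> sets S. E \<subseteq> B}. ereal (\<mu> E)) \<le> enn2ereal (pos_variation R \<mu> B)"
    unfolding eq
  proof (rule SUP_least)
    fix E assume "E \<in> {E \<in> R. E \<subseteq> B}"
    then have "ennreal (\<mu> E) \<le> pos_variation R \<mu> B"
      by (intro ennreal_le_pos_variation) auto
    then have "enn2ereal (ennreal (\<mu> E)) \<le> enn2ereal (pos_variation R \<mu> B)"
      by (rule less_eq_ennreal.rep_eq[THEN iffD1])
    moreover have "ereal (\<mu> E) \<le> enn2ereal (ennreal (\<mu> E))"
      by (simp add: ennreal.rep_eq)
    ultimately show "ereal (\<mu> E) \<le> enn2ereal (pos_variation R \<mu> B)" by (rule order_trans[rotated])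
  qed
qed

lemma jordan_pos_eqI:
  assumes \<mu>: "ring_additive R \<mu>" and N: "sets N = sets S"
    and eq: "\<And>B. B \<in> R \<Longrightarrow> emeasure N B = pos_variation R \<mu> B"
  shows "jordan_pos S R \<mu> = N"
  unfolding jordan_pos_def
proof (rule the_equality)
  show "N \<in> space (locally_finite_measures S R) \<and>
    (\<forall>B\<in>R. enn2ereal (emeasure N B) = (SUP E\<in>{E \<in> sets S. E \<subseteq> B}. ereal (\<mu> E)))"
    using N eq pos_variation_finite[OF \<mu>]
    by (auto simp: space_locally_finite_measures enn2ereal_pos_variation[OF \<mu>])
  fix N' assume "N' \<in> space (locally_finite_measures S R) \<and>
    (\<forall>B\<in>R. enn2ereal (emeasure N' B) = (SUP E\<in>{E \<in> sets S. E \<subseteq> B}. ereal (\<mu> E)))"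
  then show "N' = N"
    using N eq
    by (intro measure_eqI_ring)
      (auto simp: space_locally_finite_measures enn2ereal_pos_variation[OF \<mu>, symmetric] enn2ereal_inject)
qed

text \<open>The variation is countably additive on all of \<open>sets S\<close>, so it defines
  outright a measure with the characterizing property.\<close>

lemma
  assumes \<mu>: "ring_additive R \<mu>"
  shows sets_jordan_pos: "sets (jordan_pos S R \<mu>) = sets S"
    and emeasure_jordan_pos: "C \<in> sets S \<Longrightarrow> emeasure (jordan_pos S R \<mu>) C = pos_variation R \<mu> C"
proof -
  let ?N = "measure_of (space S) (sets S) (pos_variation R \<mu>)"
  have em: "emeasure ?N C = pos_variation R \<mu> C" if "C \<in> sets S" for C
  proof (rule emeasure_measure_of[OF refl])
    show "countably_additive (sets ?N) (pos_variation R \<mu>)"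
      unfolding countably_additive_def using pos_variation_UN[OF \<mu>] by auto
    show "positive (sets ?N) (pos_variation R \<mu>)"
      unfolding positive_def by (simp add: pos_variation_empty[OF \<mu>])
  qed (use that sets.space_closed in auto)
  then have J: "jordan_pos S R \<mu> = ?N"
    using ring_sets by (intro jordan_pos_eqI[OF \<mu>]) auto
  show "sets (jordan_pos S R \<mu>) = sets S" unfolding J by simp
  show "C \<in> sets S \<Longrightarrow> emeasure (jordan_pos S R \<mu>) C = pos_variation R \<mu> C"
    unfolding J by (rule em)
qed

lemma jordan_pos_in_space:
  assumes \<mu>: "ring_additive R \<mu>"
  shows "jordan_pos S R \<mu> \<in> space (locally_finite_measures S R)"
  using pos_variation_finite[OF \<mu>] ring_sets
  by (auto simp: space_locally_finite_measures sets_jordan_pos[OF \<mu>] emeasure_jordan_pos[OF \<mu>])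

lemma emeasure_jordan_pos_singleton:
  assumes \<mu>: "ring_additive R \<mu>" and s: "{s} \<in> R"
  shows "emeasure (jordan_pos S R \<mu>) {s} = ennreal (\<mu> {s})"
proof -
  have "{E \<in> R. E \<subseteq> {s}} = {{}, {s}}" using s by auto
  then show ?thesis
    using s ring_sets
    by (simp add: emeasure_jordan_pos[OF \<mu>] pos_variation_def ring_additive_empty[OF \<mu>] sup_max)
qed

end

section \<open>Approximation by a countable family of sets and measurability of the Jordan
  decomposition\<close>

lemma ennreal_add_le: "0 \<le> b \<Longrightarrow> ennreal (a + b) \<le> ennreal a + ennreal b"
  by (cases "0 \<le> a") (auto simp: ennreal_neg intro: ennreal_leI)

text \<open>Inner regularity of \<open>P\<close> gives a compact \<open>K\<close> inside
  \<open>T\<close>, outer regularity of \<open>N\<close> an open \<open>V\<close> around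
  \<open>T\<close>, and finitely many basic sets inside \<open>V\<close> cover \<open>K\<close>. The
  two measures will be the positive and the negative variation, each of which has to control only
  one of the two differences.\<close>

lemma finite_union_of_basis_approximates:
  fixes P N :: "real measure"
  assumes \<B>: "topological_basis \<B>"
    and P: "sets P = sets borel" "emeasure P (space P) \<noteq> \<infinity>"
    and N: "sets N = sets borel" "emeasure N (space N) \<noteq> \<infinity>"
    and T: "T \<in> sets borel" and e: "e > 0"
  shows "\<exists>\<U>. finite \<U> \<and> \<U> \<subseteq> \<B> \<and> emeasure P (T - \<Union>\<U>) \<le> ennreal e \<and> emeasure N (\<Union>\<U> - T) \<le> ennreal e"
proof -
  have fin: "emeasure P T \<noteq> \<infinity>" "emeasure N T \<noteq> \<infinity>"
    using emeasure_space[of P T] emeasure_space[of N T] P(2) N(2) by (auto simp: top_unique)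
  obtain K where K: "K \<subseteq> T" "compact K" "emeasure P T < emeasure P K + ennreal e"
    using SUP_approx_ennreal[OF e _ inner_regular[OF P T] fin(1)] compact_empty by blast
  obtain V where V: "T \<subseteq> V" "open V" "emeasure N V < emeasure N T + ennreal e"
    using INF_approx_ennreal[OF e outer_regular[OF N T] fin(2)] by blast
  have "\<exists>b\<in>\<B>. x \<in> b \<and> b \<subseteq> V" if "x \<in> K" for x
    by (rule topological_basisE[OF \<B> V(2), of x]) (use that K V in auto)
  then obtain b where b: "\<And>x. x \<in> K \<Longrightarrow> b x \<in> \<B> \<and> x \<in> b x \<and> b x \<subseteq> V" by metis
  obtain K' where K': "K' \<subseteq> K" "finite K'" "K \<subseteq> (\<Union>x\<in>K'. b x)"
  proof (rule compactE_image[OF K(2), of K b])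
    show "open (b x)" if "x \<in> K" for x using b[OF that] topological_basis_open[OF \<B>] by blast
    show "K \<subseteq> (\<Union>x\<in>K. b x)" using b by blast
  qed auto
  have bo: "x \<in> K' \<Longrightarrow> b x \<in> sets borel" for x
    using b K' topological_basis_open[OF \<B>] by (auto intro!: borel_open)
  have Km: "K \<in> sets borel" using K by (auto intro: borel_compact)
  have "emeasure P (T - \<Union>(b ` K')) \<le> emeasure P (T - K)"
    using K' T Km P by (intro emeasure_mono) auto
  also have "\<dots> = emeasure P T - emeasure P K"
    using K T Km P fin emeasure_mono[OF K(1), of P]
    by (intro emeasure_Diff) (auto simp: top_unique)
  also have "\<dots> \<le> ennreal e"
    using K(3) fin by (simp add: ennreal_minus_le_iff add.commute less_imp_le)
  finally have 1: "emeasure P (T - \<Union>(b ` K')) \<le> ennreal e" .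
  have "emeasure N (\<Union>(b ` K') - T) \<le> emeasure N (V - T)"
  proof (rule emeasure_mono)
    have "\<Union>(b ` K') \<subseteq> V" using K'(1) b by blast
    then show "\<Union>(b ` K') - T \<subseteq> V - T" by auto
    show "V - T \<in> sets N" using V T N by auto
  qed
  also have "\<dots> = emeasure N V - emeasure N T"
    using V T N fin by (intro emeasure_Diff) auto
  also have "\<dots> \<le> ennreal e"
    using V(3) fin by (simp add: ennreal_minus_le_iff add.commute less_imp_le)
  finally show ?thesis
    using 1 K' b by (intro exI[of _ "b ` K'"]) auto
qed

context localized_borel_space
begin

text \<open>Measurability of the inverse \<open>g\<close> makes every measurable \<open>C\<close>
  the preimage under \<open>f\<close> of a Borel set. Regularity, distribution functions and dyadic
  partitions of the line thereby become available on \<open>S\<close>.\<close>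

lemma real_embedding:
  obtains f :: "'a \<Rightarrow> real" where "f \<in> borel_measurable S" "inj_on f (space S)"
    "\<And>C. C \<in> sets S \<Longrightarrow> \<exists>T\<in>sets borel. C = f -` T \<inter> space S"
proof -
  obtain A f g where A: "A \<in> sets (borel :: real measure)"
    and f: "f \<in> S \<rightarrow>\<^sub>M restrict_space borel A" and g: "g \<in> restrict_space borel A \<rightarrow>\<^sub>M S"
    and gf: "\<And>s. s \<in> space S \<Longrightarrow> g (f s) = s" and fg: "\<And>x. x \<in> A \<Longrightarrow> f (g x) = x"
    using borel_space unfolding borel_space_def by blast
  have sp: "space (restrict_space borel A) = A" by (simp add: space_restrict_space)
  show ?thesis
  proof (rule that[of f])
    show "f \<in> borel_measurable S"
      using f by (simp add: measurable_restrict_space2_iff)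
    show "inj_on f (space S)"
      using gf by (metis inj_onI)
    fix C assume C: "C \<in> sets S"
    have "g -` C \<inter> A \<in> sets (restrict_space borel A)"
      using measurable_sets[OF g C] by (simp add: sp)
    then have "g -` C \<inter> A \<in> sets borel"
      using A by (subst (asm) sets_restrict_space_iff) auto
    moreover have "C = f -` (g -` C \<inter> A) \<inter> space S"
      using sets.sets_into_space[OF C] gf measurable_space[OF f] sp by auto
    ultimately show "\<exists>T\<in>sets borel. C = f -` T \<inter> space S" by blast
  qed
qed

lemma singleton_sets: "s \<in> space S \<Longrightarrow> {s} \<in> sets S"
proof -
  obtain f :: "'a \<Rightarrow> real" where f: "f \<in> borel_measurable S" "inj_on f (space S)"
    by (rule real_embedding) auto
  assume s: "s \<in> space S"
  then have "{s} = f -` {f s} \<inter> space S" using f(2) by (auto dest: inj_onD)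
  then show ?thesis using f(1) by (metis borel_singleton measurable_sets sets.empty_sets)
qed

lemma singleton_ring: "s \<in> space S \<Longrightarrow> {s} \<in> R"
proof -
  assume s: "s \<in> space S"
  obtain U :: "nat \<Rightarrow> 'a set" where U: "\<And>n. U n \<in> R" "(\<Union>n. U n) = space S"
    by (rule exhausting_sequence) auto
  then obtain n where "s \<in> U n" using s by auto
  then show ?thesis using ring_subset[OF U(1)[of n] singleton_sets[OF s]] by auto
qed

text \<open>A ring-additive set function has finite variation, so every measurable set can be approximated
  by preimages of finite unions of basic open sets of the line.\<close>

lemma pos_variation_countable:
  obtains \<A> where "countable \<A>" "\<A> \<noteq> {}" "\<A> \<subseteq> sets S"
    "\<And>\<mu> B. ring_additive R \<mu> \<Longrightarrow> B \<in> R \<Longrightarrow> pos_variation R \<mu> B = (SUP A\<in>\<A>. ennreal (\<mu> (B \<inter> A)))"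
proof -
  obtain f :: "'a \<Rightarrow> real" where f: "f \<in> borel_measurable S" "inj_on f (space S)"
    and fC: "\<And>C. C \<in> sets S \<Longrightarrow> \<exists>T\<in>sets borel. C = f -` T \<inter> space S"
    by (rule real_embedding) auto
  obtain \<B> :: "real set set" where \<B>: "countable \<B>" "topological_basis \<B>"
    using ex_countable_basis by blast
  let ?A = "\<lambda>\<U>. f -` \<Union>\<U> \<inter> space S"
  define \<A> where "\<A> = ?A ` {\<U>. finite \<U> \<and> \<U> \<subseteq> \<B>}"
  have Am: "?A \<U> \<in> sets S" if "\<U> \<subseteq> \<B>" for \<U>
    using that topological_basis_open[OF \<B>(2)]
    by (intro measurable_sets[OF f(1)] borel_open open_Union) auto
  show ?thesis
  proof (rule that[of \<A>])
    show "countable \<A>" unfolding \<A>_def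
      using countable_Collect_finite_subset[OF \<B>(1)] by (simp add: conj_commute)
    show "\<A> \<noteq> {}" unfolding \<A>_def by auto
    show "\<A> \<subseteq> sets S" unfolding \<A>_def using Am by auto
    fix \<mu> B assume \<mu>: "ring_additive R \<mu>" and B: "B \<in> R"
    have \<mu>': "ring_additive R (\<lambda>B. - \<mu> B)" using \<mu> by (rule ring_additive_uminus)
    show "pos_variation R \<mu> B = (SUP A\<in>\<A>. ennreal (\<mu> (B \<inter> A)))" (is "_ = ?S")
    proof (rule antisym)
      show "?S \<le> pos_variation R \<mu> B"
        using Am B by (intro SUP_least ennreal_le_pos_variation) (auto simp: \<A>_def intro: ring_ideal)
      show "pos_variation R \<mu> B \<le> ?S"
        unfolding pos_variation_def
      proof (rule SUP_least)
        fix E assume "E \<in> {E \<in> R. E \<subseteq> B}"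
        then have E: "E \<in> R" "E \<subseteq> B" by auto
        obtain T where T: "T \<in> sets borel" "E = f -` T \<inter> space S"
          using fC ring_sets E by blast
        \<comment> \<open>Restriction to \<open>B\<close> keeps the image measure finite: the
          variation of \<open>B\<close> is finite, that of the whole space may not be.\<close>
        let ?d = "\<lambda>\<mu>. distr (density (jordan_pos S R \<mu>) (indicator B)) borel f"
        have d: "emeasure (?d \<mu>) Q = pos_variation R \<mu> (B \<inter> (f -` Q \<inter> space S))"
          if "ring_additive R \<mu>" "Q \<in> sets borel" for \<mu> Q
        proof -
          have s: "sets (jordan_pos S R \<mu>) = sets S" "space (jordan_pos S R \<mu>) = space S"
            using sets_jordan_pos[OF that(1)] by (auto dest: sets_eq_imp_space_eq)
          have m: "f -` Q \<inter> space S \<in> sets S" using f(1) that(2) by (rule measurable_sets)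
          have B': "B \<in> sets S" using B by (rule ring_sets)
          have "emeasure (?d \<mu>) Q = emeasure (density (jordan_pos S R \<mu>) (indicator B)) (f -` Q \<inter> space S)"
            using f(1) s that(2) by (subst emeasure_distr) auto
          also have "\<dots> = (\<integral>\<^sup>+x. indicator (B \<inter> (f -` Q \<inter> space S)) x \<partial>jordan_pos S R \<mu>)"
            unfolding indicator_inter_arith[of B] using m B' s by (subst emeasure_density) auto
          also have "\<dots> = pos_variation R \<mu> (B \<inter> (f -` Q \<inter> space S))"
            using m B' s emeasure_jordan_pos[OF that(1)] by (subst nn_integral_indicator) auto
          finally show ?thesis .
        qed
        have dfin: "emeasure (?d \<mu>) (space (?d \<mu>)) \<noteq> \<infinity>" if "ring_additive R \<mu>" for \<mu>
          using d[OF that, of UNIV] pos_variation_finite[OF that B] ring_sets[OF B, THEN sets.sets_into_space]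
          by (simp add: Int_absorb2)
        show "ennreal (\<mu> E) \<le> ?S"
        proof (rule ennreal_le_epsilon)
          fix e :: real assume "0 < e"
          \<comment> \<open>The loss in passing from \<open>E\<close> to
            \<open>B \<inter> ?A \<U>\<close> is \<open>\<mu> (E - ?A \<U>)\<close> minus
            \<open>\<mu> (B \<inter> ?A \<U> - E)\<close>. The positive variation bounds the first
            term, the negative variation bounds the negative of the second, each by
            \<open>e / 2\<close>.\<close>
          then have e2: "e / 2 > 0" by simp
          obtain \<U> where \<U>: "finite \<U>" "\<U> \<subseteq> \<B>"
              "emeasure (?d \<mu>) (T - \<Union>\<U>) \<le> ennreal (e / 2)"
              "emeasure (?d (\<lambda>B. - \<mu> B)) (\<Union>\<U> - T) \<le> ennreal (e / 2)"
            using finite_union_of_basis_approximates[OF \<B>(2) _ dfin[OF \<mu>] _ dfin[OF \<mu>'] T(1) e2]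
            by auto
          have Um: "\<Union>\<U> \<in> sets borel"
            using \<U>(2) topological_basis_open[OF \<B>(2)] by (intro borel_open open_Union) auto
          have r: "E - ?A \<U> \<in> R" "B \<inter> ?A \<U> \<in> R" "B \<inter> ?A \<U> - E \<in> R" "E \<inter> ?A \<U> \<in> R"
            using B E Am[OF \<U>(2)] ring_sets[of E] by (auto intro: ring_ideal ring_subset[OF E(1)] simp: sets.Diff)
          have "ennreal (\<mu> (E - ?A \<U>)) \<le> pos_variation R \<mu> (B \<inter> (f -` (T - \<Union>\<U>) \<inter> space S))"
            using r E T by (intro ennreal_le_pos_variation) auto
          also have "\<dots> \<le> ennreal (e / 2)"
            using d[OF \<mu>, of "T - \<Union>\<U>"] Um T \<U> by auto
          finally have 1: "\<mu> (E - ?A \<U>) \<le> e / 2"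
            using e2 by (simp add: ennreal_le_iff)
          have "ennreal (- \<mu> (B \<inter> ?A \<U> - E)) \<le> pos_variation R (\<lambda>B. - \<mu> B) (B \<inter> (f -` (\<Union>\<U> - T) \<inter> space S))"
            using r E T by (intro ennreal_le_pos_variation) auto
          also have "\<dots> \<le> ennreal (e / 2)"
            using d[OF \<mu>', of "\<Union>\<U> - T"] Um T \<U> by auto
          finally have 2: "- \<mu> (B \<inter> ?A \<U> - E) \<le> e / 2"
            using e2 by (simp add: ennreal_le_iff)
          have "(E - ?A \<U>) \<union> (E \<inter> ?A \<U>) = E" "(B \<inter> ?A \<U> - E) \<union> (E \<inter> ?A \<U>) = B \<inter> ?A \<U>"
            using E by auto
          with ring_additive_Un[OF \<mu> r(1,4)] ring_additive_Un[OF \<mu> r(3,4)]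
          have "\<mu> E = \<mu> (E - ?A \<U>) + \<mu> (E \<inter> ?A \<U>)"
            "\<mu> (B \<inter> ?A \<U>) = \<mu> (B \<inter> ?A \<U> - E) + \<mu> (E \<inter> ?A \<U>)"
            by (auto simp: Int_def)
          with 1 2 have "\<mu> E \<le> \<mu> (B \<inter> ?A \<U>) + e" by linarith
          then have "ennreal (\<mu> E) \<le> ennreal (\<mu> (B \<inter> ?A \<U>) + e)" by (rule ennreal_leI)
          also have "\<dots> \<le> ennreal (\<mu> (B \<inter> ?A \<U>)) + ennreal e"
            using \<open>0 < e\<close> by (intro ennreal_add_le) simp
          also have "\<dots> \<le> ?S + ennreal e"
            using \<U> by (intro add_right_mono SUP_upper) (auto simp: \<A>_def)
          finally show "ennreal (\<mu> E) \<le> ?S + ennreal e" .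
        qed
      qed
    qed
  qed
qed

text \<open>The countable family does not depend on the set function, so one and the same countable
  supremum computes the variation for every \<open>\<omega>\<close>.\<close>

lemma borel_measurable_jordan_pos:
  assumes add: "\<And>\<omega>. \<omega> \<in> space N \<Longrightarrow> ring_additive R (\<xi> \<omega>)"
    and meas: "\<And>B. B \<in> R \<Longrightarrow> (\<lambda>\<omega>. \<xi> \<omega> B) \<in> borel_measurable N" and B: "B \<in> R"
  shows "(\<lambda>\<omega>. emeasure (jordan_pos S R (\<xi> \<omega>)) B) \<in> borel_measurable N"
proof -
  obtain \<A> where \<A>: "countable \<A>" "\<A> \<subseteq> sets S"
    "\<And>\<mu> B. ring_additive R \<mu> \<Longrightarrow> B \<in> R \<Longrightarrow> pos_variation R \<mu> B = (SUP A\<in>\<A>. ennreal (\<mu> (B \<inter> A)))"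
    by (rule pos_variation_countable) blast
  have "(\<lambda>\<omega>. SUP A\<in>\<A>. ennreal (\<xi> \<omega> (B \<inter> A))) \<in> borel_measurable N"
    using \<A> B meas ring_ideal by (intro borel_measurable_SUP measurable_compose[OF _ measurable_ennreal]) auto
  then show ?thesis
    by (rule measurable_cong[THEN iffD1, rotated])
      (simp add: add emeasure_jordan_pos[OF add] ring_sets[OF B] \<A>(3)[OF add B])
qed

lemma measurable_locally_finite_measures:
  assumes "\<And>\<omega>. \<omega> \<in> space N \<Longrightarrow> X \<omega> \<in> space (locally_finite_measures S R)"
    and meas: "\<And>B. B \<in> R \<Longrightarrow> (\<lambda>\<omega>. emeasure (X \<omega>) B) \<in> borel_measurable N"
  shows "X \<in> N \<rightarrow>\<^sub>M locally_finite_measures S R"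
proof -
  obtain U :: "nat \<Rightarrow> 'a set" where U: "\<And>n. U n \<in> R" "incseq U" "(\<Union>n. U n) = space S"
    by (rule exhausting_sequence) auto
  have X: "sets (X \<omega>) = sets S" "\<forall>B\<in>R. emeasure (X \<omega>) B < \<infinity>" if "\<omega> \<in> space N" for \<omega>
    using assms(1)[OF that] by (auto simp: space_locally_finite_measures)
  have "(\<lambda>\<omega>. emeasure (X \<omega>) C) \<in> borel_measurable N" if C: "C \<in> sets S" for C
  proof -
    have "(\<lambda>\<omega>. SUP n. emeasure (X \<omega>) (C \<inter> U n)) \<in> borel_measurable N"
      using ring_ideal[OF U(1) C] by (intro borel_measurable_SUP meas) (auto simp: Int_commute)
    then show ?thesis
      by (rule measurable_cong[THEN iffD1, rotated])
        (use U X(1) C in \<open>auto intro!: emeasure_eq_SUP_exhausting[symmetric]\<close>)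
  qed
  then show ?thesis
    unfolding locally_finite_measures_def using X
    by (intro measurable_SUP2 measurable_vimage_algebra2) auto
qed

text \<open>For the upper bound, \<open>N\<close> is discarded and the suprema are taken separately.
  The lower bound rests on singularity: \<open>P\<close> is carried by \<open>D\<close>, which
  neither \<open>N\<close> nor \<open>\<alpha>\<close> charges, so the choice of a competitor on
  \<open>D\<close> does not interfere with its choice elsewhere.\<close>

lemma pos_variation_singular_sum:
  assumes \<mu>: "ring_additive R \<mu>" and \<alpha>: "ring_additive R \<alpha>"
    and P: "P \<in> space (locally_finite_measures S R)" and N: "N \<in> space (locally_finite_measures S R)"
    and eq: "\<And>B. B \<in> R \<Longrightarrow> \<mu> B = \<alpha> B + measure P B - measure N B"
    and D: "D \<in> sets S" "emeasure P (space S - D) = 0" "emeasure N D = 0"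
    and D': "D' \<in> sets S" "emeasure N (space S - D') = 0"
    and null: "\<And>E. E \<in> R \<Longrightarrow> E \<subseteq> D \<union> D' \<Longrightarrow> \<alpha> E = 0"
    and B: "B \<in> R"
  shows "pos_variation R \<mu> B = pos_variation R \<alpha> B + emeasure P B"
proof -
  have sets: "sets P = sets S" "sets N = sets S" and fin: "\<And>B. B \<in> R \<Longrightarrow> emeasure P B < \<top>" "\<And>B. B \<in> R \<Longrightarrow> emeasure N B < \<top>"
    using P N by (auto simp: space_locally_finite_measures)
  have emP: "emeasure P B = ennreal (measure P B)" if "B \<in> R" for B
    using fin(1)[OF that] by (intro emeasure_eq_ennreal_measure) auto
  have Bs: "B \<in> sets S" "B \<subseteq> space S" using ring_sets[OF B] sets.sets_into_space by auto
  have lower: "ennreal (\<alpha> E) + emeasure P B \<le> pos_variation R \<mu> B" if E: "E \<in> R" "E \<subseteq> B" "0 \<le> \<alpha> E" for E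
  proof -
    \<comment> \<open>Off \<open>D \<union> D'\<close> this set keeps all that
      \<open>\<alpha>\<close> sees of \<open>E\<close>, on \<open>D\<close> it collects all of
      \<open>P\<close> in \<open>B\<close>, and the rest of \<open>D'\<close> is left out to avoid
      \<open>N\<close>.\<close>
    define E' where "E' = (E - (D \<union> D')) \<union> (B \<inter> D)"
    have Es: "E \<in> sets S" using ring_sets E by auto
    have r: "E - (D \<union> D') \<in> R" "E \<inter> (D \<union> D') \<in> R" "B \<inter> D \<in> R" "B - D \<in> R"
      using E B D(1) D'(1) Es Bs by (auto intro: ring_ideal ring_subset)
    then have E': "E' \<in> R" "E' \<subseteq> B" unfolding E'_def using E by auto
    have "(E - (D \<union> D')) \<union> (E \<inter> (D \<union> D')) = E" by auto
    with ring_additive_Un[OF \<alpha> r(1,2)] null[OF r(2)] have "\<alpha> E = \<alpha> (E - (D \<union> D'))" by auto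
    moreover have "\<alpha> E' = \<alpha> (E - (D \<union> D'))"
      unfolding E'_def using ring_additive_Un[OF \<alpha> r(1,3)] null[OF r(3)] by fastforce
    ultimately have 1: "\<alpha> E' = \<alpha> E" by simp
    have "emeasure P (B - D) \<le> emeasure P (space S - D)"
      using D(1) Bs sets by (intro emeasure_mono) auto
    then have PD: "emeasure P (B - D) = 0" using D(2) by simp
    have "emeasure P B \<le> emeasure P (E' \<union> (B - D))"
      using Bs D(1) E'(1) ring_sets sets by (intro emeasure_mono) (auto simp: E'_def)
    also have "\<dots> \<le> emeasure P E' + emeasure P (B - D)"
      using Bs D(1) E'(1) ring_sets sets by (intro emeasure_subadditive) auto
    finally have "emeasure P B \<le> emeasure P E'" using PD by simp
    moreover have "emeasure P E' \<le> emeasure P B"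
      using E' Bs sets by (intro emeasure_mono) auto
    ultimately have 2: "measure P E' = measure P B" by (simp add: measure_def)
    have "emeasure N E' \<le> emeasure N ((space S - D') \<union> D)"
      using D(1) D'(1) sets E Bs by (intro emeasure_mono) (auto simp: E'_def)
    also have "\<dots> \<le> emeasure N (space S - D') + emeasure N D"
      using D(1) D'(1) sets by (intro emeasure_subadditive) auto
    finally have 3: "measure N E' = 0" using D D' by (simp add: measure_def)
    have "\<mu> E' = \<alpha> E + measure P B" using eq[OF E'(1)] 1 2 3 by simp
    then have "ennreal (\<alpha> E) + emeasure P B = ennreal (\<mu> E')"
      using E(3) emP[OF B] by simp
    also have "\<dots> \<le> pos_variation R \<mu> B" by (rule ennreal_le_pos_variation) fact+
    finally show ?thesis .
  qed
  show ?thesis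
  proof (rule antisym)
    show "pos_variation R \<mu> B \<le> pos_variation R \<alpha> B + emeasure P B"
      unfolding pos_variation_def[of R \<mu>]
    proof (rule SUP_least)
      fix E assume "E \<in> {E \<in> R. E \<subseteq> B}"
      then have E: "E \<in> R" "E \<subseteq> B" by auto
      have "ennreal (\<mu> E) \<le> ennreal (\<alpha> E + measure P E)"
        unfolding eq[OF E(1)] by (rule ennreal_leI) simp
      also have "\<dots> \<le> ennreal (\<alpha> E) + ennreal (measure P E)" by (intro ennreal_add_le) simp
      also have "\<dots> \<le> pos_variation R \<alpha> B + emeasure P B"
        unfolding emP[OF E(1), symmetric] using E Bs sets
        by (intro add_mono ennreal_le_pos_variation emeasure_mono) auto
      finally show "ennreal (\<mu> E) \<le> pos_variation R \<alpha> B + emeasure P B" .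
    qed
    have ne: "{E \<in> R. E \<subseteq> B} \<noteq> {}" using B by auto
    show "pos_variation R \<alpha> B + emeasure P B \<le> pos_variation R \<mu> B"
      unfolding pos_variation_def[of R \<alpha>]
    proof (subst ennreal_SUP_add_left[OF ne, symmetric], rule SUP_least)
      fix E assume "E \<in> {E \<in> R. E \<subseteq> B}"
      \<comment> \<open>If \<open>\<alpha> E\<close> is negative, its cutoff value is 0 and the
        bound for the empty set suffices.\<close>
      then show "ennreal (\<alpha> E) + emeasure P B \<le> pos_variation R \<mu> B"
        using lower[of E] lower[of "{}"] ring_additive_empty[OF \<alpha>]
        by (cases "0 \<le> \<alpha> E") (auto simp: ennreal_neg)
    qed
  qed
qed

text \<open>A singleton has only itself and the empty set as subsets, so the positive part has at
  \<open>s\<close> the positive part of the mass \<open>\<xi> \<omega> {s}\<close>, which is nonzero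
  only where that mass is.\<close>

lemma atomless_jordan_pos:
  assumes add: "\<And>\<omega>. \<omega> \<in> space \<Omega> \<Longrightarrow> ring_additive R (\<xi> \<omega>)"
    and meas: "\<And>B. B \<in> R \<Longrightarrow> (\<lambda>\<omega>. \<xi> \<omega> B) \<in> borel_measurable \<Omega>"
    and "finite_measure \<Omega>" and at: "atomless \<Omega> S \<xi>"
  shows "atomless \<Omega> S (\<lambda>\<omega>. emeasure (jordan_pos S R (\<xi> \<omega>)))"
proof -
  interpret finite_measure \<Omega> by fact
  have "measure \<Omega> {\<omega> \<in> space \<Omega>. emeasure (jordan_pos S R (\<xi> \<omega>)) {s} \<noteq> 0} \<le>
      measure \<Omega> {\<omega> \<in> space \<Omega>. \<xi> \<omega> {s} \<noteq> 0}" if s: "s \<in> space S" for s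
  proof (rule finite_measure_mono)
    show "{\<omega> \<in> space \<Omega>. emeasure (jordan_pos S R (\<xi> \<omega>)) {s} \<noteq> 0} \<subseteq> {\<omega> \<in> space \<Omega>. \<xi> \<omega> {s} \<noteq> 0}"
      using singleton_ring[OF s] by (auto simp: emeasure_jordan_pos_singleton[OF add])
    show "{\<omega> \<in> space \<Omega>. \<xi> \<omega> {s} \<noteq> 0} \<in> sets \<Omega>"
      using meas[OF singleton_ring[OF s]] by measurable
  qed
  with at show ?thesis unfolding atomless_def by (meson less_le_trans)
qed

end

section \<open>Independence over disjoint sets\<close>

text \<open>The sigma-field generated by the variables \<open>emeasure (\<Psi> \<omega>) D\<close>,
  kept as a set of events because this is the form in which \<open>indep_sets\<close> expresses
  independence.\<close>

definition history :: "'w measure \<Rightarrow> ('w \<Rightarrow> 'b measure) \<Rightarrow> 'b set set \<Rightarrow> 'w set set" where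
  "history M \<Psi> \<D> = sigma_sets (space M)
     (\<Union>D\<in>\<D>. {(\<lambda>\<omega>. emeasure (\<Psi> \<omega>) D) -` T \<inter> space M | T. T \<in> sets borel})"

text \<open>A completion of \<open>G\<close> inside \<open>sets M\<close>. It is needed because the
  two parts of \<open>\<xi>\<close> agree only almost surely with functions of the restricted
  Poisson process.\<close>

definition ae_closure :: "'w measure \<Rightarrow> 'w set set \<Rightarrow> 'w set set" where
  "ae_closure M G = {E \<in> sets M. \<exists>E'\<in>G. AE \<omega> in M. \<omega> \<in> E \<longleftrightarrow> \<omega> \<in> E'}"

lemma history_generators:
  "(\<Union>D\<in>\<D>. {(\<lambda>\<omega>. emeasure (\<Psi> \<omega>) D) -` T \<inter> space M | T. T \<in> sets borel}) \<subseteq> Pow (space M)"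
  by auto

lemma sigma_algebra_history: "sigma_algebra (space M) (history M \<Psi> \<D>)"
  unfolding history_def by (rule sigma_algebra_sigma_sets[OF history_generators])

lemma sets_sigma_history: "sets (sigma (space M) (history M \<Psi> \<D>)) = history M \<Psi> \<D>"
  by (rule sigma_algebra.sets_measure_of_eq[OF sigma_algebra_history])

lemma history_mono: "\<D> \<subseteq> \<D>' \<Longrightarrow> history M \<Psi> \<D> \<subseteq> history M \<Psi> \<D>'"
  unfolding history_def by (rule sigma_sets_mono') auto

lemma measurable_emeasure_history:
  assumes "D \<in> \<D>"
  shows "(\<lambda>\<omega>. emeasure (\<Psi> \<omega>) D) \<in> borel_measurable (sigma (space M) (history M \<Psi> \<D>))"
proof (rule measurableI)
  fix T :: "ennreal set" assume "T \<in> sets borel"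
  with assms show "(\<lambda>\<omega>. emeasure (\<Psi> \<omega>) D) -` T \<inter> space (sigma (space M) (history M \<Psi> \<D>))
      \<in> sets (sigma (space M) (history M \<Psi> \<D>))"
    unfolding sets_sigma_history by (auto simp: history_def space_measure_of_conv intro!: sigma_sets.Basic)
qed simp

lemma history_subset_sets:
  assumes "\<And>D. D \<in> \<D> \<Longrightarrow> (\<lambda>\<omega>. emeasure (\<Psi> \<omega>) D) \<in> borel_measurable M"
  shows "history M \<Psi> \<D> \<subseteq> sets M"
  unfolding history_def using assms by (intro sets.sigma_sets_subset) (auto intro: measurable_sets)

lemma sigma_algebra_ae_closure:
  assumes G: "sigma_algebra (space M) G" "G \<subseteq> sets M"
  shows "sigma_algebra (space M) (ae_closure M G)"
proof -
  interpret G: sigma_algebra "space M" G by fact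
  show ?thesis
    unfolding sigma_algebra_iff2
  proof (intro conjI ballI allI impI)
    show "ae_closure M G \<subseteq> Pow (space M)" using sets.sets_into_space by (auto simp: ae_closure_def)
    show "{} \<in> ae_closure M G" by (auto simp: ae_closure_def intro!: bexI[of _ "{}"])
  next
    fix E assume "E \<in> ae_closure M G"
    then obtain E' where E: "E \<in> sets M" "E' \<in> G" "AE \<omega> in M. \<omega> \<in> E \<longleftrightarrow> \<omega> \<in> E'"
      by (auto simp: ae_closure_def)
    have "AE \<omega> in M. \<omega> \<in> space M - E \<longleftrightarrow> \<omega> \<in> space M - E'"
      using E(3) by eventually_elim auto
    then show "space M - E \<in> ae_closure M G"
      using E by (auto simp: ae_closure_def intro!: bexI[of _ "space M - E'"])
  next
    fix E :: "nat \<Rightarrow> _" assume "range E \<subseteq> ae_closure M G"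
    then have "\<forall>n. \<exists>E'. E n \<in> sets M \<and> E' \<in> G \<and> (AE \<omega> in M. \<omega> \<in> E n \<longleftrightarrow> \<omega> \<in> E')"
      by (auto simp: ae_closure_def)
    then obtain E' where E: "\<And>n. E n \<in> sets M" "\<And>n. E' n \<in> G" "\<And>n. AE \<omega> in M. \<omega> \<in> E n \<longleftrightarrow> \<omega> \<in> E' n"
      by metis
    have "AE \<omega> in M. \<forall>n. \<omega> \<in> E n \<longleftrightarrow> \<omega> \<in> E' n" using E(3) by (simp add: AE_all_countable)
    then have "AE \<omega> in M. \<omega> \<in> (\<Union>n. E n) \<longleftrightarrow> \<omega> \<in> (\<Union>n. E' n)" by eventually_elim auto
    then show "(\<Union>n. E n) \<in> ae_closure M G"
      using E by (auto simp: ae_closure_def intro!: bexI[of _ "\<Union>n. E' n"])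
  qed
qed

lemma measurable_ae_closure:
  assumes G: "sigma_algebra (space M) G" "G \<subseteq> sets M"
    and X: "X \<in> borel_measurable M" and Y: "Y \<in> borel_measurable (sigma (space M) G)"
    and XY: "AE \<omega> in M. X \<omega> = Y \<omega>"
  shows "X \<in> borel_measurable (sigma (space M) (ae_closure M G))"
proof (rule measurableI)
  fix T :: "'b set" assume T: "T \<in> sets borel"
  have "AE \<omega> in M. \<omega> \<in> X -` T \<inter> space M \<longleftrightarrow> \<omega> \<in> Y -` T \<inter> space M"
    using XY by eventually_elim auto
  moreover have "Y -` T \<inter> space M \<in> G"
    using measurable_sets[OF Y T]
    by (simp add: sigma_algebra.sets_measure_of_eq[OF G(1)] sigma_algebra.space_measure_of_eq[OF G(1)])
  ultimately have "X -` T \<inter> space M \<in> ae_closure M G"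
    using measurable_sets[OF X T] unfolding ae_closure_def by blast
  then show "X -` T \<inter> space (sigma (space M) (ae_closure M G)) \<in> sets (sigma (space M) (ae_closure M G))"
    using sigma_algebra_ae_closure[OF G]
    by (simp add: sigma_algebra.sets_measure_of_eq sigma_algebra.space_measure_of_eq)
qed simp

context prob_space
begin

text \<open>Independence concerns only probabilities of finite intersections, and these do not
  change when each event is replaced by an almost surely equal one.\<close>

lemma indep_sets_ae_closure:
  assumes G: "indep_sets G I"
  shows "indep_sets (\<lambda>i. ae_closure M (G i)) I"
proof (rule indep_setsI)
  show "ae_closure M (G i) \<subseteq> events" for i by (auto simp: ae_closure_def)
  fix A J assume J: "J \<noteq> {}" "J \<subseteq> I" "finite J" and A: "\<forall>j\<in>J. A j \<in> ae_closure M (G j)"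
  then have "\<forall>j\<in>J. \<exists>E'. A j \<in> sets M \<and> E' \<in> G j \<and> (AE \<omega> in M. \<omega> \<in> A j \<longleftrightarrow> \<omega> \<in> E')"
    by (auto simp: ae_closure_def)
  then obtain E where E: "\<And>j. j \<in> J \<Longrightarrow> A j \<in> sets M" "\<And>j. j \<in> J \<Longrightarrow> E j \<in> G j"
    "\<And>j. j \<in> J \<Longrightarrow> AE \<omega> in M. \<omega> \<in> A j \<longleftrightarrow> \<omega> \<in> E j"
    by metis
  have Em: "E j \<in> events" if "j \<in> J" for j
    using G E(2)[OF that] that J(2) by (auto simp: indep_sets_def)
  have eq: "prob (A j) = prob (E j)" if "j \<in> J" for j
    using E Em that by (intro finite_measure_eq_AE) auto
  have "AE \<omega> in M. \<forall>j\<in>J. \<omega> \<in> A j \<longleftrightarrow> \<omega> \<in> E j" using E(3) J(3) by (simp add: AE_finite_all)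
  then have "AE \<omega> in M. \<omega> \<in> (\<Inter>j\<in>J. A j) \<longleftrightarrow> \<omega> \<in> (\<Inter>j\<in>J. E j)" by eventually_elim auto
  then have "prob (\<Inter>j\<in>J. A j) = prob (\<Inter>j\<in>J. E j)"
    using E(1) Em J by (intro finite_measure_eq_AE) (auto intro!: sets.finite_INT)
  also have "\<dots> = (\<Prod>j\<in>J. prob (E j))"
    using indep_setsD[OF G J(2,1,3)] E(2) by auto
  also have "\<dots> = (\<Prod>j\<in>J. prob (A j))"
    using eq by (intro prod.cong) auto
  finally show "prob (\<Inter>j\<in>J. A j) = (\<Prod>j\<in>J. prob (A j))" .
qed

text \<open>Transport along a bijection from initial segments of the naturals to any finite index
  set; below, the indices are pairs or truth values.\<close>

lemma completely_random_indep_sets: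
  assumes cr: "completely_random M \<R> (\<lambda>\<omega>. emeasure (\<Psi> \<omega>))" and K: "finite K"
    and A: "A ` K \<subseteq> \<R>" "disjoint_family_on A K"
  shows "indep_sets (\<lambda>k. {(\<lambda>\<omega>. emeasure (\<Psi> \<omega>) (A k)) -` T \<inter> space M | T. T \<in> sets borel}) K"
    (is "indep_sets (\<lambda>k. ?ev (A k)) K")
proof -
  obtain e where e: "bij_betw e {..<card K} K"
    using ex_bij_betw_nat_finite[OF K] by (auto simp: atLeast0LessThan)
  have "disjoint_family_on (A \<circ> e) {..<card K}"
    using A(2) e unfolding disjoint_family_on_def bij_betw_def inj_on_def comp_def by (metis imageI)
  moreover have "(A \<circ> e) ` {..<card K} \<subseteq> \<R>" using A(1) e by (auto simp: bij_betw_def)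
  ultimately have "indep_vars (\<lambda>_. borel) (\<lambda>i \<omega>. emeasure (\<Psi> \<omega>) ((A \<circ> e) i)) {..<card K}"
    using cr unfolding completely_random_def by blast
  then have ind: "indep_sets (\<lambda>i. ?ev (A (e i))) {..<card K}"
    unfolding indep_vars_def2 by simp
  show ?thesis
  proof (rule indep_setsI)
    fix k assume "k \<in> K"
    then obtain i where i: "i < card K" "k = e i" using e by (auto simp: bij_betw_def)
    from ind have "\<forall>i\<in>{..<card K}. ?ev (A (e i)) \<subseteq> events" unfolding indep_sets_def by blast
    with i show "?ev (A k) \<subseteq> events" by blast
  next
    fix B J assume J: "J \<noteq> {}" "J \<subseteq> K" "finite J" and B: "\<forall>j\<in>J. B j \<in> ?ev (A j)"
    define L where "L = {i \<in> {..<card K}. e i \<in> J}"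
    have L: "e ` L = J" "inj_on e L" "L \<subseteq> {..<card K}" "finite L"
      using e J(2) by (auto simp: bij_betw_def L_def inj_on_def)
    have "prob (\<Inter>i\<in>L. B (e i)) = (\<Prod>i\<in>L. prob (B (e i)))"
    proof (rule indep_setsD[OF ind])
      show "\<forall>i\<in>L. B (e i) \<in> ?ev (A (e i))" using B L(1) by blast
    qed (use L J in auto)
    moreover have "(\<Inter>i\<in>L. B (e i)) = (\<Inter>j\<in>J. B j)" unfolding L(1)[symmetric] by auto
    moreover have "(\<Prod>i\<in>L. prob (B (e i))) = (\<Prod>j\<in>J. prob (B j))"
      unfolding L(1)[symmetric] by (simp add: prod.reindex[OF L(2)])
    ultimately show "prob (\<Inter>j\<in>J. B j) = (\<Prod>j\<in>J. prob (B j))" by simp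
  qed
qed

text \<open>The members of each \<open>\<D> i\<close> are finite disjoint unions of atoms, and atoms belonging to
  different \<open>C i\<close> are disjoint, so complete randomness applies to all atoms at once.\<close>

lemma indep_sets_history_finite:
  assumes cr: "completely_random M (sets F) (\<lambda>\<omega>. emeasure (\<Psi> \<omega>))"
    and sets: "\<And>\<omega>. \<omega> \<in> space M \<Longrightarrow> sets (\<Psi> \<omega>) = sets F"
    and I: "finite I" and C: "C ` I \<subseteq> sets F" "disjoint_family_on C I"
    and \<D>: "\<And>i. i \<in> I \<Longrightarrow> finite (\<D> i)" "\<And>i. i \<in> I \<Longrightarrow> \<D> i \<subseteq> {D \<in> sets F. D \<subseteq> C i}"
  shows "indep_sets (\<lambda>i. history M \<Psi> (\<D> i)) I"
proof -
  \<comment> \<open>The label \<open>k\<close> consists of an index \<open>i\<close> and a set of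
    members of \<open>\<D> i\<close>; \<open>P k\<close> is the part of \<open>C i\<close> lying in
    exactly these members. Keeping \<open>i\<close> in the label distinguishes, for instance, the
    empty sets of members that belong to different indices.\<close>
  define P where "P k = {x \<in> C (fst k). \<forall>D\<in>\<D> (fst k). x \<in> D \<longleftrightarrow> D \<in> snd k}" for k
  define K where "K i = {i} \<times> Pow (\<D> i)" for i
  let ?ev = "\<lambda>D. {(\<lambda>\<omega>. emeasure (\<Psi> \<omega>) D) -` T \<inter> space M | T. T \<in> sets borel}"
  have Pm: "P k \<in> sets F" if "k \<in> (\<Union>i\<in>I. K i)" for k
  proof -
    from that obtain i s where k: "k = (i, s)" "i \<in> I" by (auto simp: K_def)
    have Ci: "C i \<in> sets F" using k C by auto
    have "P k = C i \<inter> {x \<in> space F. \<forall>D\<in>\<D> i. x \<in> D \<longleftrightarrow> D \<in> s}"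
      unfolding P_def k using sets.sets_into_space[OF Ci] by auto
    moreover have "{x \<in> space F. \<forall>D\<in>\<D> i. x \<in> D \<longleftrightarrow> D \<in> s} \<in> sets F"
    proof (rule sets.sets_Collect_finite_All[OF _ \<D>(1)[OF k(2)]])
      fix D assume "D \<in> \<D> i"
      then have "D \<in> sets F" using \<D>(2)[OF k(2)] by auto
      then show "{x \<in> space F. x \<in> D \<longleftrightarrow> D \<in> s} \<in> sets F" by measurable
    qed
    ultimately show ?thesis using Ci by auto
  qed
  have "disjoint_family_on P (\<Union>i\<in>I. K i)"
  proof (unfold disjoint_family_on_def, intro ballI impI)
    fix k l assume kl: "k \<in> (\<Union>i\<in>I. K i)" "l \<in> (\<Union>i\<in>I. K i)" "k \<noteq> l"
    show "P k \<inter> P l = {}"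
    proof (cases "fst k = fst l")
      case False
      moreover have "fst k \<in> I" "fst l \<in> I" using kl by (auto simp: K_def)
      ultimately have "C (fst k) \<inter> C (fst l) = {}" using C(2) by (auto simp: disjoint_family_on_def)
      then show ?thesis unfolding P_def by blast
    next
      case True
      with kl have "snd k \<noteq> snd l" "snd k \<subseteq> \<D> (fst k)" "snd l \<subseteq> \<D> (fst k)"
        by (auto simp: K_def prod_eq_iff)
      then obtain D where "D \<in> \<D> (fst k)" "(D \<in> snd k) \<noteq> (D \<in> snd l)" by blast
      then show ?thesis using True unfolding P_def by auto
    qed
  qed
  then have "indep_sets (\<lambda>k. ?ev (P k)) (\<Union>i\<in>I. K i)"
    using I \<D>(1) Pm by (intro completely_random_indep_sets[OF cr]) (auto simp: K_def)
  then have "indep_sets (\<lambda>i. sigma_sets (space M) (\<Union>k\<in>K i. ?ev (P k))) I"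
  proof (rule indep_sets_collect_sigma)
    show "Int_stable (?ev (P k))" for k
    proof (rule Int_stableI)
      fix a b assume "a \<in> ?ev (P k)" "b \<in> ?ev (P k)"
      then obtain T T' where "T \<in> sets borel" "T' \<in> sets borel"
        "a = (\<lambda>\<omega>. emeasure (\<Psi> \<omega>) (P k)) -` T \<inter> space M" "b = (\<lambda>\<omega>. emeasure (\<Psi> \<omega>) (P k)) -` T' \<inter> space M"
        by blast
      then show "a \<inter> b \<in> ?ev (P k)"
        by (intro CollectI exI[of _ "T \<inter> T'"]) auto
    qed
    show "disjoint_family_on K I" by (auto simp: disjoint_family_on_def K_def)
  qed
  then show ?thesis
  proof (rule indep_sets_mono_sets)
    fix i assume i: "i \<in> I"
    have eq: "(\<Union>k\<in>K i. ?ev (P k)) = (\<Union>D\<in>P ` K i. ?ev D)" by auto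
    show "history M \<Psi> (\<D> i) \<subseteq> sigma_sets (space M) (\<Union>k\<in>K i. ?ev (P k))"
      unfolding eq history_def[symmetric] unfolding history_def[of _ _ "\<D> i"]
    proof (rule sigma_algebra.sigma_sets_subset[OF sigma_algebra_history], safe)
      fix D T assume D: "D \<in> \<D> i" and T: "T \<in> sets (borel :: ennreal measure)"
      let ?N = "sigma (space M) (history M \<Psi> (P ` K i))"
      have spN: "space ?N = space M" by (simp add: space_measure_of_conv)
      \<comment> \<open>The labels of the atoms that make up \<open>D\<close>; finite additivity
        turns the mass of \<open>D\<close> into a sum over them.\<close>
      define L where "L = {s. s \<subseteq> \<D> i \<and> D \<in> s}"
      have L: "finite L" "\<And>s. s \<in> L \<Longrightarrow> (i, s) \<in> K i" "\<And>s. s \<in> L \<Longrightarrow> P (i, s) \<in> sets F"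
        using \<D>(1)[OF i] i Pm unfolding L_def by (auto simp: K_def)
      have "D \<subseteq> C i" using \<D>(2)[OF i] D by auto
      have DU: "D = (\<Union>s\<in>L. P (i, s))"
      proof (intro equalityI subsetI)
        fix x assume "x \<in> D"
        then have "x \<in> P (i, {D' \<in> \<D> i. x \<in> D'})" "{D' \<in> \<D> i. x \<in> D'} \<in> L"
          using D \<open>D \<subseteq> C i\<close> by (auto simp: P_def L_def)
        then show "x \<in> (\<Union>s\<in>L. P (i, s))" by blast
      qed (use D in \<open>auto simp: P_def L_def\<close>)
      have dis: "disjoint_family_on (\<lambda>s. P (i, s)) L"
        unfolding disjoint_family_on_def P_def L_def by auto
      have "(\<lambda>\<omega>. \<Sum>s\<in>L. emeasure (\<Psi> \<omega>) (P (i, s))) \<in> borel_measurable ?N"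
        using L by (intro borel_measurable_sum measurable_emeasure_history) auto
      moreover have "(\<Sum>s\<in>L. emeasure (\<Psi> \<omega>) (P (i, s))) = emeasure (\<Psi> \<omega>) D" if "\<omega> \<in> space ?N" for \<omega>
        unfolding DU using L dis sets[of \<omega>] that by (intro sum_emeasure) (auto simp: spN)
      ultimately have "(\<lambda>\<omega>. emeasure (\<Psi> \<omega>) D) \<in> borel_measurable ?N"
        using measurable_cong[of ?N] by (metis (no_types, lifting))
      from measurable_sets[OF this T]
      show "(\<lambda>\<omega>. emeasure (\<Psi> \<omega>) D) -` T \<inter> space M \<in> history M \<Psi> (P ` K i)"
        unfolding sets_sigma_history spN .
    qed
  qed
qed

text \<open>The events that involve only finitely many sets form a generator closed under
  intersection, because two finite families can be merged. Independence therefore extends from them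
  to the generated sigma-fields.\<close>

lemma indep_sets_history:
  assumes cr: "completely_random M (sets F) (\<lambda>\<omega>. emeasure (\<Psi> \<omega>))"
    and sets: "\<And>\<omega>. \<omega> \<in> space M \<Longrightarrow> sets (\<Psi> \<omega>) = sets F"
    and meas: "\<And>D. D \<in> sets F \<Longrightarrow> (\<lambda>\<omega>. emeasure (\<Psi> \<omega>) D) \<in> borel_measurable M"
    and I: "finite I" and C: "C ` I \<subseteq> sets F" "disjoint_family_on C I"
  shows "indep_sets (\<lambda>i. history M \<Psi> {D \<in> sets F. D \<subseteq> C i}) I"
proof -
  define G where "G i = (\<Union>\<D>\<in>{\<D>. finite \<D> \<and> \<D> \<subseteq> {D \<in> sets F. D \<subseteq> C i}}. history M \<Psi> \<D>)" for i
  have "indep_sets G I"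
  proof (rule indep_setsI)
    show "G i \<subseteq> events" for i
      unfolding G_def using meas by (intro UN_least history_subset_sets) auto
    fix A J assume J: "J \<noteq> {}" "J \<subseteq> I" "finite J" and A: "\<forall>j\<in>J. A j \<in> G j"
    then have "\<forall>j\<in>J. \<exists>\<D>. finite \<D> \<and> \<D> \<subseteq> {D \<in> sets F. D \<subseteq> C j} \<and> A j \<in> history M \<Psi> \<D>"
      unfolding G_def by auto
    then obtain \<D> where \<D>: "\<And>j. j \<in> J \<Longrightarrow> finite (\<D> j)" "\<And>j. j \<in> J \<Longrightarrow> \<D> j \<subseteq> {D \<in> sets F. D \<subseteq> C j}"
      "\<And>j. j \<in> J \<Longrightarrow> A j \<in> history M \<Psi> (\<D> j)"
      by metis
    have "indep_sets (\<lambda>j. history M \<Psi> (\<D> j)) J"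
      using C J \<D> sets by (intro indep_sets_history_finite[OF cr, where C = C])
        (auto intro: disjoint_family_on_mono[OF J(2)])
    from indep_setsD[OF this subset_refl J(1,3)] \<D>(3)
    show "prob (\<Inter>j\<in>J. A j) = (\<Prod>j\<in>J. prob (A j))" by auto
  qed
  then have "indep_sets (\<lambda>i. sigma_sets (space M) (G i)) I"
  proof (rule indep_sets_sigma)
    fix i
    show "Int_stable (G i)"
    proof (rule Int_stableI)
      fix a b assume "a \<in> G i" "b \<in> G i"
      then obtain \<D> \<D>' where fin: "finite \<D>" "\<D> \<subseteq> {D \<in> sets F. D \<subseteq> C i}"
          "finite \<D>'" "\<D>' \<subseteq> {D \<in> sets F. D \<subseteq> C i}"
        and ab: "a \<in> history M \<Psi> \<D>" "b \<in> history M \<Psi> \<D>'"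
        unfolding G_def by blast
      interpret H: sigma_algebra "space M" "history M \<Psi> (\<D> \<union> \<D>')" by (rule sigma_algebra_history)
      have "a \<in> history M \<Psi> (\<D> \<union> \<D>')" "b \<in> history M \<Psi> (\<D> \<union> \<D>')"
        using ab history_mono[of \<D> "\<D> \<union> \<D>'"] history_mono[of \<D>' "\<D> \<union> \<D>'"] by blast+
      then show "a \<inter> b \<in> G i"
        unfolding G_def using fin by (intro UN_I[of "\<D> \<union> \<D>'"]) auto
    qed
  qed
  then show ?thesis
  proof (rule indep_sets_mono_sets)
    fix i
    show "history M \<Psi> {D \<in> sets F. D \<subseteq> C i} \<subseteq> sigma_sets (space M) (G i)"
      unfolding history_def[of _ _ "{D \<in> sets F. D \<subseteq> C i}"]
    proof (rule sigma_sets_mono, safe)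
      fix D and T :: "ennreal set" assume "D \<in> sets F" "D \<subseteq> C i" "T \<in> sets borel"
      then have "(\<lambda>\<omega>. emeasure (\<Psi> \<omega>) D) -` T \<inter> space M \<in> G i"
        unfolding G_def by (intro UN_I[of "{D}"]) (auto simp: history_def)
      then show "(\<lambda>\<omega>. emeasure (\<Psi> \<omega>) D) -` T \<inter> space M \<in> sigma_sets (space M) (G i)" ..
    qed
  qed
qed

end

section \<open>Poisson processes and integer-valued measures\<close>

lemma borel_measurable_nn_integral_kernel:
  assumes K: "\<And>\<omega>. \<omega> \<in> space N \<Longrightarrow> sets (K \<omega>) = sets F"
    and meas: "\<And>C. C \<in> sets F \<Longrightarrow> (\<lambda>\<omega>. emeasure (K \<omega>) C) \<in> borel_measurable N"
    and h: "h \<in> borel_measurable F"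
  shows "(\<lambda>\<omega>. \<integral>\<^sup>+x. h x \<partial>K \<omega>) \<in> borel_measurable N"
  using h
proof (induct rule: borel_measurable_induct)
  have sp: "space (K \<omega>) = space F" if "\<omega> \<in> space N" for \<omega>
    using K[OF that] by (rule sets_eq_imp_space_eq)
  have mK: "f \<in> borel_measurable (K \<omega>)" if "\<omega> \<in> space N" "f \<in> borel_measurable F" for \<omega> and f :: "_ \<Rightarrow> ennreal"
    using that(2) measurable_cong_sets[OF K[OF that(1)] refl] by blast
  {
    case (cong f g)
    have "(\<integral>\<^sup>+x. f x \<partial>K \<omega>) = (\<integral>\<^sup>+x. g x \<partial>K \<omega>)" if "\<omega> \<in> space N" for \<omega>
      using cong(3) sp[OF that] by (intro nn_integral_cong) auto
    with cong(4) show ?case using measurable_cong[of N] by (metis (no_types, lifting))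
  next
    case (set A)
    have "(\<integral>\<^sup>+x. indicator A x \<partial>K \<omega>) = emeasure (K \<omega>) A" if "\<omega> \<in> space N" for \<omega>
      using set K[OF that] by simp
    with meas[OF set] show ?case using measurable_cong[of N] by (metis (no_types, lifting))
  next
    case (mult u c)
    have "(\<integral>\<^sup>+x. c * u x \<partial>K \<omega>) = c * (\<integral>\<^sup>+x. u x \<partial>K \<omega>)" if "\<omega> \<in> space N" for \<omega>
      using mK[OF that mult(2)] by (rule nn_integral_cmult)
    moreover have "(\<lambda>\<omega>. c * (\<integral>\<^sup>+x. u x \<partial>K \<omega>)) \<in> borel_measurable N" using mult(4) by measurable
    ultimately show ?case using measurable_cong[of N] by (metis (no_types, lifting))
  next
    case (add u v)
    have "(\<integral>\<^sup>+x. v x + u x \<partial>K \<omega>) = (\<integral>\<^sup>+x. v x \<partial>K \<omega>) + (\<integral>\<^sup>+x. u x \<partial>K \<omega>)" if "\<omega> \<in> space N" for \<omega>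
      using mK[OF that add(1)] mK[OF that add(4)] by (intro nn_integral_add) auto
    moreover have "(\<lambda>\<omega>. (\<integral>\<^sup>+x. v x \<partial>K \<omega>) + (\<integral>\<^sup>+x. u x \<partial>K \<omega>)) \<in> borel_measurable N" using add(7,3) by measurable
    ultimately show ?case using measurable_cong[of N] by (metis (no_types, lifting))
  next
    case (seq U)
    have "(\<integral>\<^sup>+x. (SUP i. U i) x \<partial>K \<omega>) = (SUP i. \<integral>\<^sup>+x. U i x \<partial>K \<omega>)" if "\<omega> \<in> space N" for \<omega>
      unfolding SUP_apply using mK[OF that seq(1)] seq(4) by (intro nn_integral_monotone_convergence_SUP) auto
    moreover have "(\<lambda>\<omega>. SUP i. \<integral>\<^sup>+x. U i x \<partial>K \<omega>) \<in> borel_measurable N" using seq(3) by measurable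
    ultimately show ?case using measurable_cong[of N] by (metis (no_types, lifting))
  }
qed

lemma poisson_sums_one: "(\<lambda>k. l ^ k / fact k * exp (- l)) sums (1 :: real)"
proof -
  have "(\<lambda>k. (l ^ k /\<^sub>R fact k) * exp (- l)) sums (exp l * exp (- l))"
    by (intro sums_mult2 exp_converges)
  then show ?thesis by (simp add: exp_minus field_simps)
qed

lemma poisson_sums_mean: "(\<lambda>k. real k * (l ^ k / fact k * exp (- l))) sums (l :: real)"
proof -
  have eq: "real (Suc k) * (l ^ Suc k / fact (Suc k) * exp (- l)) = l * (l ^ k / fact k * exp (- l))" for k
    by (simp add: field_simps del: of_nat_Suc)
  have "(\<lambda>k. real (Suc k) * (l ^ Suc k / fact (Suc k) * exp (- l))) sums l"
    unfolding eq using sums_mult[OF poisson_sums_one, of l l] by simp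
  then show ?thesis by (subst (asm) sums_Suc_iff) simp
qed

text \<open>The inequality is enough for almost sure finiteness and for union bounds, and it is
  immediate when the intensity is infinite.\<close>

lemma (in prob_space) poisson_process_mean_le:
  assumes \<Psi>: "poisson_process M F \<Psi>" and C: "C \<in> sets F"
  shows "(\<integral>\<^sup>+\<omega>. emeasure (\<Psi> \<omega>) C \<partial>M) \<le> emeasure F C"
proof (cases "emeasure F C < \<infinity>")
  case True
  define l where "l = measure F C"
  define A where "A k = {\<omega> \<in> space M. emeasure (\<Psi> \<omega>) C = of_nat k}" for k
  have [measurable]: "(\<lambda>\<omega>. emeasure (\<Psi> \<omega>) C) \<in> borel_measurable M"
    using \<Psi> C by (auto simp: poisson_process_def)
  have Am[measurable]: "A k \<in> sets M" for k unfolding A_def by measurable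
  have p: "emeasure M (A k) = ennreal (l ^ k / fact k * exp (- l))" for k
    using \<Psi> C True by (simp add: poisson_process_def A_def l_def emeasure_eq_measure)
  have l: "l \<ge> 0" "emeasure F C = ennreal l"
    using True by (auto simp: l_def emeasure_eq_ennreal_measure)
  have dis: "disjoint_family A" by (auto simp: disjoint_family_on_def A_def)
  \<comment> \<open>The Poisson weights sum to 1, so the value \<open>\<infinity>\<close>, which an
    integer-valued measure may take here, has probability 0.\<close>
  have "emeasure M (\<Union>k. A k) = (\<Sum>k. emeasure M (A k))"
    using dis by (intro suminf_emeasure[symmetric]) auto
  also have "\<dots> = ennreal 1"
    unfolding p using poisson_sums_one[of l] l(1)
    by (subst suminf_ennreal2) (auto simp: sums_iff)
  finally have "prob (\<Union>k. A k) = 1" by (simp add: measure_def)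
  then have "AE \<omega> in M. \<omega> \<in> (\<Union>k. A k)"
    using AE_prob_1 by blast
  then have "AE \<omega> in M. emeasure (\<Psi> \<omega>) C = (\<Sum>k. of_nat k * indicator (A k) \<omega>)"
  proof eventually_elim
    case (elim \<omega>)
    then obtain k where k: "\<omega> \<in> A k" by auto
    have "(\<Sum>j. of_nat j * indicator (A j) \<omega>) = (\<Sum>j\<in>{k}. of_nat j * indicator (A j) \<omega> :: ennreal)"
    proof (rule suminf_finite)
      fix j assume "j \<notin> {k}"
      then have "\<omega> \<notin> A j" using k by (auto simp: A_def)
      then show "of_nat j * indicator (A j) \<omega> = (0 :: ennreal)" by simp
    qed simp
    moreover have "emeasure (\<Psi> \<omega>) C = of_nat k" using k by (simp add: A_def)
    ultimately show ?case using k by simp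
  qed
  then have "(\<integral>\<^sup>+\<omega>. emeasure (\<Psi> \<omega>) C \<partial>M) = (\<integral>\<^sup>+\<omega>. (\<Sum>k. of_nat k * indicator (A k) \<omega>) \<partial>M)"
    by (rule nn_integral_cong_AE)
  also have "\<dots> = (\<Sum>k. \<integral>\<^sup>+\<omega>. of_nat k * indicator (A k) \<omega> \<partial>M)"
    by (intro nn_integral_suminf) measurable
  also have "\<dots> = (\<Sum>k. ennreal (real k * (l ^ k / fact k * exp (- l))))"
    using l(1) by (subst ennreal_mult) (simp_all add: nn_integral_cmult_indicator p ennreal_of_nat_eq_real_of_nat)
  also have "\<dots> = ennreal l"
    using poisson_sums_mean[of l] l(1) by (subst suminf_ennreal2) (auto simp: sums_iff)
  finally show ?thesis using l by simp
qed (simp add: top.not_eq_extremum[symmetric])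

text \<open>Campbell's formula as an inequality, extended from indicators. It transfers
  integrability of \<open>min 1 \<bar>x\<bar>\<close> from the intensity to almost every
  configuration.\<close>

lemma (in prob_space) poisson_process_nn_integral_mean_le:
  assumes \<Psi>: "poisson_process M F \<Psi>" and h: "h \<in> borel_measurable F"
  shows "(\<integral>\<^sup>+\<omega>. \<integral>\<^sup>+x. h x \<partial>\<Psi> \<omega> \<partial>M) \<le> (\<integral>\<^sup>+x. h x \<partial>F)"
  using h
proof (induct rule: borel_measurable_induct)
  have K: "\<And>\<omega>. \<omega> \<in> space M \<Longrightarrow> sets (\<Psi> \<omega>) = sets F"
    and meas: "\<And>C. C \<in> sets F \<Longrightarrow> (\<lambda>\<omega>. emeasure (\<Psi> \<omega>) C) \<in> borel_measurable M"
    using \<Psi> by (auto simp: poisson_process_def)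
  note kern = borel_measurable_nn_integral_kernel[of M \<Psi> F, OF K meas]
  have sp: "space (\<Psi> \<omega>) = space F" if "\<omega> \<in> space M" for \<omega>
    using K[OF that] by (rule sets_eq_imp_space_eq)
  have mK: "f \<in> borel_measurable (\<Psi> \<omega>)" if "\<omega> \<in> space M" "f \<in> borel_measurable F" for \<omega> and f :: "_ \<Rightarrow> ennreal"
    using that(2) measurable_cong_sets[OF K[OF that(1)] refl] by blast
  {
    case (cong f g)
    have "(\<integral>\<^sup>+\<omega>. \<integral>\<^sup>+x. f x \<partial>\<Psi> \<omega> \<partial>M) = (\<integral>\<^sup>+\<omega>. \<integral>\<^sup>+x. g x \<partial>\<Psi> \<omega> \<partial>M)"
      using cong(3) sp by (intro nn_integral_cong) auto
    moreover have "(\<integral>\<^sup>+x. f x \<partial>F) = (\<integral>\<^sup>+x. g x \<partial>F)" using cong(3) by (rule nn_integral_cong)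
    ultimately show ?case using cong(4) by simp
  next
    case (set A)
    have "(\<integral>\<^sup>+\<omega>. \<integral>\<^sup>+x. indicator A x \<partial>\<Psi> \<omega> \<partial>M) = (\<integral>\<^sup>+\<omega>. emeasure (\<Psi> \<omega>) A \<partial>M)"
      using set K by (intro nn_integral_cong) simp
    with poisson_process_mean_le[OF \<Psi> set] set show ?case by simp
  next
    case (mult u c)
    have "(\<integral>\<^sup>+\<omega>. \<integral>\<^sup>+x. c * u x \<partial>\<Psi> \<omega> \<partial>M) = (\<integral>\<^sup>+\<omega>. c * (\<integral>\<^sup>+x. u x \<partial>\<Psi> \<omega>) \<partial>M)"
      using mK[OF _ mult(2)] by (intro nn_integral_cong nn_integral_cmult)
    also have "\<dots> = c * (\<integral>\<^sup>+\<omega>. \<integral>\<^sup>+x. u x \<partial>\<Psi> \<omega> \<partial>M)"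
      using kern mult(2) by (intro nn_integral_cmult) auto
    also have "\<dots> \<le> c * (\<integral>\<^sup>+x. u x \<partial>F)" using mult(4) by (rule mult_left_mono) simp
    finally show ?case using mult(2) by (simp add: nn_integral_cmult)
  next
    case (add u v)
    have "(\<integral>\<^sup>+\<omega>. \<integral>\<^sup>+x. v x + u x \<partial>\<Psi> \<omega> \<partial>M) = (\<integral>\<^sup>+\<omega>. (\<integral>\<^sup>+x. v x \<partial>\<Psi> \<omega>) + (\<integral>\<^sup>+x. u x \<partial>\<Psi> \<omega>) \<partial>M)"
      using mK[OF _ add(1)] mK[OF _ add(4)] by (intro nn_integral_cong nn_integral_add) auto
    also have "\<dots> = (\<integral>\<^sup>+\<omega>. \<integral>\<^sup>+x. v x \<partial>\<Psi> \<omega> \<partial>M) + (\<integral>\<^sup>+\<omega>. \<integral>\<^sup>+x. u x \<partial>\<Psi> \<omega> \<partial>M)"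
      using kern add(1,4) by (intro nn_integral_add) auto
    also have "\<dots> \<le> (\<integral>\<^sup>+x. v x \<partial>F) + (\<integral>\<^sup>+x. u x \<partial>F)" using add(7,3) by (intro add_mono)
    finally show ?case using add(1,4) by (simp add: nn_integral_add)
  next
    case (seq U)
    have "(\<integral>\<^sup>+\<omega>. \<integral>\<^sup>+x. (SUP i. U i) x \<partial>\<Psi> \<omega> \<partial>M) = (\<integral>\<^sup>+\<omega>. (SUP i. \<integral>\<^sup>+x. U i x \<partial>\<Psi> \<omega>) \<partial>M)"
      unfolding SUP_apply using mK[OF _ seq(1)] seq(4)
      by (intro nn_integral_cong nn_integral_monotone_convergence_SUP) auto
    also have "\<dots> = (SUP i. \<integral>\<^sup>+\<omega>. \<integral>\<^sup>+x. U i x \<partial>\<Psi> \<omega> \<partial>M)"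
      using kern seq(1,4)
      by (intro nn_integral_monotone_convergence_SUP) (auto simp: incseq_def le_fun_def intro!: nn_integral_mono)
    also have "\<dots> \<le> (SUP i. \<integral>\<^sup>+x. U i x \<partial>F)" using seq(3) by (intro SUP_mono) auto
    also have "\<dots> = (\<integral>\<^sup>+x. (SUP i. U i) x \<partial>F)"
      unfolding SUP_apply using seq(1,4) by (intro nn_integral_monotone_convergence_SUP[symmetric]) auto
    finally show ?case .
  }
qed

text \<open>Markov's inequality; it will be summed over the cells of a partition.\<close>

lemma (in prob_space) poisson_process_prob_ge_1_le:
  assumes \<Psi>: "poisson_process M F \<Psi>" and C: "C \<in> sets F"
  shows "emeasure M {\<omega> \<in> space M. 1 \<le> emeasure (\<Psi> \<omega>) C} \<le> emeasure F C"
proof -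
  have [measurable]: "(\<lambda>\<omega>. emeasure (\<Psi> \<omega>) C) \<in> borel_measurable M"
    using \<Psi> C by (auto simp: poisson_process_def)
  have "emeasure M {\<omega> \<in> space M. 1 \<le> emeasure (\<Psi> \<omega>) C} =
      (\<integral>\<^sup>+\<omega>. indicator {\<omega> \<in> space M. 1 \<le> emeasure (\<Psi> \<omega>) C} \<omega> \<partial>M)"
    by simp
  also have "\<dots> \<le> (\<integral>\<^sup>+\<omega>. emeasure (\<Psi> \<omega>) C \<partial>M)"
    by (intro nn_integral_mono) (auto simp: indicator_def)
  also have "\<dots> \<le> emeasure F C" by (rule poisson_process_mean_le[OF \<Psi> C])
  finally show ?thesis .
qed

lemma nn_integral_slice:
  assumes N: "sets N = sets (S \<Otimes>\<^sub>M punctured_line)" and B: "B \<in> sets S"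
    and h: "h \<in> borel_measurable borel"
  shows "(\<integral>\<^sup>+x. h x \<partial>slice N B) = (\<integral>\<^sup>+z. h (snd z) * indicator (B \<times> UNIV) z \<partial>N)"
proof -
  have N_space: "space N = space S \<times> - {0}"
    using sets_eq_imp_space_eq[OF N] by (simp add: space_pair_measure space_restrict_space)
  have line: "- {0} \<in> sets punctured_line"
    using sets.top[of punctured_line] by (simp add: space_restrict_space)
  have snd: "snd \<in> restrict_space N (B \<times> - {0}) \<rightarrow>\<^sub>M punctured_line"
    using measurable_snd[of S punctured_line] measurable_cong_sets[OF N refl]
    by (auto intro: measurable_restrict_space1)
  have "(\<integral>\<^sup>+x. h x \<partial>slice N B) = (\<integral>\<^sup>+z. h (snd z) \<partial>restrict_space N (B \<times> - {0}))"
    unfolding slice_def using measurable_restrict_space1[OF h] by (intro nn_integral_distr[OF snd]) simp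
  also have "\<dots> = (\<integral>\<^sup>+z. h (snd z) * indicator (B \<times> - {0}) z \<partial>N)"
    using B line by (intro nn_integral_restrict_space) (auto simp: N intro!: sets.Int pair_measureI)
  also have "\<dots> = (\<integral>\<^sup>+z. h (snd z) * indicator (B \<times> UNIV) z \<partial>N)"
    by (intro nn_integral_cong) (auto simp: N_space indicator_def)
  finally show ?thesis .
qed

text \<open>The masses of the sets \<open>\<bar>x\<bar> > k\<close> are natural numbers decreasing to \<open>0\<close>, so one of them vanishes.\<close>

lemma nn_integral_abs_finite_of_truncated:
  fixes m :: "real measure"
  assumes m: "sets m = sets punctured_line"
    and int: "\<And>A. A \<in> sets m \<Longrightarrow> emeasure m A \<in> insert \<infinity> (range of_nat)"
    and fin: "(\<integral>\<^sup>+x. ennreal (min 1 \<bar>x\<bar>) \<partial>m) < \<infinity>"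
  shows "(\<integral>\<^sup>+x. ennreal \<bar>x\<bar> \<partial>m) < \<infinity>"
proof -
  \<comment> \<open>Starting at 1 instead of 0 makes \<open>min 1 \<bar>x\<bar>\<close> equal to 1
    on \<open>A 0\<close>. The truncated integral then bounds the mass of \<open>A 0\<close>, and
    continuity from above is applicable.\<close>
  define A where "A k = {x. \<bar>x\<bar> > real (Suc k)}" for k
  have mb: "f \<in> borel_measurable m" if "f \<in> borel_measurable borel" for f :: "real \<Rightarrow> ennreal"
    using measurable_restrict_space1[OF that] measurable_cong_sets[OF m refl] by blast
  have A: "A k \<in> sets m" for k
    unfolding m A_def by (subst sets_restrict_space_iff) (auto intro!: borel_open open_Collect_less continuous_intros)
  have "emeasure m (A 0) = (\<integral>\<^sup>+x. indicator (A 0) x \<partial>m)"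
    using A[of 0] by (rule nn_integral_indicator[symmetric])
  also have "\<dots> \<le> (\<integral>\<^sup>+x. ennreal (min 1 \<bar>x\<bar>) \<partial>m)"
    by (intro nn_integral_mono) (auto simp: indicator_def A_def)
  finally have A0: "emeasure m (A 0) < \<infinity>" using fin by (rule le_less_trans)
  have Afin: "emeasure m (A k) \<noteq> \<infinity>" for k
  proof -
    have "emeasure m (A k) \<le> emeasure m (A 0)" using A[of 0] by (intro emeasure_mono) (auto simp: A_def)
    then show ?thesis using A0 by (auto simp: top_unique)
  qed
  have "(\<Inter>k. A k) = {}"
  proof (intro equals0I)
    fix x assume "x \<in> (\<Inter>k. A k)"
    then have "\<bar>x\<bar> > real (Suc k)" for k by (auto simp: A_def)
    moreover obtain k where "\<bar>x\<bar> < real k" using reals_Archimedean2 by blast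
    ultimately show False by (smt (verit) of_nat_Suc)
  qed
  moreover have "(\<lambda>k. emeasure m (A k)) \<longlonglongrightarrow> emeasure m (\<Inter>k. A k)"
    using A Afin by (intro Lim_emeasure_decseq) (auto simp: decseq_def A_def)
  ultimately have "(\<lambda>k. emeasure m (A k)) \<longlonglongrightarrow> 0" by simp
  then have "eventually (\<lambda>k. emeasure m (A k) < 1) sequentially" by (rule order_tendstoD) simp
  then obtain k where k: "emeasure m (A k) < 1" by (auto simp: eventually_sequentially)
  have "emeasure m (A k) = 0"
    using k int[OF A[of k]] by auto
  then have "AE x in m. x \<notin> A k" using A by (intro AE_not_in) (auto simp: null_sets_def)
  \<comment> \<open>Almost every mark has modulus at most \<open>k + 1\<close>, and there the
    truncation costs at most this factor.\<close>
  then have "AE x in m. ennreal \<bar>x\<bar> \<le> ennreal (real (Suc k)) * ennreal (min 1 \<bar>x\<bar>)"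
  proof eventually_elim
    case (elim x)
    then have "\<bar>x\<bar> \<le> real (Suc k) * min 1 \<bar>x\<bar>"
      by (auto simp: A_def min_def mult_le_cancel_right1 simp del: of_nat_Suc)
    then show ?case by (simp add: ennreal_mult[symmetric] ennreal_leI del: of_nat_Suc)
  qed
  then have "(\<integral>\<^sup>+x. ennreal \<bar>x\<bar> \<partial>m) \<le> (\<integral>\<^sup>+x. ennreal (real (Suc k)) * ennreal (min 1 \<bar>x\<bar>) \<partial>m)"
    by (rule nn_integral_mono_AE)
  also have "\<dots> = ennreal (real (Suc k)) * (\<integral>\<^sup>+x. ennreal (min 1 \<bar>x\<bar>) \<partial>m)"
    by (intro nn_integral_cmult mb) measurable
  also have "\<dots> < \<infinity>" using fin by (simp add: ennreal_mult_less_top del: of_nat_Suc)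
  finally show ?thesis .
qed

text \<open>Off its atoms, the image on the line of an integer-valued measure has a continuous integer-valued
  distribution function, which therefore vanishes.\<close>

lemma (in localized_borel_space) integer_measure_carried_by_atoms:
  assumes m: "sets m = sets S" and int: "\<And>A. A \<in> sets S \<Longrightarrow> emeasure m A \<in> range of_nat"
  shows "countable {s. emeasure m {s} \<noteq> 0}" "emeasure m (space S - {s. emeasure m {s} \<noteq> 0}) = 0"
proof -
  obtain f :: "'a \<Rightarrow> real" where f: "f \<in> borel_measurable S" "inj_on f (space S)"
    by (rule real_embedding) auto
  have sp: "space m = space S" using m by (rule sets_eq_imp_space_eq)
  have "emeasure m (space m) \<noteq> \<infinity>" using int[of "space S"] by (auto simp: sp)
  then interpret m: finite_measure m by (rule finite_measureI)
  define D where "D = {s. emeasure m {s} \<noteq> 0}"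
  show "countable {s. emeasure m {s} \<noteq> 0}"
    using m.countable_support by (simp add: m.emeasure_eq_measure)
  have "s \<in> space S" if "emeasure m {s} \<noteq> 0" for s
    using that emeasure_notin_sets[of "{s}" m] sets.sets_into_space[of "{s}" m] by (auto simp: sp)
  then have Dsub: "D \<subseteq> space S" unfolding D_def by auto
  have "D \<in> sets S" using \<open>countable _\<close> Dsub unfolding D_def[symmetric]
    by (intro sets.countable[OF singleton_sets]) auto
  then have E: "space S - D \<in> sets S" by auto
  \<comment> \<open>The part of \<open>m\<close> off its atoms, carried over to the line.\<close>
  define M' where "M' = distr (density m (indicator (space S - D))) borel f"
  have f': "f \<in> density m (indicator (space S - D)) \<rightarrow>\<^sub>M borel"
    using f(1) measurable_cong_sets[of "density m (indicator (space S - D))" S borel borel] m by simp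
  have em: "emeasure M' T = emeasure m ((f -` T \<inter> space S) - D)" if "T \<in> sets borel" for T
  proof -
    have T: "f -` T \<inter> space S \<in> sets S" using f(1) that by (rule measurable_sets)
    have "emeasure M' T = emeasure (density m (indicator (space S - D))) (f -` T \<inter> space S)"
      unfolding M'_def using that f' sp by (subst emeasure_distr) auto
    also have "\<dots> = (\<integral>\<^sup>+x. indicator ((space S - D) \<inter> (f -` T \<inter> space S)) x \<partial>m)"
      unfolding indicator_inter_arith[of "space S - D"] using T E m by (subst emeasure_density) auto
    also have "\<dots> = emeasure m ((space S - D) \<inter> (f -` T \<inter> space S))"
      using T E m by (subst nn_integral_indicator) auto
    also have "(space S - D) \<inter> (f -` T \<inter> space S) = (f -` T \<inter> space S) - D" by auto
    finally show ?thesis .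
  qed
  have intM': "\<exists>k::nat. measure M' T = real k" if "T \<in> sets borel" for T
  proof -
    have "(f -` T \<inter> space S) - D \<in> sets S" using measurable_sets[OF f(1) that] \<open>D \<in> sets S\<close> by auto
    from int[OF this] em[OF that] obtain k :: nat where "emeasure M' T = of_nat k" by auto
    then show ?thesis by (auto simp: measure_def ennreal_of_nat_eq_real_of_nat)
  qed
  have "finite_borel_measure M'"
  proof (unfold finite_borel_measure_def finite_borel_measure_axioms_def, intro conjI)
    show "finite_measure M'"
      by (rule finite_measureI) (use em[of UNIV] in \<open>simp add: M'_def m.emeasure_eq_measure\<close>)
  qed (simp add: M'_def)
  then interpret M': finite_borel_measure M' .
  \<comment> \<open>A jump at \<open>x\<close> would be the mass of the at most one point outside
    \<open>D\<close> that the injective \<open>f\<close> maps to \<open>x\<close>, and this point is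
    not an atom.\<close>
  have cont: "isCont (cdf M') x" for x
    unfolding M'.isCont_cdf
  proof -
    have "emeasure m ((f -` {x} \<inter> space S) - D) = 0"
    proof (cases "\<exists>s\<in>space S - D. f s = x")
      case True
      then obtain s where s: "s \<in> space S" "s \<notin> D" "f s = x" by auto
      then have "(f -` {x} \<inter> space S) - D = {s}" using f(2) by (auto dest: inj_onD)
      then show ?thesis using s(2) by (simp add: D_def)
    next
      case False
      then have "(f -` {x} \<inter> space S) - D = {}" by auto
      then show ?thesis by (simp only: emeasure_empty)
    qed
    then show "measure M' {x} = 0" using em[of "{x}"] by (simp add: measure_def)
  qed
  have "cdf M' constant_on UNIV"
  proof (rule continuous_discrete_range_constant)
    show "continuous_on UNIV (cdf M')" using cont by (simp add: continuous_on_eq_continuous_at)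
    fix x :: real
    show "\<exists>e>0. \<forall>y. y \<in> UNIV \<and> cdf M' y \<noteq> cdf M' x \<longrightarrow> e \<le> norm (cdf M' y - cdf M' x)"
    proof (intro exI[of _ 1] conjI allI impI)
      fix y assume y: "y \<in> UNIV \<and> cdf M' y \<noteq> cdf M' x"
      obtain i j :: nat where "cdf M' y = real i" "cdf M' x = real j"
        unfolding cdf_def using intM'[of "{..y}"] intM'[of "{..x}"] by auto
      with y show "1 \<le> norm (cdf M' y - cdf M' x)" by (auto simp: real_norm_def)
    qed simp
  qed auto
  then obtain c where c: "cdf M' = (\<lambda>x. c)" by (auto simp: constant_on_def)
  \<comment> \<open>The constant equals the limit at minus infinity, which is 0, and the limit at
    plus infinity, which is the total mass.\<close>
  have "c = 0" using M'.cdf_lim_at_bot unfolding c by (simp add: tendsto_const_iff)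
  moreover have "c = measure M' (space M')" using M'.cdf_lim_at_top unfolding c by (simp add: tendsto_const_iff)
  ultimately have "measure M' UNIV = 0" by (simp add: M'_def)
  then have "emeasure M' UNIV = 0" by (simp add: M'.emeasure_eq_measure)
  then have "emeasure m (space S - D) = 0" using em[of UNIV] by simp
  then show "emeasure m (space S - {s. emeasure m {s} \<noteq> 0}) = 0" by (simp add: D_def)
qed

section \<open>Marked point configurations\<close>

text \<open>In the applications \<open>\<sigma>\<close> is 1 or -1; as a parameter it lets one proof
  serve both signs.\<close>

definition half :: "real \<Rightarrow> real set" where "half \<sigma> = {x. 0 < \<sigma> * x}"

text \<open>Marks bounded away from 0: integrability of \<open>min 1 \<bar>x\<bar>\<close> makes
  their mass finite, and they increase to \<open>half \<sigma>\<close>.\<close>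

definition far_half :: "real \<Rightarrow> nat \<Rightarrow> real set" where "far_half \<sigma> n = {x. 1 / (real n + 1) < \<sigma> * x}"

text \<open>For a point configuration this puts mass \<open>\<sigma> * x\<close> at \<open>s\<close>
  for each point \<open>(s, x)\<close> with \<open>x\<close> of sign \<open>\<sigma>\<close>; for
  the other sign the density is negative and \<open>ennreal\<close> turns it into 0.\<close>

definition jump_part :: "'a measure \<Rightarrow> real \<Rightarrow> ('a \<times> real) measure \<Rightarrow> 'a measure" where
  "jump_part S \<sigma> N = distr (density N (\<lambda>z. ennreal (\<sigma> * snd z))) S fst"

lemma half_sets: "half \<sigma> \<in> sets borel" "0 \<notin> half \<sigma>"
  unfolding half_def by (auto intro!: borel_open open_Collect_less continuous_intros)

lemma far_half_sets: "far_half \<sigma> n \<in> sets borel" "0 \<notin> far_half \<sigma> n"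
  unfolding far_half_def by (auto intro!: borel_open open_Collect_less continuous_intros)

lemma far_half_mono: "m \<le> n \<Longrightarrow> far_half \<sigma> m \<subseteq> far_half \<sigma> n"
proof
  fix x assume "m \<le> n" "x \<in> far_half \<sigma> m"
  moreover from \<open>m \<le> n\<close> have "1 / (real n + 1) \<le> 1 / (real m + 1)" by (simp add: frac_le)
  ultimately show "x \<in> far_half \<sigma> n" unfolding far_half_def by auto
qed

lemma half_eq_UN_far_half: "half \<sigma> = (\<Union>n. far_half \<sigma> n)"
proof (intro equalityI subsetI)
  fix x assume "x \<in> half \<sigma>"
  then obtain n where "1 / real (Suc n) < \<sigma> * x"
    using reals_Archimedean[of "\<sigma> * x"] by (auto simp: half_def inverse_eq_divide)
  then show "x \<in> (\<Union>n. far_half \<sigma> n)" by (auto simp: far_half_def add.commute)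
next
  fix x assume "x \<in> (\<Union>n. far_half \<sigma> n)"
  then obtain n where "1 / (real n + 1) < \<sigma> * x" by (auto simp: far_half_def)
  moreover have "0 < 1 / (real n + 1)" by simp
  ultimately show "x \<in> half \<sigma>" unfolding half_def mem_Collect_eq by (rule less_trans[rotated])
qed

context
  fixes S :: "'a measure" and N :: "('a \<times> real) measure"
  assumes N: "sets N = sets (S \<Otimes>\<^sub>M punctured_line)"
begin

lemma Times_sets_marked: "B \<in> sets S \<Longrightarrow> A \<in> sets borel \<Longrightarrow> 0 \<notin> A \<Longrightarrow> B \<times> A \<in> sets N"
  unfolding N by (rule pair_measureI) (auto simp: sets_restrict_space_iff)

lemma measurable_marked_fst: "fst \<in> N \<rightarrow>\<^sub>M S"
  using measurable_cong_sets[OF N refl] measurable_fst by blast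

lemma measurable_marked_snd: "snd \<in> borel_measurable N"
proof -
  have "snd \<in> N \<rightarrow>\<^sub>M punctured_line" using measurable_cong_sets[OF N refl] measurable_snd by blast
  then show ?thesis by (simp add: measurable_restrict_space2_iff)
qed

lemma sets_jump_part: "sets (jump_part S \<sigma> N) = sets S"
  by (simp add: jump_part_def)

lemma emeasure_jump_part_marked:
  assumes B: "B \<in> sets S"
  shows "emeasure (jump_part S \<sigma> N) B = (\<integral>\<^sup>+z. ennreal (\<sigma> * snd z) * indicator (B \<times> UNIV) z \<partial>N)"
proof -
  note measurable_marked_snd[measurable] measurable_marked_fst[measurable]
  have "fst -` B \<inter> space N \<in> sets N" using measurable_marked_fst B by (rule measurable_sets)
  then have "emeasure (jump_part S \<sigma> N) B = (\<integral>\<^sup>+z. ennreal (\<sigma> * snd z) * indicator (fst -` B \<inter> space N) z \<partial>N)"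
    unfolding jump_part_def using B
    by (subst emeasure_distr) (auto simp: emeasure_density measurable_cong_sets[OF sets_density refl])
  also have "\<dots> = (\<integral>\<^sup>+z. ennreal (\<sigma> * snd z) * indicator (B \<times> UNIV) z \<partial>N)"
    by (intro nn_integral_cong) (auto simp: indicator_def mem_Times_iff)
  finally show ?thesis .
qed

lemma emeasure_jump_part:
  assumes B: "B \<in> sets S"
  shows "emeasure (jump_part S \<sigma> N) B = (\<integral>\<^sup>+x. ennreal (\<sigma> * x) \<partial>slice N B)"
  unfolding emeasure_jump_part_marked[OF B] by (rule nn_integral_slice[OF N B, symmetric]) measurable

lemma emeasure_jump_part_eq_0:
  assumes B: "B \<in> sets S" and null: "emeasure N (B \<times> half \<sigma>) = 0"
  shows "emeasure (jump_part S \<sigma> N) B = 0"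
proof -
  have "B \<times> half \<sigma> \<in> null_sets N"
    using null Times_sets_marked[OF B half_sets] by (auto simp: null_sets_def)
  then have "AE z in N. z \<notin> B \<times> half \<sigma>" by (rule AE_not_in)
  then have "AE z in N. ennreal (\<sigma> * snd z) * indicator (B \<times> UNIV) z = 0"
    by eventually_elim (auto simp: half_def indicator_def not_less intro!: ennreal_neg)
  then have "(\<integral>\<^sup>+z. ennreal (\<sigma> * snd z) * indicator (B \<times> UNIV) z \<partial>N) = (\<integral>\<^sup>+z. 0 \<partial>N)"
    by (rule nn_integral_cong_AE)
  then show ?thesis unfolding emeasure_jump_part_marked[OF B] by simp
qed

text \<open>Chebyshev's inequality: \<open>(n + 1) * min 1 \<bar>x\<bar>\<close> is at least 1 on
  \<open>far_half \<sigma> n\<close>.\<close>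

lemma emeasure_far_half_finite:
  assumes B: "B \<in> sets S" and \<sigma>: "\<bar>\<sigma>\<bar> = 1" and fin: "(\<integral>\<^sup>+x. ennreal (min 1 \<bar>x\<bar>) \<partial>slice N B) < \<infinity>"
  shows "emeasure N (B \<times> far_half \<sigma> n) < \<infinity>"
proof -
  have [measurable]: "far_half \<sigma> n \<in> sets punctured_line"
    using far_half_sets by (auto simp: sets_restrict_space_iff)
  have sets: "sets (slice N B) = sets punctured_line" by (simp add: slice_def)
  have mb: "f \<in> borel_measurable (slice N B)" if "f \<in> borel_measurable borel" for f :: "real \<Rightarrow> ennreal"
    using measurable_restrict_space1[OF that] measurable_cong_sets[OF sets refl] by blast
  have "emeasure N (B \<times> far_half \<sigma> n) = emeasure (slice N B) (far_half \<sigma> n)"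
    by (rule emeasure_slice[OF N B, symmetric]) measurable
  also have "\<dots> = (\<integral>\<^sup>+x. indicator (far_half \<sigma> n) x \<partial>slice N B)"
    by (rule nn_integral_indicator[symmetric]) (simp add: sets)
  also have "\<dots> \<le> (\<integral>\<^sup>+x. ennreal (real n + 1) * ennreal (min 1 \<bar>x\<bar>) \<partial>slice N B)"
  proof (rule nn_integral_mono)
    fix x
    have "1 \<le> (real n + 1) * min 1 \<bar>x\<bar>" if "x \<in> far_half \<sigma> n"
    proof -
      have "\<sigma> * x \<le> \<bar>x\<bar>" using abs_ge_self[of "\<sigma> * x"] \<sigma> by (simp add: abs_mult)
      with that have "1 / (real n + 1) < \<bar>x\<bar>" by (auto simp: far_half_def)
      then show ?thesis by (auto simp: min_def field_simps)
    qed
    then show "indicator (far_half \<sigma> n) x \<le> ennreal (real n + 1) * ennreal (min 1 \<bar>x\<bar>)"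
      by (subst ennreal_mult[symmetric]) (auto simp: indicator_def simp del: ennreal_plus)
  qed
  also have "\<dots> = ennreal (real n + 1) * (\<integral>\<^sup>+x. ennreal (min 1 \<bar>x\<bar>) \<partial>slice N B)"
    by (intro nn_integral_cmult mb) measurable
  also have "\<dots> < \<infinity>" using fin by (simp add: ennreal_mult_less_top)
  finally show ?thesis .
qed

lemma emeasure_distr_fst_restrict:
  assumes B: "B \<in> sets S" and A: "A \<in> sets borel" "0 \<notin> A" and T: "T \<in> sets S"
  shows "emeasure (distr (density N (indicator (B \<times> A))) S fst) T = emeasure N ((T \<inter> B) \<times> A)"
proof -
  note measurable_marked_fst[measurable]
  have BA: "B \<times> A \<in> sets N" using B A by (rule Times_sets_marked)
  have mT: "fst -` T \<inter> space N \<in> sets N" using measurable_marked_fst T by (rule measurable_sets)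
  have "emeasure (distr (density N (indicator (B \<times> A))) S fst) T =
      emeasure (density N (indicator (B \<times> A))) (fst -` T \<inter> space N)"
    using T by (subst emeasure_distr) (auto simp: measurable_cong_sets[OF sets_density refl])
  also have "\<dots> = (\<integral>\<^sup>+x. indicator ((B \<times> A) \<inter> (fst -` T \<inter> space N)) x \<partial>N)"
    unfolding indicator_inter_arith[of "B \<times> A"] using mT BA by (subst emeasure_density) auto
  also have "\<dots> = emeasure N ((B \<times> A) \<inter> (fst -` T \<inter> space N))"
    using mT BA by (subst nn_integral_indicator) auto
  also have "(B \<times> A) \<inter> (fst -` T \<inter> space N) = (T \<inter> B) \<times> A"
    using sets.sets_into_space[OF BA] by auto
  finally show ?thesis .
qed

lemma slice_integrable:
  assumes int: "\<And>C. C \<in> sets N \<Longrightarrow> emeasure N C \<in> insert \<infinity> (range of_nat)"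
    and B: "B \<in> sets S" and A: "A \<in> sets S" "A \<subseteq> B"
    and fin: "(\<integral>\<^sup>+x. ennreal (min 1 \<bar>x\<bar>) \<partial>slice N B) < \<infinity>"
  shows "integrable (slice N A) (\<lambda>x. x)"
proof (rule integrableI_bounded)
  have sets: "sets (slice N A) = sets punctured_line" for A by (simp add: slice_def)
  show "(\<lambda>x. x) \<in> borel_measurable (slice N A)"
    unfolding measurable_cong_sets[OF sets refl] by (rule measurable_restrict_space1) simp
  have "emeasure (slice N B) T \<in> insert \<infinity> (range of_nat)" if "T \<in> sets (slice N B)" for T
  proof -
    have T: "T \<in> sets punctured_line" using that by (simp add: sets)
    then have "B \<times> T \<in> sets N" unfolding N using B by (intro pair_measureI)
    from int[OF this] show ?thesis unfolding emeasure_slice[OF N B T] .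
  qed
  from nn_integral_abs_finite_of_truncated[OF sets this fin]
  have "(\<integral>\<^sup>+x. ennreal \<bar>x\<bar> \<partial>slice N B) < \<infinity>" .
  moreover have "(\<integral>\<^sup>+x. ennreal \<bar>x\<bar> \<partial>slice N A) \<le> (\<integral>\<^sup>+x. ennreal \<bar>x\<bar> \<partial>slice N B)"
    using A(2) by (subst (1 2) nn_integral_slice[OF N]) (auto intro!: nn_integral_mono A(1) B simp: indicator_def)
  ultimately show "(\<integral>\<^sup>+x. ennreal (norm x) \<partial>slice N A) < \<infinity>" by (simp add: le_less_trans)
qed

end

text \<open>\<open>N\<close> may be infinite, so the result on integer-valued measures is applied to
  the projections of its restrictions to \<open>U n \<times> far_half \<sigma> n\<close>, which are
  finite. One index serves both truncations because both sequences increase.\<close>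

lemma (in localized_borel_space) marks_carried_by_countable_set:
  assumes N: "sets N = sets (S \<Otimes>\<^sub>M punctured_line)"
    and int: "\<And>C. C \<in> sets N \<Longrightarrow> emeasure N C \<in> insert \<infinity> (range of_nat)"
    and U: "\<And>n. U n \<in> R" "incseq U" "(\<Union>n. U n) = space S"
    and fin: "\<And>n. emeasure N (U n \<times> far_half \<sigma> n) < \<infinity>"
  defines "D \<equiv> {s \<in> space S. emeasure N ({s} \<times> half \<sigma>) \<noteq> 0}"
  shows "countable D" "emeasure N ((space S - D) \<times> half \<sigma>) = 0"
proof -
  have Us: "U n \<in> sets S" for n using U(1) by (rule ring_sets)
  define m where "m n = distr (density N (indicator (U n \<times> far_half \<sigma> n))) S fst" for n
  have UW: "U n \<times> far_half \<sigma> n \<in> sets N" for n by (intro Times_sets_marked[OF N] Us far_half_sets)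
  have sm: "sets (m n) = sets S" for n by (simp add: m_def)
  have em: "emeasure (m n) A = emeasure N ((A \<inter> U n) \<times> far_half \<sigma> n)" if A: "A \<in> sets S" for A n
    unfolding m_def using Us far_half_sets A by (rule emeasure_distr_fst_restrict[OF N])
  have intm: "emeasure (m n) A \<in> range of_nat" if A: "A \<in> sets S" for A n
  proof -
    have "(A \<inter> U n) \<times> far_half \<sigma> n \<in> sets N" using A Us by (intro Times_sets_marked[OF N] far_half_sets) auto
    then have "emeasure N ((A \<inter> U n) \<times> far_half \<sigma> n) \<in> insert \<infinity> (range of_nat)" by (rule int)
    moreover have "emeasure N ((A \<inter> U n) \<times> far_half \<sigma> n) \<le> emeasure N (U n \<times> far_half \<sigma> n)"
      using UW by (intro emeasure_mono) auto
    ultimately show ?thesis using fin[of n] em[OF A] by (auto simp: top_unique)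
  qed
  define D' where "D' n = {s. emeasure (m n) {s} \<noteq> 0}" for n
  have atoms: "countable (D' n)" "emeasure (m n) (space S - D' n) = 0" for n
    unfolding D'_def by (rule integer_measure_carried_by_atoms[OF sm intm]; assumption)+
  have single: "emeasure (m n) {s} = emeasure N ({s} \<times> far_half \<sigma> n)" if "s \<in> U n" for s n
  proof -
    have "s \<in> space S" using that U(3) by blast
    then show ?thesis using em[OF singleton_sets, of s n] that by (simp add: Int_absorb2)
  qed
  have Dsub: "D' n \<inter> U n \<subseteq> D" for n
  proof
    fix s assume s: "s \<in> D' n \<inter> U n"
    then have sS: "s \<in> space S" using U(3) by blast
    have "emeasure N ({s} \<times> far_half \<sigma> n) \<le> emeasure N ({s} \<times> half \<sigma>)"
      using singleton_sets[OF sS] by (intro emeasure_mono Times_sets_marked[OF N] half_sets) (auto simp: half_eq_UN_far_half)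
    with s single[of s n] sS show "s \<in> D" by (auto simp: D_def D'_def)
  qed
  have "D \<subseteq> (\<Union>n. D' n)"
  proof
    fix s assume s: "s \<in> D"
    then have sS: "s \<in> space S" by (simp add: D_def)
    have "\<exists>n. emeasure N ({s} \<times> far_half \<sigma> n) \<noteq> 0"
    proof (rule ccontr)
      assume "\<not> ?thesis"
      then have "(\<Union>n. {s} \<times> far_half \<sigma> n) \<in> null_sets N"
        using singleton_sets[OF sS]
        by (intro null_sets_UN) (auto simp: null_sets_def intro!: Times_sets_marked[OF N] far_half_sets)
      moreover have "(\<Union>n. {s} \<times> far_half \<sigma> n) = {s} \<times> half \<sigma>" by (auto simp: half_eq_UN_far_half)
      ultimately show False using s by (auto simp: D_def null_sets_def)
    qed
    then obtain i where i: "emeasure N ({s} \<times> far_half \<sigma> i) \<noteq> 0" by blast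
    obtain j where j: "s \<in> U j" using sS U(3) by blast
    let ?n = "max i j"
    have "emeasure N ({s} \<times> far_half \<sigma> i) \<le> emeasure N ({s} \<times> far_half \<sigma> ?n)"
      using singleton_sets[OF sS] far_half_mono[of i ?n \<sigma>]
      by (intro emeasure_mono Times_sets_marked[OF N] far_half_sets) auto
    moreover have "s \<in> U ?n" using j incseqD[OF U(2), of j ?n] by auto
    ultimately have "s \<in> D' ?n" using i single[of s ?n] by (auto simp: D'_def)
    then show "s \<in> (\<Union>n. D' n)" by blast
  qed
  then show "countable D" by (rule countable_subset) (auto intro: atoms(1))
  then have Ds: "D \<in> sets S"
    by (intro sets.countable[OF singleton_sets]) (auto simp: D_def)
  have "(U n - D) \<times> far_half \<sigma> n \<in> null_sets N" for n
  proof -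
    have "emeasure (m n) (U n - D) \<le> emeasure (m n) (space S - D' n)"
    proof (rule emeasure_mono)
      show "U n - D \<subseteq> space S - D' n" using Dsub[of n] U(3) by blast
      have "D' n \<subseteq> space S"
      proof
        fix s assume "s \<in> D' n"
        then have "{s} \<in> sets (m n)" using emeasure_notin_sets[of "{s}" "m n"] by (auto simp: D'_def)
        then show "s \<in> space S" using sets.sets_into_space[of "{s}" S] by (simp add: sm)
      qed
      then have "D' n \<in> sets S" using atoms(1)[of n] by (intro sets.countable[OF singleton_sets]) (auto simp: subset_eq)
      then show "space S - D' n \<in> sets (m n)" by (auto simp: sm)
    qed
    then have "emeasure (m n) (U n - D) = 0" using atoms(2) by simp
    moreover have "(U n - D) \<inter> U n = U n - D" by auto
    ultimately show ?thesis
      using em[of "U n - D" n] Us[of n] Ds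
      by (auto simp: null_sets_def intro!: Times_sets_marked[OF N] far_half_sets)
  qed
  then have "(\<Union>n. (U n - D) \<times> far_half \<sigma> n) \<in> null_sets N" by (rule null_sets_UN)
  moreover have "(\<Union>n. (U n - D) \<times> far_half \<sigma> n) = (space S - D) \<times> half \<sigma>"
  proof (intro equalityI subsetI)
    fix z assume "z \<in> (space S - D) \<times> half \<sigma>"
    then have "fst z \<in> (\<Union>n. U n)" "fst z \<notin> D" "snd z \<in> (\<Union>n. far_half \<sigma> n)"
      unfolding U(3) half_eq_UN_far_half by auto
    then obtain i j where z: "fst z \<in> U i" "fst z \<notin> D" "snd z \<in> far_half \<sigma> j" by auto
    then have "fst z \<in> U (max i j)" "snd z \<in> far_half \<sigma> (max i j)"
      using incseqD[OF U(2), of i "max i j"] far_half_mono[of j "max i j" \<sigma>] by auto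
    with z show "z \<in> (\<Union>n. (U n - D) \<times> far_half \<sigma> n)" by (auto simp: mem_Times_iff)
  qed (use U(3) in \<open>auto simp: half_eq_UN_far_half\<close>)
  ultimately show "emeasure N ((space S - D) \<times> half \<sigma>) = 0" by (simp add: null_sets_def)
qed

section \<open>Dyadic partitions and the absence of points with marks of both signs\<close>

definition dyadic_cell :: "nat \<Rightarrow> real \<Rightarrow> nat" where "dyadic_cell k x = nat \<lfloor>2 ^ k * exp x\<rfloor>"

lemma dyadic_cell_Suc: "dyadic_cell k x = dyadic_cell (Suc k) x div 2"
proof -
  have "\<lfloor>2 ^ Suc k * exp x / real_of_int 2\<rfloor> = \<lfloor>2 ^ Suc k * exp x\<rfloor> div 2"
    by (rule floor_divide_real_eq_div) simp
  then have "\<lfloor>2 ^ k * exp x\<rfloor> = \<lfloor>2 ^ Suc k * exp x\<rfloor> div 2" by simp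
  then show ?thesis unfolding dyadic_cell_def by (simp add: nat_div_distrib)
qed

text \<open>The exponential makes the argument of the floor positive, so \<open>nat\<close>
  identifies no two cells, and points of a common cell of level \<open>k\<close> have exponentials
  less than \<open>1 / 2 ^ k\<close> apart.\<close>

lemma dyadic_cell_separates:
  assumes eq: "\<And>k. dyadic_cell k x = dyadic_cell k y"
  shows "x = y"
proof (rule ccontr)
  assume "x \<noteq> y"
  then have d: "0 < \<bar>exp x - exp y\<bar>" by simp
  obtain k where k: "1 / \<bar>exp x - exp y\<bar> < 2 ^ k" using real_arch_pow[of 2] by auto
  have "\<lfloor>2 ^ k * exp x\<rfloor> = \<lfloor>2 ^ k * exp y\<rfloor>"
    using eq[of k] by (simp add: dyadic_cell_def eq_nat_nat_iff)
  then have "\<bar>2 ^ k * exp x - 2 ^ k * exp y\<bar> < 1" by linarith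
  then have "2 ^ k * \<bar>exp x - exp y\<bar> < 1"
    by (simp add: abs_mult flip: right_diff_distrib)
  with k d show False by (simp add: field_simps)
qed

lemma measurable_dyadic_cell: "dyadic_cell k \<in> borel \<rightarrow>\<^sub>M count_space UNIV"
  unfolding dyadic_cell_def by measurable

text \<open>The probability that some cell of level \<open>k\<close> carries both kinds of marks is at most the mass
  that the product of the two intensities gives to the union of the squares of these cells. As
  \<open>k\<close> grows the squares shrink to the diagonal, which is a null set because the intensity is
  diffuse.\<close>

lemma (in localized_borel_space) no_common_atoms:
  assumes "prob_space M" and \<Psi>: "poisson_process M F \<Psi>" and F: "sets F = sets (S \<Otimes>\<^sub>M punctured_line)"
    and diffuse: "\<And>s. s \<in> space S \<Longrightarrow> emeasure F ({s} \<times> - {0}) = 0"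
    and B: "B \<in> sets S" and A: "A \<in> sets borel" "0 \<notin> A" and A': "A' \<in> sets borel" "0 \<notin> A'"
    and disj: "A \<inter> A' = {}"
    and fin: "emeasure F (B \<times> A) < \<infinity>" "emeasure F (B \<times> A') < \<infinity>"
  shows "AE \<omega> in M. \<forall>s\<in>B. emeasure (\<Psi> \<omega>) ({s} \<times> A) = 0 \<or> emeasure (\<Psi> \<omega>) ({s} \<times> A') = 0"
proof -
  interpret prob_space M by fact
  have \<Psi>s: "sets (\<Psi> \<omega>) = sets F" if "\<omega> \<in> space M" for \<omega>
    using \<Psi> that by (auto simp: poisson_process_def)
  have \<Psi>int: "emeasure (\<Psi> \<omega>) C \<in> insert \<infinity> (range of_nat)" if "\<omega> \<in> space M" "C \<in> sets F" for \<omega> C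
    using \<Psi> that by (auto simp: poisson_process_def)
  have \<Psi>m: "(\<lambda>\<omega>. emeasure (\<Psi> \<omega>) C) \<in> borel_measurable M" if "C \<in> sets F" for C
    using \<Psi> that by (auto simp: poisson_process_def)
  have cr: "completely_random M (sets F) (\<lambda>\<omega>. emeasure (\<Psi> \<omega>))"
    using \<Psi> by (auto simp: poisson_process_def)
  note prodF = Times_sets_marked[OF F]
  obtain f :: "'a \<Rightarrow> real" where f: "f \<in> borel_measurable S" "inj_on f (space S)"
    by (rule real_embedding) auto
  define G where "G A = distr (density F (indicator (B \<times> A))) S fst" for A
  have Gs: "sets (G A) = sets S" "space (G A) = space S" for A by (auto simp: G_def)
  have G: "emeasure (G X) T = emeasure F ((T \<inter> B) \<times> X)" if "X \<in> sets borel" "0 \<notin> X" "T \<in> sets S" for X T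
    unfolding G_def by (rule emeasure_distr_fst_restrict[OF F B that])
  have Bsub: "B \<subseteq> space S" using B by (rule sets.sets_into_space)
  have Gfin: "finite_measure (G X)" if "X \<in> sets borel" "0 \<notin> X" "emeasure F (B \<times> X) < \<infinity>" for X
    using G[OF that(1,2), of "space S"] that(3) Bsub by (intro finite_measureI) (auto simp: Gs Int_absorb1)
  interpret G: finite_measure "G A" by (rule Gfin[OF A fin(1)])
  interpret G': finite_measure "G A'" by (rule Gfin[OF A' fin(2)])
  define q where "q k s = dyadic_cell k (f s)" for k s
  have q[measurable]: "q k \<in> S \<rightarrow>\<^sub>M count_space UNIV" for k
    unfolding q_def using f(1) by (rule measurable_compose[OF _ measurable_dyadic_cell])
  define P where "P k j = {s \<in> space S. q k s = j}" for k j
  have Pm: "P k j \<in> sets S" for k j unfolding P_def by measurable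
  let ?GG = "G A \<Otimes>\<^sub>M G A'"
  have GGs: "sets ?GG = sets (S \<Otimes>\<^sub>M S)" by (intro sets_pair_measure_cong Gs)
  \<comment> \<open>Numbering the cells by naturals makes this neighbourhood of the diagonal a
    countable disjoint union of squares, ready for a union bound.\<close>
  define E where "E k = (\<Union>j. P k j \<times> P k j)" for k
  have Em: "E k \<in> sets ?GG" for k
    unfolding E_def GGs using Pm by (intro sets.countable_UN) (auto intro!: pair_measureI)
  have E_iff: "(s, t) \<in> E k \<longleftrightarrow> s \<in> space S \<and> t \<in> space S \<and> q k s = q k t" for s t k
    by (auto simp: E_def P_def)
  have "emeasure ?GG (\<Inter>k. E k) = (\<integral>\<^sup>+s. emeasure (G A') (Pair s -` (\<Inter>k. E k)) \<partial>G A)"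
    using Em by (intro G'.emeasure_pair_measure_alt) (auto intro!: sets.countable_INT)
  also have "\<dots> = (\<integral>\<^sup>+s. 0 \<partial>G A)"
  proof (rule nn_integral_cong)
    fix s assume "s \<in> space (G A)"
    then have s: "s \<in> space S" by (simp add: Gs)
    have "Pair s -` (\<Inter>k. E k) \<subseteq> {s}"
    proof
      fix t assume "t \<in> Pair s -` (\<Inter>k. E k)"
      then have "t \<in> space S" "\<And>k. q k s = q k t" by (auto simp: E_iff)
      then show "t \<in> {s}" using dyadic_cell_separates[of "f s" "f t"] f(2) s by (auto simp: q_def dest: inj_onD)
    qed
    then have "emeasure (G A') (Pair s -` (\<Inter>k. E k)) \<le> emeasure (G A') {s}"
      using singleton_sets[OF s] by (intro emeasure_mono) (auto simp: Gs)
    also have "\<dots> = emeasure F (({s} \<inter> B) \<times> A')"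
      by (rule G[OF A' singleton_sets[OF s]])
    also have "\<dots> \<le> emeasure F ({s} \<times> - {0})"
      using singleton_sets[OF s] A' by (intro emeasure_mono prodF) auto
    finally show "emeasure (G A') (Pair s -` (\<Inter>k. E k)) = 0" using diffuse[OF s] by simp
  qed
  finally have E0: "emeasure ?GG (\<Inter>k. E k) = 0" by simp
  have "decseq E"
  proof (rule decseq_SucI)
    fix k show "E (Suc k) \<subseteq> E k"
      using dyadic_cell_Suc[of k] by (auto simp: E_iff q_def)
  qed
  moreover have "emeasure ?GG (E k) \<noteq> \<infinity>" for k
  proof -
    interpret GG: finite_measure ?GG
      by (rule finite_measure_pair_measure) unfold_locales
    show ?thesis by (simp add: GG.emeasure_eq_measure)
  qed
  ultimately have E_lim: "(\<lambda>k. emeasure ?GG (E k)) \<longlonglongrightarrow> 0"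
    using Lim_emeasure_decseq[of E ?GG] Em E0 by auto
  define C where "C X k j = (P k j \<inter> B) \<times> X" for X :: "real set" and k j
  have Cm: "C X k j \<in> sets F" if "X \<in> sets borel" "0 \<notin> X" for X k j
    unfolding C_def using Pm B that by (intro prodF) auto
  define bad where "bad k j = {\<omega> \<in> space M. 1 \<le> emeasure (\<Psi> \<omega>) (C A k j)} \<inter>
      {\<omega> \<in> space M. 1 \<le> emeasure (\<Psi> \<omega>) (C A' k j)}" for k j
  have ge1: "{\<omega> \<in> space M. 1 \<le> emeasure (\<Psi> \<omega>) (C X k j)} \<in> events" if "X \<in> sets borel" "0 \<notin> X" for X k j
    using \<Psi>m[OF Cm[OF that]] by measurable
  have badm: "bad k j \<in> events" for k j
    unfolding bad_def using ge1[OF A] ge1[OF A'] by auto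
  have bad_le: "emeasure M (bad k j) \<le> emeasure ?GG (P k j \<times> P k j)" for k j
  proof -
    \<comment> \<open>The two products are disjoint because \<open>A\<close> and \<open>A'\<close>
      are, so complete randomness factors the probability that both are occupied.\<close>
    let ?C = "\<lambda>b. if b then C A k j else C A' k j"
    let ?ev = "\<lambda>b. {\<omega> \<in> space M. 1 \<le> emeasure (\<Psi> \<omega>) (?C b)}"
    have "indep_sets (\<lambda>b. {(\<lambda>\<omega>. emeasure (\<Psi> \<omega>) (?C b)) -` T \<inter> space M | T. T \<in> sets borel}) UNIV"
    proof (rule completely_random_indep_sets[OF cr])
      show "range ?C \<subseteq> sets F" using Cm[OF A] Cm[OF A'] by auto
      show "disjoint_family ?C" using disj by (auto simp: disjoint_family_on_def C_def)
    qed simp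
    then have "prob (\<Inter>b\<in>UNIV. ?ev b) = (\<Prod>b\<in>UNIV. prob (?ev b))"
    proof (rule indep_setsD)
      show "\<forall>b\<in>UNIV. ?ev b \<in> {(\<lambda>\<omega>. emeasure (\<Psi> \<omega>) (?C b)) -` T \<inter> space M | T. T \<in> sets borel}"
      proof
        fix b
        have "?ev b = (\<lambda>\<omega>. emeasure (\<Psi> \<omega>) (?C b)) -` {1..} \<inter> space M" by auto
        then show "?ev b \<in> {(\<lambda>\<omega>. emeasure (\<Psi> \<omega>) (?C b)) -` T \<inter> space M | T. T \<in> sets borel}"
          by (intro CollectI exI[of _ "{1..}"]) auto
      qed
    qed auto
    then have "prob (bad k j) = prob (?ev True) * prob (?ev False)"
      by (simp add: UNIV_bool bad_def Int_commute mult.commute)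
    then have "emeasure M (bad k j) = emeasure M (?ev True) * emeasure M (?ev False)"
      by (simp add: emeasure_eq_measure ennreal_mult)
    also have "\<dots> \<le> emeasure F (C A k j) * emeasure F (C A' k j)"
      using poisson_process_prob_ge_1_le[OF \<Psi> Cm[OF A]] poisson_process_prob_ge_1_le[OF \<Psi> Cm[OF A']]
      by (intro mult_mono) auto
    also have "\<dots> = emeasure (G A) (P k j) * emeasure (G A') (P k j)"
      using G[OF A Pm] G[OF A' Pm] by (simp add: C_def)
    also have "\<dots> = emeasure ?GG (P k j \<times> P k j)"
      using Pm by (intro G'.emeasure_pair_measure_Times[symmetric]) (auto simp: Gs)
    finally show ?thesis .
  qed
  have UN_le: "emeasure M (\<Union>j. bad k j) \<le> emeasure ?GG (E k)" for k
  proof -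
    have "emeasure M (\<Union>j. bad k j) \<le> (\<Sum>j. emeasure M (bad k j))"
      using badm by (intro emeasure_subadditive_countably) auto
    also have "\<dots> \<le> (\<Sum>j. emeasure ?GG (P k j \<times> P k j))"
      by (intro suminf_le bad_le) auto
    also have "\<dots> = emeasure ?GG (E k)"
      unfolding E_def
    proof (rule suminf_emeasure)
      show "range (\<lambda>j. P k j \<times> P k j) \<subseteq> sets ?GG" using Pm by (auto simp: Gs intro!: pair_measureI)
      show "disjoint_family (\<lambda>j. P k j \<times> P k j)" by (auto simp: disjoint_family_on_def P_def)
    qed
    finally show ?thesis .
  qed
  have "emeasure M (\<Inter>k. \<Union>j. bad k j) \<le> 0"
  proof (rule LIMSEQ_le_const[OF E_lim], intro exI allI impI)
    fix k :: nat
    have "emeasure M (\<Inter>k. \<Union>j. bad k j) \<le> emeasure M (\<Union>j. bad k j)"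
      using badm by (intro emeasure_mono) auto
    with UN_le[of k] show "emeasure M (\<Inter>k. \<Union>j. bad k j) \<le> emeasure ?GG (E k)" by (rule order_trans[rotated])
  qed
  then have "(\<Inter>k. \<Union>j. bad k j) \<in> null_sets M"
    using badm by (auto simp: null_sets_def intro!: sets.countable_INT)
  then have "AE \<omega> in M. \<omega> \<notin> (\<Inter>k. \<Union>j. bad k j)" by (rule AE_not_in)
  then show ?thesis
    using AE_space
  proof eventually_elim
    case (elim \<omega>)
    then obtain k where k: "\<And>j. \<omega> \<notin> bad k j" by auto
    show ?case
    proof (rule ballI, rule ccontr)
      fix s assume s: "s \<in> B" and "\<not> (emeasure (\<Psi> \<omega>) ({s} \<times> A) = 0 \<or> emeasure (\<Psi> \<omega>) ({s} \<times> A') = 0)"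
      then have ne: "emeasure (\<Psi> \<omega>) ({s} \<times> A) \<noteq> 0" "emeasure (\<Psi> \<omega>) ({s} \<times> A') \<noteq> 0" by auto
      have sS: "s \<in> space S" using s Bsub by auto
      \<comment> \<open>A nonzero count is at least 1 by integrality, so a point with both kinds of
        marks makes its cell bad at whatever level.\<close>
      have "1 \<le> emeasure (\<Psi> \<omega>) (C X k (q k s))"
        if X: "X \<in> sets borel" "0 \<notin> X" and nz: "emeasure (\<Psi> \<omega>) ({s} \<times> X) \<noteq> 0" for X
      proof -
        have "{s} \<times> X \<in> sets F" using singleton_sets[OF sS] X by (intro prodF)
        from \<Psi>int[OF elim(2) this] nz have "1 \<le> emeasure (\<Psi> \<omega>) ({s} \<times> X)"
          by (auto simp: ennreal_of_nat_eq_real_of_nat)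
        also have "\<dots> \<le> emeasure (\<Psi> \<omega>) (C X k (q k s))"
          using Cm[OF X] \<Psi>s[OF elim(2)] sS s by (intro emeasure_mono) (auto simp: C_def P_def)
        finally show ?thesis .
      qed
      from this[OF A ne(1)] this[OF A' ne(2)] have "\<omega> \<in> bad k (q k s)"
        using elim(2) by (simp add: bad_def)
      with k show False by blast
    qed
  qed
qed

text \<open>The bound on common atoms needs finite intensities, which hold on \<open>U n\<close> for
  marks in \<open>far_half 1 n\<close> and \<open>far_half (- 1) n\<close>. Countably many
  \<open>n\<close> cost only a null set, and a point with marks of both signs would be detected at
  every sufficiently large \<open>n\<close>.\<close>

lemma (in localized_borel_space) no_opposite_marks:
  assumes "prob_space M" and \<Psi>: "poisson_process M F \<Psi>" and F: "sets F = sets (S \<Otimes>\<^sub>M punctured_line)"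
    and diffuse: "\<And>s. s \<in> space S \<Longrightarrow> emeasure F ({s} \<times> - {0}) = 0"
    and U: "\<And>n. U n \<in> R" "incseq U" "(\<Union>n. U n) = space S"
    and fin: "\<And>n. (\<integral>\<^sup>+x. ennreal (min 1 \<bar>x\<bar>) \<partial>slice F (U n)) < \<infinity>"
  shows "AE \<omega> in M. \<forall>s\<in>space S. emeasure (\<Psi> \<omega>) ({s} \<times> half 1) = 0 \<or> emeasure (\<Psi> \<omega>) ({s} \<times> half (- 1)) = 0"
proof -
  have Us: "U n \<in> sets S" for n using U(1) by (rule ring_sets)
  have "AE \<omega> in M. \<forall>s\<in>U n. emeasure (\<Psi> \<omega>) ({s} \<times> far_half 1 n) = 0 \<or> emeasure (\<Psi> \<omega>) ({s} \<times> far_half (- 1) n) = 0" for n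
  proof (rule no_common_atoms[OF assms(1) \<Psi> F diffuse Us far_half_sets far_half_sets])
    show "far_half 1 n \<inter> far_half (- 1) n = {}"
    proof (intro equals0I)
      fix x assume "x \<in> far_half 1 n \<inter> far_half (- 1) n"
      then have "x \<in> half 1" "x \<in> half (- 1)" by (auto simp: half_eq_UN_far_half)
      then show False by (simp add: half_def)
    qed
  qed (use emeasure_far_half_finite[OF F Us _ fin, of 1 n n] emeasure_far_half_finite[OF F Us _ fin, of "- 1" n n] in auto)
  then have "AE \<omega> in M. \<forall>n. \<forall>s\<in>U n. emeasure (\<Psi> \<omega>) ({s} \<times> far_half 1 n) = 0 \<or> emeasure (\<Psi> \<omega>) ({s} \<times> far_half (- 1) n) = 0"
    by (simp add: AE_all_countable)
  then show ?thesis
    using AE_space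
  proof eventually_elim
    case (elim \<omega>)
    have N: "sets (\<Psi> \<omega>) = sets (S \<Otimes>\<^sub>M punctured_line)"
      using \<Psi> elim(2) F by (auto simp: poisson_process_def)
    show ?case
    proof
      fix s assume s: "s \<in> space S"
      note tm = Times_sets_marked[OF N singleton_sets[OF s] far_half_sets]
      obtain i where i: "s \<in> U i" using s U(3) by blast
      have ex: "\<exists>n. emeasure (\<Psi> \<omega>) ({s} \<times> far_half \<sigma> n) \<noteq> 0" if "emeasure (\<Psi> \<omega>) ({s} \<times> half \<sigma>) \<noteq> 0" for \<sigma>
      proof (rule ccontr)
        assume "\<not> ?thesis"
        then have "(\<Union>n. {s} \<times> far_half \<sigma> n) \<in> null_sets (\<Psi> \<omega>)"
          using tm by (intro null_sets_UN) (auto simp: null_sets_def)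
        moreover have "(\<Union>n. {s} \<times> far_half \<sigma> n) = {s} \<times> half \<sigma>" by (auto simp: half_eq_UN_far_half)
        ultimately show False using that by (auto simp: null_sets_def)
      qed
      have mono: "emeasure (\<Psi> \<omega>) ({s} \<times> far_half \<sigma> m) \<le> emeasure (\<Psi> \<omega>) ({s} \<times> far_half \<sigma> n)" if "m \<le> n" for \<sigma> m n
        using tm far_half_mono[OF that, of \<sigma>] by (intro emeasure_mono) auto
      show "emeasure (\<Psi> \<omega>) ({s} \<times> half 1) = 0 \<or> emeasure (\<Psi> \<omega>) ({s} \<times> half (- 1)) = 0"
      proof (rule ccontr)
        assume "\<not> ?thesis"
        then obtain m n where mn: "emeasure (\<Psi> \<omega>) ({s} \<times> far_half 1 m) \<noteq> 0" "emeasure (\<Psi> \<omega>) ({s} \<times> far_half (- 1) n) \<noteq> 0"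
          using ex by blast
        define l where "l = max i (max m n)"
        have "s \<in> U l" using i incseqD[OF U(2), of i l] by (auto simp: l_def)
        moreover have "emeasure (\<Psi> \<omega>) ({s} \<times> far_half 1 l) \<noteq> 0" "emeasure (\<Psi> \<omega>) ({s} \<times> far_half (- 1) l) \<noteq> 0"
          using mn mono[of m l 1] mono[of n l "- 1"] unfolding l_def
          by (metis le_zero_eq max.cobounded1 max.coboundedI2 max.cobounded2)+
        ultimately show False using elim(1) by blast
      qed
    qed
  qed
qed

section \<open>The Jordan decomposition of a completely random signed measure\<close>

lemma half_pos: "half 1 = {0<..}" and half_neg: "half (- 1) = {..<0}"
  by (auto simp: half_def)

text \<open>A deterministic statement whose hypotheses hold for almost every configuration. With
  \<open>\<sigma> = - 1\<close> it describes the negative part, since that is the positive part of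
  \<open>- \<xi>\<close>.\<close>

lemma (in localized_borel_space) jordan_pos_marked:
  assumes N: "sets N = sets (S \<Otimes>\<^sub>M punctured_line)"
    and int: "\<And>C. C \<in> sets N \<Longrightarrow> emeasure N C \<in> insert \<infinity> (range of_nat)"
    and U: "\<And>n. U n \<in> R" "incseq U" "(\<Union>n. U n) = space S" "\<And>B. B \<in> R \<Longrightarrow> \<exists>n. B \<subseteq> U n"
    and fin: "\<And>n. (\<integral>\<^sup>+x. ennreal (min 1 \<bar>x\<bar>) \<partial>slice N (U n)) < \<infinity>"
    and opp: "\<And>s. s \<in> space S \<Longrightarrow> emeasure N ({s} \<times> half 1) = 0 \<or> emeasure N ({s} \<times> half (- 1)) = 0"
    and \<xi>: "ring_additive R \<xi>" and \<alpha>: "ring_additive R \<alpha>"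
    and null: "\<And>D. D \<in> R \<Longrightarrow> countable D \<Longrightarrow> \<alpha> D = 0"
    and rep: "\<And>B. B \<in> R \<Longrightarrow> \<xi> B = \<alpha> B + (\<integral>x. x \<partial>slice N B)"
    and \<sigma>: "\<sigma> = 1 \<or> \<sigma> = - 1" and B: "B \<in> R"
  shows "emeasure (jordan_pos S R (\<lambda>B. \<sigma> * \<xi> B)) B =
      emeasure (jordan_pos S R (\<lambda>B. \<sigma> * \<alpha> B)) B + emeasure (jump_part S \<sigma> N) B"
    and "emeasure (jump_part S \<sigma> N) B < \<infinity>"
    and "set_integrable (slice N B) (half \<sigma>) (\<lambda>x. x)"
    and "measure (jump_part S \<sigma> N) B = \<sigma> * (LINT x:half \<sigma>|slice N B. x)"
proof -
  have Us: "U n \<in> sets S" for n using U(1) by (rule ring_sets)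
  have abs\<sigma>: "\<bar>\<sigma>\<bar> = 1" "\<bar>- \<sigma>\<bar> = 1" and \<sigma>\<sigma>: "\<sigma> * \<sigma> = 1" using \<sigma> by auto
  have ring: "ring_additive R (\<lambda>B. \<sigma> * \<mu> B)" if "ring_additive R \<mu>" for \<mu>
    using \<sigma> that ring_additive_uminus[OF that] by auto
  have integ: "integrable (slice N B) (\<lambda>x. x)" if B: "B \<in> R" for B
  proof -
    obtain n where n: "B \<subseteq> U n" using U(4)[OF B] by blast
    show ?thesis by (rule slice_integrable[OF N int Us ring_sets[OF B] n fin]; assumption)
  qed
  have jump: "emeasure (jump_part S \<tau> N) B = (\<integral>\<^sup>+x. ennreal (\<tau> * x) \<partial>slice N B)" if "B \<in> R" for B \<tau>
    by (rule emeasure_jump_part[OF N ring_sets[OF that]])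
  have jfin: "emeasure (jump_part S \<tau> N) B < \<infinity>" if B: "B \<in> R" and \<tau>: "\<bar>\<tau>\<bar> = 1" for B \<tau>
  proof -
    have "(\<integral>\<^sup>+x. ennreal (\<tau> * x) \<partial>slice N B) \<le> (\<integral>\<^sup>+x. ennreal (norm x) \<partial>slice N B)"
    proof (intro nn_integral_mono ennreal_leI)
      fix x show "\<tau> * x \<le> norm x" using abs_ge_self[of "\<tau> * x"] \<tau> by (simp add: abs_mult)
    qed
    also have "\<dots> < \<infinity>" using integ[OF B] by (simp add: integrable_iff_bounded)
    finally show ?thesis unfolding jump[OF B] .
  qed
  have LFM: "jump_part S \<tau> N \<in> space (locally_finite_measures S R)" if "\<bar>\<tau>\<bar> = 1" for \<tau>
    using jfin[OF _ that] by (auto simp: space_locally_finite_measures sets_jump_part[OF N])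
  \<comment> \<open>The Lebesgue integral is the difference of the integrals of the positive and
    negative parts of the integrand, and these are the masses of the two jump measures.\<close>
  have split: "(\<integral>x. x \<partial>slice N B) = measure (jump_part S 1 N) B - measure (jump_part S (- 1) N) B"
    if B: "B \<in> R" for B
    using real_lebesgue_integral_def[OF integ[OF B]] by (simp add: measure_def jump[OF B])
  have eq: "\<sigma> * \<xi> B = \<sigma> * \<alpha> B + measure (jump_part S \<sigma> N) B - measure (jump_part S (- \<sigma>) N) B"
    if B: "B \<in> R" for B
    using rep[OF B] split[OF B] \<sigma> by (auto simp: algebra_simps)
  define D where "D \<tau> = {s \<in> space S. emeasure N ({s} \<times> half \<tau>) \<noteq> 0}" for \<tau>
  have D: "countable (D \<tau>)" "emeasure N ((space S - D \<tau>) \<times> half \<tau>) = 0" if "\<bar>\<tau>\<bar> = 1" for \<tau>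
    unfolding D_def
    by (rule marks_carried_by_countable_set[OF N int U(1,2,3) emeasure_far_half_finite[OF N Us that fin]]; assumption)+
  have Ds: "D \<tau> \<in> sets S" if "\<bar>\<tau>\<bar> = 1" for \<tau>
    using D(1)[OF that] by (intro sets.countable[OF singleton_sets]) (auto simp: D_def)
  have carried: "emeasure (jump_part S \<tau> N) (space S - D \<tau>) = 0" if "\<bar>\<tau>\<bar> = 1" for \<tau>
    using Ds[OF that] D(2)[OF that] by (intro emeasure_jump_part_eq_0[OF N]) auto
  have sing: "emeasure N ({s} \<times> half (- \<sigma>)) = 0" if "s \<in> D \<sigma>" for s
    using that opp[of s] \<sigma> by (auto simp: D_def)
  \<comment> \<open>No fibre over \<open>D \<sigma>\<close> carries marks of the opposite sign, and
    there are only countably many such fibres. This is the singularity that the variation of the sum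
    requires.\<close>
  have "(\<Union>s\<in>D \<sigma>. {s} \<times> half (- \<sigma>)) \<in> null_sets N"
    using D(1)[OF abs\<sigma>(1)] sing
    by (intro null_sets_UN') (auto simp: null_sets_def D_def intro!: Times_sets_marked[OF N] singleton_sets half_sets)
  moreover have "(\<Union>s\<in>D \<sigma>. {s} \<times> half (- \<sigma>)) = D \<sigma> \<times> half (- \<sigma>)" by auto
  ultimately have "emeasure N (D \<sigma> \<times> half (- \<sigma>)) = 0" by (simp add: null_sets_def)
  then have opp0: "emeasure (jump_part S (- \<sigma>) N) (D \<sigma>) = 0"
    by (intro emeasure_jump_part_eq_0[OF N Ds[OF abs\<sigma>(1)]])
  have "pos_variation R (\<lambda>B. \<sigma> * \<xi> B) B = pos_variation R (\<lambda>B. \<sigma> * \<alpha> B) B + emeasure (jump_part S \<sigma> N) B"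
  proof (rule pos_variation_singular_sum[OF ring[OF \<xi>] ring[OF \<alpha>] LFM LFM eq Ds carried opp0 Ds carried _ B])
    fix E assume "E \<in> R" "E \<subseteq> D \<sigma> \<union> D (- \<sigma>)"
    then have "countable E" using D(1) abs\<sigma> by (meson countable_Un countable_subset)
    with \<open>E \<in> R\<close> show "\<sigma> * \<alpha> E = 0" by (simp add: null)
  qed (use abs\<sigma> in auto)
  then show "emeasure (jordan_pos S R (\<lambda>B. \<sigma> * \<xi> B)) B =
      emeasure (jordan_pos S R (\<lambda>B. \<sigma> * \<alpha> B)) B + emeasure (jump_part S \<sigma> N) B"
    by (simp add: emeasure_jordan_pos ring \<xi> \<alpha> ring_sets[OF B])
  show "emeasure (jump_part S \<sigma> N) B < \<infinity>" using B abs\<sigma>(1) by (rule jfin)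
  have sets: "sets (slice N B) = sets punctured_line" by (simp add: slice_def)
  have hs: "half \<sigma> \<in> sets (slice N B)"
    unfolding sets using half_sets by (auto simp: sets_restrict_space_iff)
  show si: "set_integrable (slice N B) (half \<sigma>) (\<lambda>x. x)"
    unfolding set_integrable_def using hs integ[OF B] by (rule integrable_mult_indicator)
  \<comment> \<open>On \<open>half \<sigma>\<close> the integrand is nonnegative, and off it the
    cutoff by \<open>ennreal\<close> has the same effect as the indicator.\<close>
  have "(LINT x:half \<sigma>|slice N B. \<sigma> * x) = enn2real (\<integral>\<^sup>+x. ennreal (indicator (half \<sigma>) x *\<^sub>R (\<sigma> * x)) \<partial>slice N B)"
    unfolding set_lebesgue_integral_def
  proof (rule integral_eq_nn_integral)
    have "(\<lambda>x. indicator (half \<sigma>) x *\<^sub>R (\<sigma> * x)) \<in> borel_measurable borel" using half_sets(1) by measurable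
    then show "(\<lambda>x. indicator (half \<sigma>) x *\<^sub>R (\<sigma> * x)) \<in> borel_measurable (slice N B)"
      unfolding measurable_cong_sets[OF sets refl] by (rule measurable_restrict_space1)
  qed (auto simp: indicator_def half_def)
  also have "(\<integral>\<^sup>+x. ennreal (indicator (half \<sigma>) x *\<^sub>R (\<sigma> * x)) \<partial>slice N B) = (\<integral>\<^sup>+x. ennreal (\<sigma> * x) \<partial>slice N B)"
    by (intro nn_integral_cong) (auto simp: indicator_def half_def not_less ennreal_neg)
  finally show "measure (jump_part S \<sigma> N) B = \<sigma> * (LINT x:half \<sigma>|slice N B. x)"
    by (simp add: measure_def jump[OF B])
qed

text \<open>Marks of the other sign do not count, so the integral is one against the restriction of
  \<open>\<Psi> \<omega>\<close> to \<open>B \<times> half \<sigma>\<close>. This locality serves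
  twice: disjoint sets \<open>B\<close> give complete randomness, the two disjoint half-lines give
  independence of the two parts.\<close>

lemma measurable_jump_part_history:
  assumes \<Psi>: "\<And>\<omega>. \<omega> \<in> space M \<Longrightarrow> sets (\<Psi> \<omega>) = sets F" and F: "sets F = sets (S \<Otimes>\<^sub>M punctured_line)"
    and B: "B \<in> sets S"
  shows "(\<lambda>\<omega>. emeasure (jump_part S \<sigma> (\<Psi> \<omega>)) B)
    \<in> borel_measurable (sigma (space M) (history M \<Psi> {D \<in> sets F. D \<subseteq> B \<times> half \<sigma>}))"
    (is "_ \<in> borel_measurable ?H")
proof -
  have sp: "space ?H = space M" by (simp add: space_measure_of_conv)
  have \<Psi>': "sets (\<Psi> \<omega>) = sets (S \<Otimes>\<^sub>M punctured_line)" if "\<omega> \<in> space ?H" for \<omega>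
    using that \<Psi>[of \<omega>] unfolding sp by (simp add: F)
  have BF: "B \<times> half \<sigma> \<in> sets F" by (rule Times_sets_marked[OF F B half_sets])
  note measurable_marked_snd[OF F, measurable]
  let ?K = "\<lambda>\<omega>. density (\<Psi> \<omega>) (indicator (B \<times> half \<sigma>))"
  have "(\<lambda>\<omega>. \<integral>\<^sup>+z. ennreal (\<sigma> * snd z) \<partial>?K \<omega>) \<in> borel_measurable ?H"
  proof (rule borel_measurable_nn_integral_kernel)
    show "sets (?K \<omega>) = sets F" if "\<omega> \<in> space ?H" for \<omega> using \<Psi>'[OF that] F by simp
    show "(\<lambda>z. ennreal (\<sigma> * snd z)) \<in> borel_measurable F" by measurable
    fix C assume C: "C \<in> sets F"
    have "emeasure (?K \<omega>) C = emeasure (\<Psi> \<omega>) ((B \<times> half \<sigma>) \<inter> C)" if "\<omega> \<in> space ?H" for \<omega>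
    proof -
      have "emeasure (?K \<omega>) C = (\<integral>\<^sup>+x. indicator ((B \<times> half \<sigma>) \<inter> C) x \<partial>\<Psi> \<omega>)"
        unfolding indicator_inter_arith[of "B \<times> half \<sigma>"] using BF C \<Psi>'[OF that] F by (subst emeasure_density) auto
      then show ?thesis using BF C \<Psi>'[OF that] F by (subst (asm) nn_integral_indicator) auto
    qed
    moreover have "(\<lambda>\<omega>. emeasure (\<Psi> \<omega>) ((B \<times> half \<sigma>) \<inter> C)) \<in> borel_measurable ?H"
      using BF C by (intro measurable_emeasure_history) auto
    ultimately show "(\<lambda>\<omega>. emeasure (?K \<omega>) C) \<in> borel_measurable ?H"
      using measurable_cong[of ?H] by (metis (no_types, lifting))
  qed
  moreover have "(\<integral>\<^sup>+z. ennreal (\<sigma> * snd z) \<partial>?K \<omega>) = emeasure (jump_part S \<sigma> (\<Psi> \<omega>)) B" if "\<omega> \<in> space ?H" for \<omega>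
  proof -
    note N = \<Psi>'[OF that]
    note measurable_marked_snd[OF N, measurable]
    have "(\<integral>\<^sup>+z. ennreal (\<sigma> * snd z) \<partial>?K \<omega>) = (\<integral>\<^sup>+z. indicator (B \<times> half \<sigma>) z * ennreal (\<sigma> * snd z) \<partial>\<Psi> \<omega>)"
      using BF N F by (intro nn_integral_density) auto
    also have "\<dots> = (\<integral>\<^sup>+z. ennreal (\<sigma> * snd z) * indicator (B \<times> UNIV) z \<partial>\<Psi> \<omega>)"
      by (intro nn_integral_cong) (auto simp: indicator_def half_def not_less intro!: ennreal_neg)
    also have "\<dots> = emeasure (jump_part S \<sigma> (\<Psi> \<omega>)) B" by (rule emeasure_jump_part_marked[OF N B, symmetric])
    finally show ?thesis .
  qed
  ultimately show ?thesis using measurable_cong[of ?H] by (metis (no_types, lifting))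
qed

theorem corollary2p24:
  fixes \<Omega> :: "'w measure" and S :: "'a measure" and R :: "'a set set"
    and \<xi> :: "'w \<Rightarrow> 'a set \<Rightarrow> real" and \<alpha> :: "'a set \<Rightarrow> real"
    and F :: "('a \<times> real) measure" and \<Psi> :: "'w \<Rightarrow> ('a \<times> real) measure"
  assumes "prob_space \<Omega>"
    and "localized_borel_space S R"
    and "random_signed_measure \<Omega> R \<xi>"
    and "completely_random \<Omega> R \<xi>"
    and "atomless \<Omega> S \<xi>"
    and "poisson_representation \<Omega> S R \<xi> \<alpha> F \<Psi>"
  shows "random_measure \<Omega> S R (\<lambda>\<omega>. jordan_pos S R (\<xi> \<omega>)) \<and>
    random_measure \<Omega> S R (\<lambda>\<omega>. jordan_neg S R (\<xi> \<omega>)) \<and>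
    prob_space.indep_var \<Omega>
      (locally_finite_measures S R) (\<lambda>\<omega>. jordan_pos S R (\<xi> \<omega>))
      (locally_finite_measures S R) (\<lambda>\<omega>. jordan_neg S R (\<xi> \<omega>)) \<and>
    completely_random \<Omega> R (\<lambda>\<omega>. emeasure (jordan_pos S R (\<xi> \<omega>))) \<and>
    completely_random \<Omega> R (\<lambda>\<omega>. emeasure (jordan_neg S R (\<xi> \<omega>))) \<and>
    atomless \<Omega> S (\<lambda>\<omega>. emeasure (jordan_pos S R (\<xi> \<omega>))) \<and>
    atomless \<Omega> S (\<lambda>\<omega>. emeasure (jordan_neg S R (\<xi> \<omega>))) \<and>
    (AE \<omega> in \<Omega>. \<forall>B\<in>R.
      set_integrable (slice (\<Psi> \<omega>) B) {0<..} (\<lambda>x. x) \<and>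
      measure (jordan_pos S R (\<xi> \<omega>)) B =
        measure (jordan_pos S R \<alpha>) B + (LINT x:{0<..}|slice (\<Psi> \<omega>) B. x)) \<and>
    (AE \<omega> in \<Omega>. \<forall>B\<in>R.
      set_integrable (slice (\<Psi> \<omega>) B) {..<0} (\<lambda>x. x) \<and>
      measure (jordan_neg S R (\<xi> \<omega>)) B =
        measure (jordan_neg S R \<alpha>) B - (LINT x:{..<0}|slice (\<Psi> \<omega>) B. x))"
proof -
  interpret prob_space \<Omega> by fact
  interpret localized_borel_space S R by fact
  obtain U :: "nat \<Rightarrow> 'a set" where U: "\<And>n. U n \<in> R" "incseq U" "(\<Union>n. U n) = space S"
    "\<And>B. B \<in> R \<Longrightarrow> \<exists>n. B \<subseteq> U n"
    by (rule exhausting_sequence) blast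
  have Us: "U n \<in> sets S" for n using U(1) by (rule ring_sets)
  have Rne: "R \<noteq> {}" using U(1) by blast
  have rep: "AE \<omega> in \<Omega>. \<forall>B\<in>R. \<xi> \<omega> B = \<alpha> B + (\<integral>x. x \<partial>slice (\<Psi> \<omega>) B)"
    and F: "sets F = sets (S \<Otimes>\<^sub>M punctured_line)"
    and Ffin: "\<And>B. B \<in> R \<Longrightarrow> (\<integral>\<^sup>+x. ennreal (min 1 \<bar>x\<bar>) \<partial>slice F B) < \<infinity>"
    and Fnull: "\<And>s. s \<in> space S \<Longrightarrow> emeasure F ({s} \<times> - {0}) = 0"
    and \<Psi>: "poisson_process \<Omega> F \<Psi>"
    and \<alpha>_space: "\<alpha> \<in> space (local_signed_measures R)"
    using assms(6) unfolding poisson_representation_def by auto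
  obtain \<mu> \<nu> where \<mu>: "\<mu> \<in> space (locally_finite_measures S R)" and \<nu>: "\<nu> \<in> space (locally_finite_measures S R)"
    and diffuse: "\<And>s. s \<in> space S \<Longrightarrow> emeasure \<mu> {s} = 0 \<and> emeasure \<nu> {s} = 0"
    and \<alpha>_eq: "\<And>B. B \<in> R \<Longrightarrow> \<alpha> B = measure \<mu> B - measure \<nu> B"
    using assms(6) unfolding poisson_representation_def by blast
  have \<alpha>: "ring_additive R \<alpha>"
    using \<alpha>_space by (simp add: space_local_signed_measures[OF Rne] local_signed_measure_additive)
  have null: "\<alpha> D = 0" if D: "D \<in> R" "countable D" for D
  proof -
    have DS: "D \<subseteq> space S" using ring_sets[OF D(1)] by (rule sets.sets_into_space)
    have "measure \<kappa> D = 0" if "sets \<kappa> = sets S" "\<And>s. s \<in> space S \<Longrightarrow> emeasure \<kappa> {s} = 0" for \<kappa>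
    proof -
      have "(\<Union>s\<in>D. {s}) \<in> null_sets \<kappa>"
        using D(2) DS that singleton_sets by (intro null_sets_UN') (auto simp: null_sets_def)
      then show ?thesis by (simp add: null_sets_def measure_def)
    qed
    with \<mu> \<nu> diffuse \<alpha>_eq[OF D(1)] show ?thesis by (simp add: space_locally_finite_measures)
  qed
  have \<xi>_add: "ring_additive R (\<xi> \<omega>)" if "\<omega> \<in> space \<Omega>" for \<omega>
    using measurable_space[OF assms(3) that]
    by (simp add: space_local_signed_measures[OF Rne] local_signed_measure_additive)
  have \<xi>_meas: "(\<lambda>\<omega>. \<xi> \<omega> B) \<in> borel_measurable \<Omega>" if B: "B \<in> R" for B
  proof -
    have "(\<lambda>\<mu>. \<mu> B) \<in> borel_measurable (local_signed_measures R)"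
      unfolding local_signed_measures_def using B
      by (intro measurable_Sup1[OF _ measurable_vimage_algebra1]) auto
    with assms(3) show ?thesis by (rule measurable_compose)
  qed
  have \<Psi>s: "sets (\<Psi> \<omega>) = sets F" if "\<omega> \<in> space \<Omega>" for \<omega>
    using \<Psi> that by (auto simp: poisson_process_def)
  have \<Psi>m: "(\<lambda>\<omega>. emeasure (\<Psi> \<omega>) C) \<in> borel_measurable \<Omega>" if "C \<in> sets F" for C
    using \<Psi> that by (auto simp: poisson_process_def)
  have cr: "completely_random \<Omega> (sets F) (\<lambda>\<omega>. emeasure (\<Psi> \<omega>))"
    using \<Psi> by (auto simp: poisson_process_def)
  \<comment> \<open>The expectation of the truncated integral is at most the corresponding integral
    under \<open>F\<close>, which is finite on \<open>U n\<close>. Using only the countably many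
    \<open>U n\<close> yields one exceptional null set for all members of \<open>R\<close>.\<close>
  have "AE \<omega> in \<Omega>. (\<integral>\<^sup>+x. ennreal (min 1 \<bar>x\<bar>) \<partial>slice (\<Psi> \<omega>) (U n)) < \<infinity>" for n
  proof -
    note measurable_marked_snd[OF F, measurable]
    let ?h = "\<lambda>z. ennreal (min 1 \<bar>snd z\<bar>) * indicator (U n \<times> UNIV) z"
    have "fst -` U n \<inter> space F \<in> sets F" using measurable_marked_fst[OF F] Us by (rule measurable_sets)
    then have "(\<lambda>z. ennreal (min 1 \<bar>snd z\<bar>) * indicator (fst -` U n \<inter> space F) z) \<in> borel_measurable F"
      by measurable
    then have h: "?h \<in> borel_measurable F"
      by (rule measurable_cong[THEN iffD1, rotated]) (auto simp: indicator_def mem_Times_iff)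
    have "(\<integral>\<^sup>+\<omega>. \<integral>\<^sup>+z. ?h z \<partial>\<Psi> \<omega> \<partial>\<Omega>) \<le> (\<integral>\<^sup>+z. ?h z \<partial>F)"
      by (rule poisson_process_nn_integral_mean_le[OF \<Psi> h])
    also have "\<dots> = (\<integral>\<^sup>+x. ennreal (min 1 \<bar>x\<bar>) \<partial>slice F (U n))"
      by (rule nn_integral_slice[OF F Us, symmetric]) measurable
    also have "\<dots> < \<infinity>" by (rule Ffin[OF U(1)])
    finally have "(\<integral>\<^sup>+\<omega>. \<integral>\<^sup>+z. ?h z \<partial>\<Psi> \<omega> \<partial>\<Omega>) \<noteq> \<infinity>" by simp
    moreover have "(\<lambda>\<omega>. \<integral>\<^sup>+z. ?h z \<partial>\<Psi> \<omega>) \<in> borel_measurable \<Omega>"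
      by (rule borel_measurable_nn_integral_kernel[OF \<Psi>s \<Psi>m h]; assumption)
    ultimately have "AE \<omega> in \<Omega>. (\<integral>\<^sup>+z. ?h z \<partial>\<Psi> \<omega>) \<noteq> \<infinity>"
      by (rule nn_integral_PInf_AE[rotated])
    then show ?thesis
      using AE_space
    proof eventually_elim
      case (elim \<omega>)
      have "sets (\<Psi> \<omega>) = sets (S \<Otimes>\<^sub>M punctured_line)" using \<Psi>s[OF elim(2)] F by simp
      from nn_integral_slice[OF this Us, of "\<lambda>x. ennreal (min 1 \<bar>x\<bar>)"] elim(1)
      show ?case by (simp add: top.not_eq_extremum)
    qed
  qed
  then have fin: "AE \<omega> in \<Omega>. \<forall>n. (\<integral>\<^sup>+x. ennreal (min 1 \<bar>x\<bar>) \<partial>slice (\<Psi> \<omega>) (U n)) < \<infinity>"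
    by (simp add: AE_all_countable)
  have opp: "AE \<omega> in \<Omega>. \<forall>s\<in>space S. emeasure (\<Psi> \<omega>) ({s} \<times> half 1) = 0 \<or> emeasure (\<Psi> \<omega>) ({s} \<times> half (- 1)) = 0"
    by (rule no_opposite_marks[OF assms(1) \<Psi> F Fnull U(1,2,3) Ffin[OF U(1)]])
  \<comment> \<open>\<open>X 1\<close> is the positive part and \<open>X (- 1)\<close> the negative
    part.\<close>
  define X where "X \<sigma> \<omega> = jordan_pos S R (\<lambda>B. \<sigma> * \<xi> \<omega> B)" for \<sigma> \<omega>
  define a where "a \<sigma> = jordan_pos S R (\<lambda>B. \<sigma> * \<alpha> B)" for \<sigma>
  have X_eq: "jordan_pos S R (\<xi> \<omega>) = X 1 \<omega>" "jordan_neg S R (\<xi> \<omega>) = X (- 1) \<omega>" for \<omega>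
    by (simp_all add: X_def jordan_neg_eq_jordan_pos)
  have a_eq: "jordan_pos S R \<alpha> = a 1" "jordan_neg S R \<alpha> = a (- 1)"
    by (simp_all add: a_def jordan_neg_eq_jordan_pos)
  have ring: "ring_additive R (\<lambda>B. \<sigma> * \<kappa> B)" if "ring_additive R \<kappa>" "\<sigma> = 1 \<or> \<sigma> = - 1" for \<kappa> \<sigma>
    using that ring_additive_uminus[OF that(1)] by auto
  \<comment> \<open>The quantifier over the possibly uncountable ring can stand inside because the
    exceptional sets come from \<open>rep\<close>, \<open>fin\<close> and \<open>opp\<close>, none
    of which depends on a chosen \<open>B\<close>.\<close>
  have key: "AE \<omega> in \<Omega>. \<forall>B\<in>R.
      emeasure (X \<sigma> \<omega>) B = emeasure (a \<sigma>) B + emeasure (jump_part S \<sigma> (\<Psi> \<omega>)) B \<and>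
      set_integrable (slice (\<Psi> \<omega>) B) (half \<sigma>) (\<lambda>x. x) \<and>
      measure (X \<sigma> \<omega>) B = measure (a \<sigma>) B + \<sigma> * (LINT x:half \<sigma>|slice (\<Psi> \<omega>) B. x)"
    if \<sigma>: "\<sigma> = 1 \<or> \<sigma> = - 1" for \<sigma>
    using rep fin opp AE_space
  proof eventually_elim
    case (elim \<omega>)
    have int: "emeasure (\<Psi> \<omega>) C \<in> insert \<infinity> (range of_nat)" if "C \<in> sets (\<Psi> \<omega>)" for C
      using \<Psi> elim(4) that \<Psi>s[OF elim(4)] by (auto simp: poisson_process_def)
    have N: "sets (\<Psi> \<omega>) = sets (S \<Otimes>\<^sub>M punctured_line)" using \<Psi>s[OF elim(4)] F by simp
    show ?case
    proof
      fix B assume B: "B \<in> R"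
      have fin: "(\<integral>\<^sup>+x. ennreal (min 1 \<bar>x\<bar>) \<partial>slice (\<Psi> \<omega>) (U n)) < \<infinity>" for n using elim(2) by blast
      have opp: "emeasure (\<Psi> \<omega>) ({s} \<times> half 1) = 0 \<or> emeasure (\<Psi> \<omega>) ({s} \<times> half (- 1)) = 0" if "s \<in> space S" for s
        using elim(3) that by blast
      have rep: "\<xi> \<omega> B = \<alpha> B + (\<integral>x. x \<partial>slice (\<Psi> \<omega>) B)" if "B \<in> R" for B using elim(1) that by blast
      note J = jordan_pos_marked[OF N int U fin opp \<xi>_add[OF elim(4)] \<alpha> null rep \<sigma> B, folded X_def a_def]
      have afin: "emeasure (a \<sigma>) B < \<infinity>"
        using jordan_pos_in_space[OF ring[OF \<alpha> \<sigma>]] B by (simp add: a_def space_locally_finite_measures)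
      have 1: "emeasure (X \<sigma> \<omega>) B = emeasure (a \<sigma>) B + emeasure (jump_part S \<sigma> (\<Psi> \<omega>)) B"
        and 2: "emeasure (jump_part S \<sigma> (\<Psi> \<omega>)) B < \<infinity>"
        and 3: "set_integrable (slice (\<Psi> \<omega>) B) (half \<sigma>) (\<lambda>x. x)"
        and 4: "measure (jump_part S \<sigma> (\<Psi> \<omega>)) B = \<sigma> * (LINT x:half \<sigma>|slice (\<Psi> \<omega>) B. x)"
        by (rule J; assumption)+
      have "measure (X \<sigma> \<omega>) B = measure (a \<sigma>) B + measure (jump_part S \<sigma> (\<Psi> \<omega>)) B"
        using afin 2 unfolding measure_def 1 by (intro enn2real_plus) auto
      with 1 3 4 show "emeasure (X \<sigma> \<omega>) B = emeasure (a \<sigma>) B + emeasure (jump_part S \<sigma> (\<Psi> \<omega>)) B \<and>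
        set_integrable (slice (\<Psi> \<omega>) B) (half \<sigma>) (\<lambda>x. x) \<and>
        measure (X \<sigma> \<omega>) B = measure (a \<sigma>) B + \<sigma> * (LINT x:half \<sigma>|slice (\<Psi> \<omega>) B. x)"
        by simp
    qed
  qed
  have sgn_meas: "(\<lambda>\<omega>. \<sigma> * \<xi> \<omega> B) \<in> borel_measurable \<Omega>" if "B \<in> R" for \<sigma> B
    using \<xi>_meas[OF that] by measurable
  have X_space: "X \<sigma> \<omega> \<in> space (locally_finite_measures S R)" if "\<sigma> = 1 \<or> \<sigma> = - 1" "\<omega> \<in> space \<Omega>" for \<sigma> \<omega>
    unfolding X_def using ring[OF \<xi>_add[OF that(2)] that(1)] by (rule jordan_pos_in_space)
  \<comment> \<open>Taken from the countable supremum and not from \<open>key\<close>: an almost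
    sure identity gives no measurability without completeness of \<open>\<Omega>\<close>.\<close>
  have X_meas: "(\<lambda>\<omega>. emeasure (X \<sigma> \<omega>) B) \<in> borel_measurable \<Omega>" if "\<sigma> = 1 \<or> \<sigma> = - 1" "B \<in> R" for \<sigma> B
    unfolding X_def by (rule borel_measurable_jordan_pos[OF ring[OF \<xi>_add that(1)] sgn_meas that(2)])
  have X_random: "random_measure \<Omega> S R (X \<sigma>)" if "\<sigma> = 1 \<or> \<sigma> = - 1" for \<sigma>
    by (rule measurable_locally_finite_measures[OF X_space[OF that] X_meas[OF that]])
  define H where "H C = history \<Omega> \<Psi> {D \<in> sets F. D \<subseteq> C}" for C
  have H: "sigma_algebra (space \<Omega>) (H C)" "H C \<subseteq> events" for C
    unfolding H_def using \<Psi>m by (intro sigma_algebra_history, intro history_subset_sets) auto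
  \<comment> \<open>The completed field of the restriction of \<open>\<Psi>\<close> to
    \<open>C\<close>; completion absorbs the null set on which the formula in \<open>key\<close> may
    fail.\<close>
  define G where "G C = sigma (space \<Omega>) (ae_closure \<Omega> (H C))" for C
  have G: "space (G C) = space \<Omega>" "sets (G C) = ae_closure \<Omega> (H C)" for C
    unfolding G_def using sigma_algebra_ae_closure[OF H]
    by (simp_all add: sigma_algebra.sets_measure_of_eq sigma_algebra.space_measure_of_eq)
  have X_G: "(\<lambda>\<omega>. emeasure (X \<sigma> \<omega>) B) \<in> borel_measurable (G (B \<times> half \<sigma>))"
    if \<sigma>: "\<sigma> = 1 \<or> \<sigma> = - 1" and B: "B \<in> R" for \<sigma> B
    unfolding G_def
  proof (rule measurable_ae_closure[OF H X_meas[OF \<sigma> B]])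
    have "(\<lambda>\<omega>. emeasure (jump_part S \<sigma> (\<Psi> \<omega>)) B) \<in> borel_measurable (sigma (space \<Omega>) (H (B \<times> half \<sigma>)))"
      unfolding H_def by (rule measurable_jump_part_history[OF \<Psi>s F ring_sets[OF B]])
    then show "(\<lambda>\<omega>. emeasure (a \<sigma>) B + emeasure (jump_part S \<sigma> (\<Psi> \<omega>)) B)
        \<in> borel_measurable (sigma (space \<Omega>) (H (B \<times> half \<sigma>)))"
      by measurable
    show "AE \<omega> in \<Omega>. emeasure (X \<sigma> \<omega>) B = emeasure (a \<sigma>) B + emeasure (jump_part S \<sigma> (\<Psi> \<omega>)) B"
      using key[OF \<sigma>] by eventually_elim (use B in blast)
  qed
  have G_mono: "sets (G C) \<subseteq> sets (G C')" if "C \<subseteq> C'" for C C'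
    unfolding G ae_closure_def H_def
    using history_mono[of "{D \<in> sets F. D \<subseteq> C}" "{D \<in> sets F. D \<subseteq> C'}"] that by blast
  have indep_G: "indep_sets (\<lambda>i. sets (G (C i))) I"
    if "finite I" "C ` I \<subseteq> sets F" "disjoint_family_on C I" for I :: "'i set" and C
    unfolding G H_def by (rule indep_sets_ae_closure[OF indep_sets_history[OF cr \<Psi>s \<Psi>m that]])
  have X_cr: "completely_random \<Omega> R (\<lambda>\<omega>. emeasure (X \<sigma> \<omega>))" if \<sigma>: "\<sigma> = 1 \<or> \<sigma> = - 1" for \<sigma>
    unfolding completely_random_def
  proof (intro allI impI)
    fix n :: nat and A :: "nat \<Rightarrow> 'a set" assume A: "A ` {..<n} \<subseteq> R" "disjoint_family_on A {..<n}"
    have AR: "A i \<in> R" if "i < n" for i using A(1) that by auto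
    show "indep_vars (\<lambda>_. borel) (\<lambda>i \<omega>. emeasure (X \<sigma> \<omega>) (A i)) {..<n}"
      unfolding indep_vars_def2
    proof (intro conjI ballI)
      have "indep_sets (\<lambda>i. sets (G (A i \<times> half \<sigma>))) {..<n}"
      proof (rule indep_G)
        show "(\<lambda>i. A i \<times> half \<sigma>) ` {..<n} \<subseteq> sets F"
          using AR ring_sets by (auto intro!: Times_sets_marked[OF F] half_sets)
        show "disjoint_family_on (\<lambda>i. A i \<times> half \<sigma>) {..<n}"
          using A(2) unfolding disjoint_family_on_def by blast
      qed simp
      then show "indep_sets (\<lambda>i. {(\<lambda>\<omega>. emeasure (X \<sigma> \<omega>) (A i)) -` T \<inter> space \<Omega> | T. T \<in> sets borel}) {..<n}"
      proof (rule indep_sets_mono_sets)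
        fix i assume "i \<in> {..<n}"
        then have "(\<lambda>\<omega>. emeasure (X \<sigma> \<omega>) (A i)) \<in> borel_measurable (G (A i \<times> half \<sigma>))"
          using AR by (intro X_G[OF \<sigma>]) auto
        from measurable_sets[OF this] show "{(\<lambda>\<omega>. emeasure (X \<sigma> \<omega>) (A i)) -` T \<inter> space \<Omega> | T. T \<in> sets borel}
            \<subseteq> sets (G (A i \<times> half \<sigma>))"
          by (auto simp: G(1))
      qed
    qed (use AR X_meas[OF \<sigma>] in auto)
  qed
  \<comment> \<open>Independence of the two parts concerns them as random elements, so all values of
    \<open>X \<sigma>\<close> must be measurable for a single field. The field over all of
    \<open>S\<close> contains those over the sets \<open>B\<close>.\<close>
  have X_GG: "X \<sigma> \<in> G (space S \<times> half \<sigma>) \<rightarrow>\<^sub>M locally_finite_measures S R" if \<sigma>: "\<sigma> = 1 \<or> \<sigma> = - 1" for \<sigma>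
  proof (rule measurable_locally_finite_measures)
    show "X \<sigma> \<omega> \<in> space (locally_finite_measures S R)" if "\<omega> \<in> space (G (space S \<times> half \<sigma>))" for \<omega>
      using X_space[OF \<sigma>] that by (simp add: G)
    fix B assume B: "B \<in> R"
    have "B \<times> half \<sigma> \<subseteq> space S \<times> half \<sigma>" using ring_sets[OF B] sets.sets_into_space by blast
    from G_mono[OF this] show "(\<lambda>\<omega>. emeasure (X \<sigma> \<omega>) B) \<in> borel_measurable (G (space S \<times> half \<sigma>))"
      using X_G[OF \<sigma> B] by (auto simp: measurable_def G(1))
  qed
  have "indep_var (locally_finite_measures S R) (X 1) (locally_finite_measures S R) (X (- 1))"
    unfolding indep_var_def indep_vars_def2
  proof (intro conjI ballI)
    \<comment> \<open>\<open>indep_var\<close> is indexed by truth values; they are translated into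
      signs, and distinct signs give disjoint half-lines.\<close>
    let ?s = "\<lambda>b. if b then 1 else - 1 :: real"
    have "indep_sets (\<lambda>b. sets (G (space S \<times> half (?s b)))) UNIV"
    proof (rule indep_G)
      show "range (\<lambda>b. space S \<times> half (?s b)) \<subseteq> sets F"
        by (auto intro!: Times_sets_marked[OF F] half_sets)
      show "disjoint_family (\<lambda>b. space S \<times> half (?s b))"
        by (auto simp: disjoint_family_on_def half_def)
    qed simp
    then show "indep_sets (\<lambda>b. {case_bool (X 1) (X (- 1)) b -` T \<inter> space \<Omega> | T.
        T \<in> sets (case_bool (locally_finite_measures S R) (locally_finite_measures S R) b)}) UNIV"
    proof (rule indep_sets_mono_sets)
      fix b
      have "X (?s b) \<in> G (space S \<times> half (?s b)) \<rightarrow>\<^sub>M locally_finite_measures S R" by (rule X_GG) simp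
      from measurable_sets[OF this]
      show "{case_bool (X 1) (X (- 1)) b -` T \<inter> space \<Omega> | T.
          T \<in> sets (case_bool (locally_finite_measures S R) (locally_finite_measures S R) b)}
          \<subseteq> sets (G (space S \<times> half (?s b)))"
        by (cases b) (auto simp: G(1))
    qed
    show "case_bool (X 1) (X (- 1)) b \<in> \<Omega> \<rightarrow>\<^sub>M case_bool (locally_finite_measures S R) (locally_finite_measures S R) b" for b
      using X_random by (cases b) auto
  qed
  moreover have "atomless \<Omega> S (\<lambda>\<omega>. emeasure (X \<sigma> \<omega>))" if \<sigma>: "\<sigma> = 1 \<or> \<sigma> = - 1" for \<sigma>
    unfolding X_def
  proof (rule atomless_jordan_pos[OF ring[OF \<xi>_add \<sigma>] sgn_meas finite_measure_axioms])
    show "atomless \<Omega> S (\<lambda>\<omega> B. \<sigma> * \<xi> \<omega> B)"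
      using assms(5) \<sigma> unfolding atomless_def by auto
  qed
  moreover have "AE \<omega> in \<Omega>. \<forall>B\<in>R. set_integrable (slice (\<Psi> \<omega>) B) {0<..} (\<lambda>x. x) \<and>
      measure (X 1 \<omega>) B = measure (a 1) B + (LINT x:{0<..}|slice (\<Psi> \<omega>) B. x)"
    using key[OF disjI1[OF refl]] unfolding half_pos by eventually_elim simp
  moreover have "AE \<omega> in \<Omega>. \<forall>B\<in>R. set_integrable (slice (\<Psi> \<omega>) B) {..<0} (\<lambda>x. x) \<and>
      measure (X (- 1) \<omega>) B = measure (a (- 1)) B - (LINT x:{..<0}|slice (\<Psi> \<omega>) B. x)"
    using key[OF disjI2[OF refl]] unfolding half_neg by eventually_elim simp
  ultimately show ?thesis
    unfolding X_eq a_eq using X_random X_cr by blast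
qed

end
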